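(* Let $N\in\mathbb N$ and let $\mathsf A$ be any one of the four non-commutative spheres $C(S^{N-1}_{\mathbb C,+})$, $C(\overline S^{N-1}_{\mathbb C})$, $C(S^{N-1}_{\mathbb C,**})$, $C(\overline S^{N-1}_{\mathbb C,**})$ (defined in the context), with generators $z_1,\dots,z_N$, regarded as a unital $C^*$-subalgebra of $B(\mathsf h)$, and let $\mathsf A_0$ be the unital $*$-subalgebra generated by $z_1,\dots,z_N$. Let $\mathsf k=\mathbb C^N$ with standard orthonormal basis $e_1,\dots,e_N$ and let $c_1,\dots,c_N\in\mathbb C$. Then the gauge-free generator $$\phi=\begin{bmatrix}\tau&\delta^\dagger\\ \delta&0\end{bmatrix}:\mathsf A_0\to\mathsf A_0\,\underline\otimes\,B(\widehat{\mathsf k}),\qquad\delta(x)=\sum_{j=1}^Nc_jd_j(x)\otimes|e_j\rangle,\quad\tau(x)=-\tfrac12\sum_{j=1}^N|c_j|^2d_j^2(x),\quad\delta^\dagger(x)=\delta(x^* )^*,$$ is well defined, where $d_j:\mathsf A_0\to\mathsf A_0$ is the derivation with $d_j(b)=n_j(b)b$ for each word $b$ in $z_1,z_1^*,\dots,z_N,z_N^*$, with $n_j(b)$ the number of copies of $z_j$ in $b$ minus the number of copies of $z_j^*$ in $b$. Moreover the quantum stochastic differential equation $j_0(x)=x\otimes I_{\mathcal F}$, $\mathrm dj_t(x)=\widetilde{\jmath}_t(\phi(x))\,\mathrm d\Lambda_t$ $(x\in\mathsf A_0)$ has a weakly multiplicative strong solution $j$, and this solution is $*$-homomorphic in the strong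 sense: each $j_t$ extends to a $*$-homomorphism from $\mathsf A$ to $B(\mathsf h\otimes\mathcal F)$.
   Context: The spheres. $C(S^{N-1}_{\mathbb C,+})$ is the universal unital $C^*$-algebra generated by $z_1,\dots,z_N$ subject to $\sum_{i=1}^Nz_iz_i^*=\sum_{i=1}^Nz_i^*z_i=1$. The others are its quotients by the closed two-sided ideals generated by the following relations, where, for $a=z_i$, the symbol $\alpha$ denotes either of $z_i$, $z_i^*$ (and likewise $\beta$ for $b$, $\gamma$ for $c$): - $C(\overline S^{N-1}_{\mathbb C})$: $\alpha\beta=-\beta\alpha$ for all distinct $a,b\in\{z_i\}$, and $\alpha\beta=\beta\alpha$ otherwise (i.e. if $a=b$); - $C(S^{N-1}_{\mathbb C,**})$: $abc=cba$ for all $a,b,c\in\{z_i,z_i^*:1\le i\le N\}$; - $C(\overline S^{N-1}_{\mathbb C,**})$: $\alpha\beta\gamma=-\gamma\beta\alpha$ for all distinct $a,b,c\in\{z_i\}$, and $\alpha\beta\gamma=\gamma\beta\alpha$ otherwise (i.e. if $a,b,c\in\{z_i\}$ are not all distinct). Words include the empty word $1_{\mathsf A}=I_{\mathsf h}$. Solutions. Inner products are linear in the second argument; $\underline\otimes$ is the algebraic tensor product; $\widehat{\mathsf k}:=\mathbb C\oplus\mathsf k$ (block matrices are with respect to this decomposition) and $\widehat z:=(1,z)$ for $z\in\mathsf k$. For a Hilbert space $\mathsf H$ (and any first tensor factor $\mathsf h'$) and $z\in\mathsf H$, $E_z:\mathsf h'\to\mathsf h'\otimes\mathsf H$, $u\mapsto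 u\otimes z$, and $E^z:=E_z^*$. $\Delta:=I_{\mathsf h\otimes\mathcal F}\otimes P_{\mathsf k}$ with $P_{\mathsf k}$ the orthogonal projection of $\widehat{\mathsf k}$ onto $\{0\}\oplus\mathsf k$, and $\Delta^\perp:=I-\Delta$. $\mathcal F$ is the Boson Fock space over $L^2(\mathbb R_+;\mathsf k)$, with exponential vectors $\varepsilon(f)=((n!)^{-1/2}f^{\otimes n})_{n\ge0}$ and $\varpi(f)=\exp(-\frac12\|f\|^2)\varepsilon(f)$; $L^{\mathrm{step}}$ denotes the $\mathsf k$-valued, right-continuous, compactly supported step functions and $\mathcal E$ the linear span of their exponential vectors. A solution $j$ is a family of linear maps $j_t$, $t\ge0$, from $\mathsf A_0$ to the linear operators $\mathsf h\underline\otimes\mathcal E\to\mathsf h\otimes\mathcal F$ such that, for each $x\in\mathsf A_0$, $X_t=j_t(x)$ is an operator process: $t\mapsto X_t\xi$ is weakly measurable for $\xi\in\mathsf h\underline\otimes\mathcal E$, and $E^{\varpi(f)}X_tE_{\varpi(g)}=\langle\varpi(1_{[t,\infty)}f),\varpi(1_{[t,\infty)}g)\rangle E^{\varpi(1_{[0,t)}f)}X_tE_{\varpi(1_{[0,t)}g)}$ for all $f,g\in L^{\mathrm{step}}$. Let $\widetilde{\jmath}_t(y\otimes T):=j_t(y)\underline\otimes T$ for $y\in\mathsf A_0$, $T\in B(\widehat{\mathsf k})$, extended linearly to $\mathsf A_0\underline\otimes B(\widehat{\mathsf k})$. It is a strong solution if, for each $x\in\mathsf A_0$: $j_0(x)=x\otimes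 I_{\mathcal F}$; $L_t=\widetilde{\jmath}_t(\phi(x))$ is an integrable process, i.e. $E^{\varpi(f)\otimes\xi}L_tE_{\varpi(g)\otimes\zeta}=\langle\varpi(1_{[t,\infty)}f),\varpi(1_{[t,\infty)}g)\rangle E^{\varpi(1_{[0,t)}f)\otimes\xi}L_tE_{\varpi(1_{[0,t)}g)\otimes\zeta}$ for almost all $t$ (all $f,g\in L^{\mathrm{step}}$, $\xi,\zeta\in\widehat{\mathsf k}$), $t\mapsto L_t\theta$ is strongly measurable for $\theta\in\mathsf h\underline\otimes\mathcal E\underline\otimes\widehat{\mathsf k}$, $t\mapsto\Delta^\perp L_t(u\otimes\varpi(f)\otimes\widehat{f(t)})$ is locally integrable and $t\mapsto\Delta L_t(u\otimes\varpi(f)\otimes\widehat{f(t)})$ is locally square-integrable for all $u\in\mathsf h$, $f\in L^{\mathrm{step}}$; and $$\langle u\otimes\varpi(f),(j_t(x)-j_0(x))v\otimes\varpi(g)\rangle=\int_0^t\langle u\otimes\varpi(f),E^{\widehat{f(s)}}\widetilde{\jmath}_s(\phi(x))E_{\widehat{g(s)}}\,v\otimes\varpi(g)\rangle\,\mathrm ds$$ for all $u,v\in\mathsf h$, $f,g\in L^{\mathrm{step}}$, $t\ge0$. It is weakly multiplicative if $\langle j_t(x)\zeta,j_t(y)\xi\rangle=\langle\zeta,j_t(x^*y)\xi\rangle$ for all $x,y\in\mathsf A_0$, $\zeta,\xi\in\mathsf h\underline\otimes\mathcal E$, $t\ge0$. *)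

theory Defs
  imports "HOL-Analysis.Analysis" "HOL-Library.Poly_Mapping"
begin

section \<open>Complex Hilbert spaces\<close>

class complex_normed_vector = real_normed_vector +
  fixes scaleC :: "complex \<Rightarrow> 'a \<Rightarrow> 'a" (infixr "*\<^sub>C" 75)
  assumes scaleC_add_right: "a *\<^sub>C (x + y) = a *\<^sub>C x + a *\<^sub>C y"
    and scaleC_add_left: "(a + b) *\<^sub>C x = a *\<^sub>C x + b *\<^sub>C x"
    and scaleC_scaleC: "a *\<^sub>C (b *\<^sub>C x) = (a * b) *\<^sub>C x"
    and scaleC_of_real: "complex_of_real r *\<^sub>C x = r *\<^sub>R x"
    and norm_scaleC: "norm (a *\<^sub>C x) = cmod a * norm x"

text \<open>The real inner product of the library is the real part of the complex inner product, which
  is linear in its second argument.\<close>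

class hilbert_space = complex_normed_vector + real_inner + complete_space +
  fixes cinner :: "'a \<Rightarrow> 'a \<Rightarrow> complex"
  assumes cinner_commute: "cinner x y = cnj (cinner y x)"
    and cinner_add_right: "cinner x (y + z) = cinner x y + cinner x z"
    and cinner_scaleC_right: "cinner x (a *\<^sub>C y) = a * cinner x y"
    and Re_cinner: "Re (cinner x y) = inner x y"
begin

subclass banach ..

end

lemma cinner_add_left:
  "cinner (x + y) (z :: 'a :: hilbert_space) = cinner x z + cinner y z"
  by (subst (1 2 3) cinner_commute) (simp add: cinner_add_right)

lemma cinner_scaleC_left:
  "cinner (a *\<^sub>C x) (y :: 'a :: hilbert_space) = cnj a * cinner x y"
  by (subst (1 2) cinner_commute) (simp add: cinner_scaleC_right)

lemma cinner_self: "cinner x (x :: 'a :: hilbert_space) = of_real ((norm x)\<^sup>2)"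
proof (rule complex_eqI)
  show "Re (cinner x x) = Re (of_real ((norm x)\<^sup>2))"
    by (simp add: Re_cinner power2_norm_eq_inner)
  show "Im (cinner x x) = Im (of_real ((norm x)\<^sup>2))"
    using arg_cong[OF cinner_commute[of x x], of Im] by simp
qed

lemma cinner_0_left [simp]: "cinner 0 (y :: 'a :: hilbert_space) = 0"
  using cinner_add_left[of 0 0 y] by simp

lemma cinner_0_right [simp]: "cinner (y :: 'a :: hilbert_space) 0 = 0"
  using cinner_add_right[of y 0 0] by simp

instantiation complex :: hilbert_space
begin
definition scaleC_complex :: "complex \<Rightarrow> complex \<Rightarrow> complex" where
  "scaleC_complex a x = a * x"
definition cinner_complex :: "complex \<Rightarrow> complex \<Rightarrow> complex" where
  "cinner_complex x y = cnj x * y"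
instance
  by standard
    (auto simp: scaleC_complex_def cinner_complex_def algebra_simps scaleR_conv_of_real
      norm_mult inner_complex_def)
end

instantiation vec :: (complex_normed_vector, finite) complex_normed_vector
begin
definition scaleC_vec :: "complex \<Rightarrow> 'a ^ 'b \<Rightarrow> 'a ^ 'b" where
  "scaleC_vec a x = (\<chi> i. a *\<^sub>C (x $ i))"
instance
  by standard
    (auto simp: scaleC_vec_def vec_eq_iff scaleC_add_right scaleC_add_left scaleC_scaleC
      scaleC_of_real norm_vec_def norm_scaleC L2_set_right_distrib)
end

instantiation vec :: (hilbert_space, finite) hilbert_space
begin
definition cinner_vec :: "'a ^ 'b \<Rightarrow> 'a ^ 'b \<Rightarrow> complex" where
  "cinner_vec x y = (\<Sum>i\<in>UNIV. cinner (x $ i) (y $ i))"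
instance
proof
  fix x y z :: "'a ^ 'b" and a :: complex
  show "cinner x y = cnj (cinner y x)"
    by (simp add: cinner_vec_def flip: cinner_commute)
  show "cinner x (y + z) = cinner x y + cinner x z"
    by (simp add: cinner_vec_def cinner_add_right sum.distrib)
  show "cinner x (a *\<^sub>C y) = a * cinner x y"
    by (simp add: cinner_vec_def scaleC_vec_def cinner_scaleC_right sum_distrib_left)
  show "Re (cinner x y) = inner x y"
    by (simp add: cinner_vec_def inner_vec_def Re_cinner)
qed
end

instantiation blinfun :: (real_normed_vector, complex_normed_vector) complex_normed_vector
begin
lift_definition scaleC_blinfun :: "complex \<Rightarrow> 'a \<Rightarrow>\<^sub>L 'b \<Rightarrow> 'a \<Rightarrow>\<^sub>L 'b" is "\<lambda>a T x. a *\<^sub>C T x"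
proof -
  fix a :: complex and T :: "'a \<Rightarrow> 'b"
  assume T: "bounded_linear T"
  then interpret bounded_linear T .
  have "bounded_linear (\<lambda>y :: 'b. a *\<^sub>C y)"
    by (rule bounded_linear_intro[where K = "cmod a"])
      (auto simp: scaleC_add_right norm_scaleC scaleC_scaleC mult.commute simp flip: scaleC_of_real)
  from bounded_linear_compose[OF this T] show "bounded_linear (\<lambda>x. a *\<^sub>C T x)" .
qed
instance
proof
  fix x y :: "'a \<Rightarrow>\<^sub>L 'b" and a b :: complex and r :: real
  show "a *\<^sub>C (x + y) = a *\<^sub>C x + a *\<^sub>C y"
    by transfer (simp add: scaleC_add_right)
  show "(a + b) *\<^sub>C x = a *\<^sub>C x + b *\<^sub>C x"
    by transfer (simp add: scaleC_add_left)
  show "a *\<^sub>C (b *\<^sub>C x) = (a * b) *\<^sub>C x"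
    by transfer (simp add: scaleC_scaleC)
  show "complex_of_real r *\<^sub>C x = r *\<^sub>R x"
    by transfer (simp add: scaleC_of_real)
  have le: "norm (a *\<^sub>C x) \<le> cmod a * norm x" for a and x :: "'a \<Rightarrow>\<^sub>L 'b"
    by (rule norm_blinfun_bound)
      (auto simp: scaleC_blinfun.rep_eq norm_scaleC mult.assoc intro!: mult_left_mono norm_blinfun)
  show "norm (a *\<^sub>C x) = cmod a * norm x"
  proof (cases "a = 0")
    case True
    then show ?thesis using le[of a x] by simp
  next
    case False
    have "inverse a *\<^sub>C a *\<^sub>C x = x"
      using False by transfer
        (simp add: scaleC_scaleC fun_eq_iff scaleC_of_real[of 1, simplified])
    then have "norm x \<le> inverse (cmod a) * norm (a *\<^sub>C x)"
      using le[of "inverse a" "a *\<^sub>C x"] by (simp add: norm_inverse)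
    then have "cmod a * norm x \<le> norm (a *\<^sub>C x)"
      using False by (simp add: field_simps)
    with le[of a x] show ?thesis by simp
  qed
qed
end

definition csubspace :: "'a :: complex_normed_vector set \<Rightarrow> bool" where
  "csubspace S \<longleftrightarrow> 0 \<in> S \<and> (\<forall>x\<in>S. \<forall>y\<in>S. x + y \<in> S) \<and> (\<forall>a. \<forall>x\<in>S. a *\<^sub>C x \<in> S)"

definition cspan :: "'a :: complex_normed_vector set \<Rightarrow> 'a set" where
  "cspan S = csubspace hull S"

definition clinear_on ::
  "'a :: complex_normed_vector set \<Rightarrow> ('a \<Rightarrow> 'b :: complex_normed_vector) \<Rightarrow> bool" where
  "clinear_on S f \<longleftrightarrow>
    (\<forall>x\<in>S. \<forall>y\<in>S. f (x + y) = f x + f y) \<and> (\<forall>a. \<forall>x\<in>S. f (a *\<^sub>C x) = a *\<^sub>C f x)"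

text \<open>\<open>B(H)\<close>: the type \<open>'a \<Rightarrow>\<^sub>L 'b\<close> only guarantees real linearity.\<close>

definition bop :: "('a :: complex_normed_vector \<Rightarrow>\<^sub>L 'b :: complex_normed_vector) set" where
  "bop = {T. clinear_on UNIV (blinfun_apply T)}"

text \<open>By the Riesz representation theorem the adjoint exists, and is unique, for bounded complex-linear
  maps; \<open>Blinfun\<close> is likewise only applied to functions that are bounded linear.\<close>

definition cadj ::
  "('a :: hilbert_space \<Rightarrow> 'b :: hilbert_space) \<Rightarrow> 'b \<Rightarrow> 'a" where
  "cadj T = (SOME S. \<forall>x y. cinner (T x) y = cinner x (S y))"

definition adj ::
  "('a :: hilbert_space \<Rightarrow>\<^sub>L 'b :: hilbert_space) \<Rightarrow> 'b \<Rightarrow>\<^sub>L 'a" where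
  "adj T = Blinfun (cadj (blinfun_apply T))"


section \<open>The Hilbert space generated by a positive kernel\<close>

text \<open>Given generators \<open>x, y, \<dots>\<close> and prescribed inner products \<open>kern x y\<close>, we take finite formal
  linear combinations (lists of coefficients and generators), divide by null vectors and complete.
  This one construction yields Hilbert space tensor products, \<open>L\<^sup>2\<close> and Fock space below.\<close>

definition fip :: "('a \<Rightarrow> 'a \<Rightarrow> complex) \<Rightarrow> (complex \<times> 'a) list \<Rightarrow> (complex \<times> 'a) list \<Rightarrow> complex" where
  "fip K p q = (\<Sum>(a, x)\<leftarrow>p. \<Sum>(b, y)\<leftarrow>q. cnj a * b * K x y)"

definition pos_kernel :: "('a \<Rightarrow> 'a \<Rightarrow> complex) \<Rightarrow> bool" where
  "pos_kernel K \<longleftrightarrow> (\<forall>x y. K x y = cnj (K y x)) \<and> (\<forall>p. 0 \<le> Re (fip K p p))"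

class kernel =
  fixes kern :: "'a \<Rightarrow> 'a \<Rightarrow> complex"
  assumes pos_kern: "pos_kernel kern"

definition fscale :: "complex \<Rightarrow> (complex \<times> 'a) list \<Rightarrow> (complex \<times> 'a) list" where
  "fscale c p = map (\<lambda>(a, x). (c * a, x)) p"

lemma fip_Nil [simp]: "fip K [] q = 0" "fip K p [] = 0"
  by (induction p) (auto simp: fip_def)

lemma fip_append_left: "fip K (p @ p') q = fip K p q + fip K p' q"
  by (simp add: fip_def)

lemma fip_append_right: "fip K p (q @ q') = fip K p q + fip K p q'"
  by (induction p) (auto simp: fip_def algebra_simps)

lemma fip_scale_right: "fip K p (fscale c q) = c * fip K p q"
proof -
  have "(\<Sum>(b, y)\<leftarrow>fscale c q. cnj a * b * K x y) = c * (\<Sum>(b, y)\<leftarrow>q. cnj a * b * K x y)" for a x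
    by (induction q) (auto simp: fscale_def algebra_simps)
  then show ?thesis
    by (induction p) (auto simp: fip_def algebra_simps)
qed

lemma fip_scale_left: "fip K (fscale c p) q = cnj c * fip K p q"
proof -
  have *: "(\<Sum>(b, y)\<leftarrow>q. cnj (c * a) * b * K x y) = cnj c * (\<Sum>(b, y)\<leftarrow>q. cnj a * b * K x y)" for a x
    by (induction q) (auto simp: algebra_simps)
  show ?thesis
  proof (induction p)
    case (Cons z p)
    obtain a x where "z = (a, x)" by force
    with Cons show ?case
      using *[of a x] by (simp add: fip_def fscale_def distrib_left)
  qed (simp add: fscale_def)
qed

lemma fip_Cons_left: "fip K ((a, x) # p) q = cnj a * fip K [(1, x)] q + fip K p q"
  using fip_append_left[of K "[(a, x)]" p q] fip_scale_left[of K a "[(1, x)]" q]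
  by (simp add: fscale_def)

lemma fip_Cons_right: "fip K p ((a, x) # q) = a * fip K p [(1, x)] + fip K p q"
  using fip_append_right[of K p "[(a, x)]" q] fip_scale_right[of K p a "[(1, x)]"]
  by (simp add: fscale_def)

lemma fip_single [simp]: "fip K [(1, x)] [(1, y)] = K x y"
  by (simp add: fip_def)

lemma fip_commute:
  assumes "\<And>x y. K x y = cnj (K y x)"
  shows "fip K p q = cnj (fip K q p)"
proof -
  have 1: "fip K [(1, x)] q = cnj (fip K q [(1, x)])" for x q
  proof (induction q)
    case (Cons z q)
    obtain b y where "z = (b, y)" by force
    with Cons assms[of x y] show ?case
      by (simp add: fip_Cons_right[of K "[(1, x)]" b y q] fip_Cons_left[of K b y q "[(1, x)]"])
  qed auto
  show ?thesis
  proof (induction p)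
    case (Cons z p)
    obtain b y where "z = (b, y)" by force
    with Cons 1[of y q] show ?case
      by (simp add: fip_Cons_left[of _ b y p] fip_Cons_right[of _ _ b y p])
  qed auto
qed

abbreviation sip :: "(complex \<times> 'a :: kernel) list \<Rightarrow> (complex \<times> 'a) list \<Rightarrow> complex" where
  "sip \<equiv> fip kern"

lemma sip_commute: "sip p q = cnj (sip q p)"
  by (rule fip_commute) (use pos_kern[where 'a = 'a] in \<open>unfold pos_kernel_def, blast\<close>)

lemma sip_pos: "0 \<le> Re (sip p p)"
  using pos_kern[where 'a = 'a] unfolding pos_kernel_def by blast

lemma sip_self: "sip p p = of_real (Re (sip p p))"
  using arg_cong[OF sip_commute[of p p], of Im] by (auto intro: complex_eqI)

definition fnorm :: "(complex \<times> 'a :: kernel) list \<Rightarrow> real" where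
  "fnorm p = sqrt (Re (sip p p))"

definition fdiff :: "(complex \<times> 'a) list \<Rightarrow> (complex \<times> 'a) list \<Rightarrow> (complex \<times> 'a) list" where
  "fdiff p q = p @ fscale (-1) q"

lemma fip_diff_left: "fip K (fdiff p q) r = fip K p r - fip K q r"
  by (simp add: fdiff_def fip_append_left fip_scale_left)

lemma fip_diff_right: "fip K r (fdiff p q) = fip K r p - fip K r q"
  by (simp add: fdiff_def fip_append_right fip_scale_right)

lemmas fip_simps = fip_append_left fip_append_right fip_scale_left fip_scale_right
  fip_diff_left fip_diff_right

lemma fnorm_ge_0 [simp]: "0 \<le> fnorm p"
  by (simp add: fnorm_def sip_pos)

lemma fnorm_sq: "(fnorm p)\<^sup>2 = Re (sip p p)"
  by (simp add: fnorm_def sip_pos)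

lemma sip_self_fnorm: "sip p p = of_real ((fnorm p)\<^sup>2)"
  using sip_self[of p] by (simp add: fnorm_sq)

lemma sip_cauchy_schwarz: "cmod (sip p q) \<le> fnorm p * fnorm q"
proof -
  define z where "z = sip p q"
  have qp: "sip q p = cnj z" using sip_commute[of q p] by (simp add: z_def)
  have *: "0 \<le> (fnorm p)\<^sup>2 - 2 * t * (cmod z)\<^sup>2 + t\<^sup>2 * (cmod z)\<^sup>2 * (fnorm q)\<^sup>2" for t :: real
  proof -
    have "0 \<le> Re (sip (fdiff p (fscale (t * cnj z) q)) (fdiff p (fscale (t * cnj z) q)))"
      by (rule sip_pos)
    also have "sip (fdiff p (fscale (t * cnj z) q)) (fdiff p (fscale (t * cnj z) q))
       = sip p p - t * (cnj z * z) - t * (z * cnj z) + t\<^sup>2 * (z * cnj z) * sip q q"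
      by (simp add: fip_simps qp flip: z_def) (simp add: algebra_simps power2_eq_square)
    also have "\<dots> = of_real ((fnorm p)\<^sup>2 - 2 * t * (cmod z)\<^sup>2 + t\<^sup>2 * (cmod z)\<^sup>2 * (fnorm q)\<^sup>2)"
      by (simp add: sip_self_fnorm mult.commute[of "cnj z" z] flip: complex_norm_square)
    finally show ?thesis by simp
  qed
  show ?thesis
  proof (cases "fnorm q = 0")
    case True
    have "z = 0"
    proof (rule ccontr)
      assume "z \<noteq> 0"
      then have "(fnorm p)\<^sup>2 - 2 * (((fnorm p)\<^sup>2 + 1) / (cmod z)\<^sup>2) * (cmod z)\<^sup>2 < 0"
        by simp (smt (verit) zero_le_power2)
      with *[of "((fnorm p)\<^sup>2 + 1) / (cmod z)\<^sup>2"] True show False by simp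
    qed
    then show ?thesis by (simp add: True z_def)
  next
    case False
    then have "0 < (fnorm q)\<^sup>2" by simp
    have "0 \<le> (fnorm p)\<^sup>2 - (cmod z)\<^sup>2 / (fnorm q)\<^sup>2"
      using *[of "1 / (fnorm q)\<^sup>2"] False by (simp add: power2_eq_square)
    with \<open>0 < (fnorm q)\<^sup>2\<close> have "(cmod z)\<^sup>2 \<le> (fnorm p)\<^sup>2 * (fnorm q)\<^sup>2"
      by (simp add: field_simps)
    then have "(cmod z)\<^sup>2 \<le> (fnorm p * fnorm q)\<^sup>2" by (simp add: power_mult_distrib)
    then show ?thesis unfolding z_def by (rule power2_le_imp_le) simp
  qed
qed

lemma fnorm_triangle: "fnorm (p @ q) \<le> fnorm p + fnorm q"
proof (rule power2_le_imp_le)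
  have "Re (sip p q) \<le> fnorm p * fnorm q"
    using complex_Re_le_cmod[of "sip p q"] sip_cauchy_schwarz[of p q] by linarith
  moreover have "Re (sip q p) = Re (sip p q)" by (subst sip_commute) simp
  ultimately show "(fnorm (p @ q))\<^sup>2 \<le> (fnorm p + fnorm q)\<^sup>2"
    by (simp add: fnorm_sq fip_simps power2_sum)
qed simp

lemma fnorm_scale: "fnorm (fscale c p) = cmod c * fnorm p"
proof -
  have "sip (fscale c p) (fscale c p) = (c * cnj c) * sip p p" by (simp add: fip_simps)
  also have "\<dots> = of_real ((cmod c * fnorm p)\<^sup>2)"
    by (simp add: sip_self_fnorm power_mult_distrib flip: complex_norm_square)
  finally have "Re (sip (fscale c p) (fscale c p)) = (cmod c * fnorm p)\<^sup>2" by simp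
  then show ?thesis by (simp add: fnorm_def[of "fscale c p"])
qed

definition fequiv :: "(complex \<times> 'a :: kernel) list \<Rightarrow> (complex \<times> 'a) list \<Rightarrow> bool" where
  "fequiv p q \<longleftrightarrow> (\<forall>r. sip r p = sip r q)"

lemma fnorm_cong: "fequiv p q \<Longrightarrow> fnorm p = fnorm q"
proof -
  assume "fequiv p q"
  then have *: "sip r p = sip r q" for r by (simp add: fequiv_def)
  have "sip p p = sip q q" by (metis * sip_commute)
  then show ?thesis by (simp add: fnorm_def)
qed

lemma fnorm_0_if: "fequiv p [] \<Longrightarrow> fnorm p = 0"
  by (drule fnorm_cong) (simp add: fnorm_def)

lemma fnorm_diff_triangle: "fnorm (fdiff p r) \<le> fnorm (fdiff p q) + fnorm (fdiff q r)"
proof -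
  have "fnorm (fdiff p r) = fnorm (fdiff p q @ fdiff q r)"
    by (rule fnorm_cong) (simp add: fequiv_def fip_simps)
  then show ?thesis using fnorm_triangle[of "fdiff p q" "fdiff q r"] by simp
qed

lemma fnorm_diff_commute: "fnorm (fdiff p q) = fnorm (fdiff q p)"
proof -
  have "fnorm (fdiff p q) = fnorm (fscale (-1) (fdiff q p))"
    by (rule fnorm_cong) (simp add: fequiv_def fip_simps)
  then show ?thesis by (simp add: fnorm_scale)
qed

lemma fnorm_le_diff: "fnorm p \<le> fnorm q + fnorm (fdiff p q)"
proof -
  have "fnorm p = fnorm (q @ fdiff p q)"
    by (rule fnorm_cong) (simp add: fequiv_def fip_simps)
  then show ?thesis using fnorm_triangle[of q "fdiff p q"] by simp
qed

definition fcauchy :: "(nat \<Rightarrow> (complex \<times> 'a :: kernel) list) \<Rightarrow> bool" where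
  "fcauchy X \<longleftrightarrow> (\<forall>e>0. \<exists>M. \<forall>m\<ge>M. \<forall>n\<ge>M. fnorm (fdiff (X m) (X n)) < e)"

definition kequiv ::
  "(nat \<Rightarrow> (complex \<times> 'a :: kernel) list) \<Rightarrow> (nat \<Rightarrow> (complex \<times> 'a) list) \<Rightarrow> bool" where
  "kequiv X Y \<longleftrightarrow> fcauchy X \<and> fcauchy Y \<and> (\<lambda>n. fnorm (fdiff (X n) (Y n))) \<longlonglongrightarrow> 0"

lemma fcauchy_const [simp]: "fcauchy (\<lambda>_. p)"
proof -
  have "fnorm (fdiff p p) = 0" by (rule fnorm_0_if) (simp add: fequiv_def fip_simps)
  then show ?thesis by (simp add: fcauchy_def)
qed

lemma fcauchy_append:
  assumes "fcauchy X" "fcauchy Y"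
  shows "fcauchy (\<lambda>n. X n @ Y n)"
  unfolding fcauchy_def
proof (intro allI impI)
  fix e :: real assume "0 < e"
  then obtain M N where M: "\<And>m n. m \<ge> M \<Longrightarrow> n \<ge> M \<Longrightarrow> fnorm (fdiff (X m) (X n)) < e / 2"
    and N: "\<And>m n. m \<ge> N \<Longrightarrow> n \<ge> N \<Longrightarrow> fnorm (fdiff (Y m) (Y n)) < e / 2"
    using assms unfolding fcauchy_def by (meson half_gt_zero)
  have "fnorm (fdiff (X m @ Y m) (X n @ Y n)) < e" if "m \<ge> max M N" "n \<ge> max M N" for m n
  proof -
    have "fnorm (fdiff (X m @ Y m) (X n @ Y n)) = fnorm (fdiff (X m) (X n) @ fdiff (Y m) (Y n))"
      by (rule fnorm_cong) (simp add: fequiv_def fip_simps)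
    also have "\<dots> \<le> fnorm (fdiff (X m) (X n)) + fnorm (fdiff (Y m) (Y n))"
      by (rule fnorm_triangle)
    also have "\<dots> < e" using M[of m n] N[of m n] that by simp
    finally show ?thesis .
  qed
  then show "\<exists>M. \<forall>m\<ge>M. \<forall>n\<ge>M. fnorm (fdiff (X m @ Y m) (X n @ Y n)) < e" by blast
qed

lemma fdiff_scale: "fdiff (fscale c p) (fscale c q) = fscale c (fdiff p q)"
  by (simp add: fdiff_def fscale_def case_prod_unfold)

lemma fcauchy_scale:
  assumes "fcauchy X"
  shows "fcauchy (\<lambda>n. fscale c (X n))"
  unfolding fcauchy_def
proof (intro allI impI)
  fix e :: real assume e: "0 < e"
  have "0 < cmod c + 1" by (simp add: add_nonneg_pos)
  with e obtain M where M: "\<And>m n. m \<ge> M \<Longrightarrow> n \<ge> M \<Longrightarrow> fnorm (fdiff (X m) (X n)) < e / (cmod c + 1)"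
    using assms unfolding fcauchy_def by (meson divide_pos_pos)
  have "fnorm (fdiff (fscale c (X m)) (fscale c (X n))) < e" if "m \<ge> M" "n \<ge> M" for m n
  proof -
    have "fnorm (fdiff (fscale c (X m)) (fscale c (X n))) = cmod c * fnorm (fdiff (X m) (X n))"
      by (simp add: fdiff_scale fnorm_scale)
    also have "\<dots> \<le> (cmod c + 1) * fnorm (fdiff (X m) (X n))"
      by (intro mult_right_mono) auto
    also have "\<dots> < e"
      using M[OF that] \<open>0 < cmod c + 1\<close> by (simp add: field_simps)
    finally show ?thesis .
  qed
  then show "\<exists>M. \<forall>m\<ge>M. \<forall>n\<ge>M. fnorm (fdiff (fscale c (X m)) (fscale c (X n))) < e" by blast
qed

lemma kequiv_if: "fcauchy X \<Longrightarrow> fcauchy Y \<Longrightarrow> (\<And>n. fequiv (X n) (Y n)) \<Longrightarrow> kequiv X Y"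
proof -
  assume "fcauchy X" "fcauchy Y" and *: "\<And>n. fequiv (X n) (Y n)"
  have "fnorm (fdiff (X n) (Y n)) = 0" for n
    using *[of n] by (intro fnorm_0_if) (simp add: fequiv_def fip_simps)
  then show "kequiv X Y" using \<open>fcauchy X\<close> \<open>fcauchy Y\<close> by (simp add: kequiv_def)
qed

lemma kequiv_append:
  assumes "kequiv X X'" "kequiv Y Y'"
  shows "kequiv (\<lambda>n. X n @ Y n) (\<lambda>n. X' n @ Y' n)"
proof -
  have "(\<lambda>n. fnorm (fdiff (X n @ Y n) (X' n @ Y' n))) \<longlonglongrightarrow> 0"
  proof (rule tendsto_sandwich[OF _ _ tendsto_const])
    show "(\<lambda>n. fnorm (fdiff (X n) (X' n)) + fnorm (fdiff (Y n) (Y' n))) \<longlonglongrightarrow> 0"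
      using assms by (auto simp: kequiv_def intro: tendsto_add_zero)
    have "fnorm (fdiff (X n @ Y n) (X' n @ Y' n))
        \<le> fnorm (fdiff (X n) (X' n)) + fnorm (fdiff (Y n) (Y' n))" for n
    proof -
      have "fnorm (fdiff (X n @ Y n) (X' n @ Y' n)) = fnorm (fdiff (X n) (X' n) @ fdiff (Y n) (Y' n))"
        by (rule fnorm_cong) (simp add: fequiv_def fip_simps)
      then show ?thesis using fnorm_triangle by metis
    qed
    then show "\<forall>\<^sub>F n in sequentially. fnorm (fdiff (X n @ Y n) (X' n @ Y' n))
        \<le> fnorm (fdiff (X n) (X' n)) + fnorm (fdiff (Y n) (Y' n))" by simp
  qed simp
  with assms show ?thesis by (auto simp: kequiv_def fcauchy_append)
qed

lemma kequiv_scale: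
  assumes "kequiv X Y"
  shows "kequiv (\<lambda>n. fscale c (X n)) (\<lambda>n. fscale c (Y n))"
  using assms
  by (auto simp: kequiv_def fcauchy_scale fdiff_scale fnorm_scale intro: tendsto_mult_right_zero)

lemma part_equivp_kequiv: "part_equivp (kequiv :: (nat \<Rightarrow> (complex \<times> 'a :: kernel) list) \<Rightarrow> _)"
proof (rule part_equivpI)
  show "\<exists>X :: nat \<Rightarrow> (complex \<times> 'a) list. kequiv X X"
    by (rule exI[of _ "\<lambda>_. []"]) (rule kequiv_if, auto simp: fequiv_def)
  show "symp (kequiv :: (nat \<Rightarrow> (complex \<times> 'a :: kernel) list) \<Rightarrow> _)"
  proof (rule sympI)
    fix X Y :: "nat \<Rightarrow> (complex \<times> 'a) list"
    assume "kequiv X Y"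
    moreover have "fnorm (fdiff (Y n) (X n)) = fnorm (fdiff (X n) (Y n))" for n
      by (rule fnorm_diff_commute)
    ultimately show "kequiv Y X" by (simp add: kequiv_def)
  qed
  show "transp (kequiv :: (nat \<Rightarrow> (complex \<times> 'a :: kernel) list) \<Rightarrow> _)"
  proof (rule transpI)
    fix X Y Z :: "nat \<Rightarrow> (complex \<times> 'a) list"
    assume XY: "kequiv X Y" and YZ: "kequiv Y Z"
    have "(\<lambda>n. fnorm (fdiff (X n) (Z n))) \<longlonglongrightarrow> 0"
    proof (rule tendsto_sandwich[OF _ _ tendsto_const])
      show "(\<lambda>n. fnorm (fdiff (X n) (Y n)) + fnorm (fdiff (Y n) (Z n))) \<longlonglongrightarrow> 0"
        using XY YZ by (auto simp: kequiv_def intro: tendsto_add_zero)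
    qed (use fnorm_diff_triangle in \<open>auto intro!: always_eventually\<close>)
    then show "kequiv X Z" using XY YZ by (auto simp: kequiv_def)
  qed
qed

quotient_type (overloaded) 'a kspace = "nat \<Rightarrow> (complex \<times> 'a :: kernel) list" / partial: kequiv
  by (rule part_equivp_kequiv)

lemma fcauchy_bounded:
  assumes "fcauchy X"
  obtains B where "0 < B" "\<And>n. fnorm (X n) \<le> B"
proof -
  obtain M where M: "\<And>m n. m \<ge> M \<Longrightarrow> n \<ge> M \<Longrightarrow> fnorm (fdiff (X m) (X n)) < 1"
    using assms unfolding fcauchy_def by (meson zero_less_one)
  define B where "B = Max ((\<lambda>n. fnorm (X n)) ` {..M}) + 1"
  have le: "fnorm (X n) \<le> B - 1" if "n \<le> M" for n
    using that by (auto simp: B_def intro!: Max_ge)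
  have "fnorm (X n) \<le> B" for n
  proof (cases "n \<le> M")
    case True
    then show ?thesis using le[of n] by simp
  next
    case False
    then show ?thesis using le[of M] M[of n M] fnorm_le_diff[of "X n" "X M"] by simp
  qed
  moreover have "0 < B" using le[of 0] fnorm_ge_0[of "X 0"] by linarith
  ultimately show ?thesis using that by blast
qed

lemma sip_diff_bound:
  "cmod (sip p q - sip p' q') \<le> fnorm (fdiff p p') * fnorm q + fnorm p' * fnorm (fdiff q q')"
proof -
  have "sip p q - sip p' q' = sip (fdiff p p') q + sip p' (fdiff q q')"
    by (simp add: fip_simps)
  then have "cmod (sip p q - sip p' q') \<le> cmod (sip (fdiff p p') q) + cmod (sip p' (fdiff q q'))"
    by (simp add: norm_triangle_ineq)
  with sip_cauchy_schwarz[of "fdiff p p'" q] sip_cauchy_schwarz[of p' "fdiff q q'"]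
  show ?thesis by linarith
qed

lemma convergent_sip:
  assumes "fcauchy X" "fcauchy Y"
  shows "convergent (\<lambda>n. sip (X n) (Y n))"
proof (rule Cauchy_convergent, rule CauchyI)
  fix e :: real assume e: "0 < e"
  obtain A where A: "0 < A" "\<And>n. fnorm (X n) \<le> A" using fcauchy_bounded[OF assms(1)] by blast
  obtain B where B: "0 < B" "\<And>n. fnorm (Y n) \<le> B" using fcauchy_bounded[OF assms(2)] by blast
  obtain M where M: "\<And>m n. m \<ge> M \<Longrightarrow> n \<ge> M \<Longrightarrow> fnorm (fdiff (X m) (X n)) < e / (2 * B)"
    using assms(1) e B(1) unfolding fcauchy_def by (metis divide_pos_pos mult_pos_pos zero_less_numeral)
  obtain N where N: "\<And>m n. m \<ge> N \<Longrightarrow> n \<ge> N \<Longrightarrow> fnorm (fdiff (Y m) (Y n)) < e / (2 * A)"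
    using assms(2) e A(1) unfolding fcauchy_def by (metis divide_pos_pos mult_pos_pos zero_less_numeral)
  have "norm (sip (X m) (Y m) - sip (X n) (Y n)) < e" if "m \<ge> max M N" "n \<ge> max M N" for m n
  proof -
    have "fnorm (fdiff (X m) (X n)) * fnorm (Y m) \<le> fnorm (fdiff (X m) (X n)) * B"
      using B by (intro mult_left_mono) auto
    also have "\<dots> < e / 2" using M[of m n] that B(1) by (simp add: field_simps)
    finally have 1: "fnorm (fdiff (X m) (X n)) * fnorm (Y m) < e / 2" .
    have "fnorm (X n) * fnorm (fdiff (Y m) (Y n)) \<le> A * fnorm (fdiff (Y m) (Y n))"
      using A by (intro mult_right_mono) auto
    also have "\<dots> < e / 2" using N[of m n] that A(1) by (simp add: field_simps)
    finally have 2: "fnorm (X n) * fnorm (fdiff (Y m) (Y n)) < e / 2" .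
    from 1 2 sip_diff_bound[of "X m" "Y m" "X n" "Y n"] show ?thesis by linarith
  qed
  then show "\<exists>M. \<forall>m\<ge>M. \<forall>n\<ge>M. norm (sip (X m) (Y m) - sip (X n) (Y n)) < e" by blast
qed

lemma lim_sip_cong:
  assumes "kequiv X X'" "kequiv Y Y'"
  shows "lim (\<lambda>n. sip (X n) (Y n)) = lim (\<lambda>n. sip (X' n) (Y' n))"
proof -
  from assms have c: "fcauchy X" "fcauchy X'" "fcauchy Y" "fcauchy Y'" by (auto simp: kequiv_def)
  obtain A where A: "0 < A" "\<And>n. fnorm (X' n) \<le> A" using fcauchy_bounded[OF c(2)] by blast
  obtain B where B: "0 < B" "\<And>n. fnorm (Y n) \<le> B" using fcauchy_bounded[OF c(3)] by blast
  have "(\<lambda>n. sip (X n) (Y n) - sip (X' n) (Y' n)) \<longlonglongrightarrow> 0"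
  proof (rule Lim_null_comparison)
    show "(\<lambda>n. fnorm (fdiff (X n) (X' n)) * B + A * fnorm (fdiff (Y n) (Y' n))) \<longlonglongrightarrow> 0"
      using assms by (auto simp: kequiv_def intro!: tendsto_add_zero tendsto_mult_right_zero
          tendsto_mult_left_zero)
    have "norm (sip (X n) (Y n) - sip (X' n) (Y' n))
        \<le> fnorm (fdiff (X n) (X' n)) * B + A * fnorm (fdiff (Y n) (Y' n))" for n
      using sip_diff_bound[of "X n" "Y n" "X' n" "Y' n"]
        mult_left_mono[OF B(2)[of n], of "fnorm (fdiff (X n) (X' n))"]
        mult_right_mono[OF A(2)[of n], of "fnorm (fdiff (Y n) (Y' n))"] by simp
    then show "\<forall>\<^sub>F n in sequentially. norm (sip (X n) (Y n) - sip (X' n) (Y' n))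
        \<le> fnorm (fdiff (X n) (X' n)) * B + A * fnorm (fdiff (Y n) (Y' n))" by simp
  qed
  moreover have "(\<lambda>n. sip (X n) (Y n)) \<longlonglongrightarrow> lim (\<lambda>n. sip (X n) (Y n))"
    "(\<lambda>n. sip (X' n) (Y' n)) \<longlonglongrightarrow> lim (\<lambda>n. sip (X' n) (Y' n))"
    using convergent_sip c by (auto simp: convergent_LIMSEQ_iff)
  ultimately show ?thesis
    using tendsto_diff LIMSEQ_unique by fastforce
qed

instantiation kspace :: (kernel) "{ab_group_add, scaleR}"
begin
lift_definition zero_kspace :: "'a kspace" is "\<lambda>_. []"
  by (rule kequiv_if) (auto simp: fequiv_def)
lift_definition plus_kspace :: "'a kspace \<Rightarrow> 'a kspace \<Rightarrow> 'a kspace" is "\<lambda>X Y n. X n @ Y n"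
  by (rule kequiv_append)
lift_definition uminus_kspace :: "'a kspace \<Rightarrow> 'a kspace" is "\<lambda>X n. fscale (-1) (X n)"
  by (rule kequiv_scale)
definition minus_kspace :: "'a kspace \<Rightarrow> 'a kspace \<Rightarrow> 'a kspace" where
  "minus_kspace x y = x + - y"
lift_definition scaleR_kspace :: "real \<Rightarrow> 'a kspace \<Rightarrow> 'a kspace" is
  "\<lambda>r X n. fscale (complex_of_real r) (X n)"
  by (rule kequiv_scale)
instance
proof
  fix x y z :: "'a kspace"
  show "x + y + z = x + (y + z)"
    by transfer (rule kequiv_if, auto simp: kequiv_def fequiv_def fcauchy_append)
  show "x + y = y + x"
    by transfer (rule kequiv_if, auto simp: kequiv_def fequiv_def fcauchy_append fip_simps)
  show "0 + x = x"
    by transfer (rule kequiv_if, auto simp: kequiv_def fequiv_def fcauchy_append fip_simps)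
  show "- x + x = 0"
    by transfer (rule kequiv_if,
        auto simp: kequiv_def fequiv_def fcauchy_append fcauchy_scale fip_simps)
  show "x - y = x + - y" by (simp add: minus_kspace_def)
qed
end

lift_definition scaleC_kspace' :: "complex \<Rightarrow> 'a :: kernel kspace \<Rightarrow> 'a kspace" is
  "\<lambda>c X n. fscale c (X n)"
  by (rule kequiv_scale)

lift_definition cinner_kspace' :: "'a :: kernel kspace \<Rightarrow> 'a kspace \<Rightarrow> complex" is
  "\<lambda>X Y. lim (\<lambda>n. sip (X n) (Y n))"
  by (rule lim_sip_cong)

lemma cinner_kspace'_commute: "cinner_kspace' x y = cnj (cinner_kspace' y x)"
proof transfer
  fix X Y :: "nat \<Rightarrow> (complex \<times> 'a) list"
  assume "kequiv X X" "kequiv Y Y"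
  then have "(\<lambda>n. sip (Y n) (X n)) \<longlonglongrightarrow> lim (\<lambda>n. sip (Y n) (X n))"
    using convergent_sip by (auto simp: kequiv_def convergent_LIMSEQ_iff)
  then have "(\<lambda>n. cnj (sip (Y n) (X n))) \<longlonglongrightarrow> cnj (lim (\<lambda>n. sip (Y n) (X n)))"
    by (rule tendsto_cnj)
  then have "(\<lambda>n. sip (X n) (Y n)) \<longlonglongrightarrow> cnj (lim (\<lambda>n. sip (Y n) (X n)))"
    by (simp flip: sip_commute)
  then show "lim (\<lambda>n. sip (X n) (Y n)) = cnj (lim (\<lambda>n. sip (Y n) (X n)))"
    by (rule limI)
qed

lemma cinner_kspace'_add_right:
  "cinner_kspace' x (y + z) = cinner_kspace' x y + cinner_kspace' x z"
proof transfer
  fix X Y Z :: "nat \<Rightarrow> (complex \<times> 'a) list"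
  assume "kequiv X X" "kequiv Y Y" "kequiv Z Z"
  then have "(\<lambda>n. sip (X n) (Y n) + sip (X n) (Z n)) \<longlonglongrightarrow>
      lim (\<lambda>n. sip (X n) (Y n)) + lim (\<lambda>n. sip (X n) (Z n))"
    using convergent_sip by (intro tendsto_add) (auto simp: kequiv_def convergent_LIMSEQ_iff)
  then show "lim (\<lambda>n. sip (X n) (Y n @ Z n)) = lim (\<lambda>n. sip (X n) (Y n)) + lim (\<lambda>n. sip (X n) (Z n))"
    by (intro limI) (simp add: fip_simps)
qed

lemma cinner_kspace'_scale_right:
  "cinner_kspace' x (scaleC_kspace' a y) = a * cinner_kspace' x y"
proof transfer
  fix X Y :: "nat \<Rightarrow> (complex \<times> 'a) list" and a
  assume "kequiv X X" "kequiv Y Y"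
  then have "(\<lambda>n. a * sip (X n) (Y n)) \<longlonglongrightarrow> a * lim (\<lambda>n. sip (X n) (Y n))"
    using convergent_sip by (intro tendsto_mult) (auto simp: kequiv_def convergent_LIMSEQ_iff)
  then show "lim (\<lambda>n. sip (X n) (fscale a (Y n))) = a * lim (\<lambda>n. sip (X n) (Y n))"
    by (intro limI) (simp add: fip_simps)
qed

lemma cinner_kspace'_pos: "0 \<le> Re (cinner_kspace' x x)"
proof transfer
  fix X :: "nat \<Rightarrow> (complex \<times> 'a) list"
  assume "kequiv X X"
  then have "(\<lambda>n. Re (sip (X n) (X n))) \<longlonglongrightarrow> Re (lim (\<lambda>n. sip (X n) (X n)))"
    using convergent_sip by (intro tendsto_Re) (auto simp: kequiv_def convergent_LIMSEQ_iff)
  then show "0 \<le> Re (lim (\<lambda>n. sip (X n) (X n)))"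
    by (rule LIMSEQ_le_const) (use sip_pos in auto)
qed

lemma cinner_kspace'_definite: "Re (cinner_kspace' x x) = 0 \<longleftrightarrow> x = 0"
proof transfer
  fix X :: "nat \<Rightarrow> (complex \<times> 'a) list"
  assume X: "kequiv X X"
  then have L: "(\<lambda>n. Re (sip (X n) (X n))) \<longlonglongrightarrow> Re (lim (\<lambda>n. sip (X n) (X n)))"
    using convergent_sip by (intro tendsto_Re) (auto simp: kequiv_def convergent_LIMSEQ_iff)
  have X0: "fnorm (fdiff (X n) []) = fnorm (X n)" for n
    by (rule fnorm_cong) (simp add: fequiv_def fip_simps)
  show "Re (lim (\<lambda>n. sip (X n) (X n))) = 0 \<longleftrightarrow> kequiv X (\<lambda>_. [])"
  proof
    assume "Re (lim (\<lambda>n. sip (X n) (X n))) = 0"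
    with L have "(\<lambda>n. sqrt (Re (sip (X n) (X n)))) \<longlonglongrightarrow> sqrt 0"
      by (intro tendsto_real_sqrt) simp
    then have "(\<lambda>n. fnorm (X n)) \<longlonglongrightarrow> 0"
      by (simp add: fnorm_def)
    with X show "kequiv X (\<lambda>_. [])"
      by (simp add: kequiv_def X0)
  next
    assume "kequiv X (\<lambda>_. [])"
    then have "(\<lambda>n. (fnorm (X n))\<^sup>2) \<longlonglongrightarrow> 0\<^sup>2"
      by (intro tendsto_power) (simp add: kequiv_def X0)
    then have "(\<lambda>n. Re (sip (X n) (X n))) \<longlonglongrightarrow> 0"
      by (simp add: fnorm_sq)
    from LIMSEQ_unique[OF L this] show "Re (lim (\<lambda>n. sip (X n) (X n))) = 0" .
  qed
qed

lemma scaleR_kspace_eq: "r *\<^sub>R x = scaleC_kspace' (complex_of_real r) x"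
  by transfer (rule kequiv_scale)

lemma scaleC_kspace'_add_right:
  "scaleC_kspace' a (x + y) = scaleC_kspace' a x + scaleC_kspace' a y"
  by transfer (rule kequiv_if,
      auto simp: kequiv_def fequiv_def fcauchy_append fcauchy_scale fip_simps algebra_simps)

lemma scaleC_kspace'_add_left:
  "scaleC_kspace' (a + b) x = scaleC_kspace' a x + scaleC_kspace' b x"
  by transfer (rule kequiv_if,
      auto simp: kequiv_def fequiv_def fcauchy_append fcauchy_scale fip_simps algebra_simps)

lemma scaleC_kspace'_scaleC: "scaleC_kspace' a (scaleC_kspace' b x) = scaleC_kspace' (a * b) x"
  by transfer (rule kequiv_if,
      auto simp: kequiv_def fequiv_def fcauchy_append fcauchy_scale fip_simps algebra_simps)

lemma scaleC_kspace'_one: "scaleC_kspace' 1 x = x"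
  by transfer (rule kequiv_if,
      auto simp: kequiv_def fequiv_def fcauchy_append fcauchy_scale fip_simps algebra_simps)

instantiation kspace :: (kernel) real_inner
begin
definition inner_kspace :: "'a kspace \<Rightarrow> 'a kspace \<Rightarrow> real" where
  "inner_kspace x y = Re (cinner_kspace' x y)"
definition norm_kspace :: "'a kspace \<Rightarrow> real" where
  "norm_kspace x = sqrt (inner x x)"
definition sgn_kspace :: "'a kspace \<Rightarrow> 'a kspace" where
  "sgn_kspace x = x /\<^sub>R norm x"
definition dist_kspace :: "'a kspace \<Rightarrow> 'a kspace \<Rightarrow> real" where
  "dist_kspace x y = norm (x - y)"
definition uniformity_kspace :: "('a kspace \<times> 'a kspace) filter" where
  "uniformity_kspace = (INF e\<in>{0<..}. principal {(x, y). dist x y < e})"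
definition open_kspace :: "'a kspace set \<Rightarrow> bool" where
  "open_kspace U \<longleftrightarrow> (\<forall>x\<in>U. eventually (\<lambda>(x', y). x' = x \<longrightarrow> y \<in> U) uniformity)"
instance
proof
  fix x y z :: "'a kspace" and a b :: real and U :: "'a kspace set"
  show "a *\<^sub>R (x + y) = a *\<^sub>R x + a *\<^sub>R y"
    by (simp add: scaleR_kspace_eq scaleC_kspace'_add_right)
  show "(a + b) *\<^sub>R x = a *\<^sub>R x + b *\<^sub>R x"
    by (simp add: scaleR_kspace_eq scaleC_kspace'_add_left)
  show "a *\<^sub>R b *\<^sub>R x = (a * b) *\<^sub>R x"
    by (simp add: scaleR_kspace_eq scaleC_kspace'_scaleC)
  show "1 *\<^sub>R x = x"
    by (simp add: scaleR_kspace_eq scaleC_kspace'_one)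
  show "dist x y = norm (x - y)" by (simp add: dist_kspace_def)
  show "sgn x = x /\<^sub>R norm x" by (simp add: sgn_kspace_def)
  show "uniformity = (INF e\<in>{0<..}. principal {(x :: 'a kspace, y). dist x y < e})"
    by (simp add: uniformity_kspace_def)
  show "open U = (\<forall>x\<in>U. \<forall>\<^sub>F (x', y) in uniformity. x' = x \<longrightarrow> y \<in> U)"
    by (simp add: open_kspace_def)
  show "inner x y = inner y x"
    unfolding inner_kspace_def by (subst cinner_kspace'_commute) simp
  show "inner (x + y) z = inner x z + inner y z"
    unfolding inner_kspace_def
    by (subst (1 2 3) cinner_kspace'_commute) (simp add: cinner_kspace'_add_right)
  show "inner (a *\<^sub>R x) y = a * inner x y"
    unfolding inner_kspace_def
    by (subst (1 2) cinner_kspace'_commute)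
      (simp add: scaleR_kspace_eq cinner_kspace'_scale_right)
  show "0 \<le> inner x x" by (simp add: inner_kspace_def cinner_kspace'_pos)
  show "inner x x = 0 \<longleftrightarrow> x = 0" by (simp add: inner_kspace_def cinner_kspace'_definite)
  show "norm x = sqrt (inner x x)" by (simp add: norm_kspace_def)
qed
end

instantiation kspace :: (kernel) complex_normed_vector
begin
definition scaleC_kspace :: "complex \<Rightarrow> 'a kspace \<Rightarrow> 'a kspace" where
  "scaleC_kspace = scaleC_kspace'"
instance
proof
  fix x y :: "'a kspace" and a b :: complex and r :: real
  show "a *\<^sub>C (x + y) = a *\<^sub>C x + a *\<^sub>C y"
    by (simp add: scaleC_kspace_def scaleC_kspace'_add_right)
  show "(a + b) *\<^sub>C x = a *\<^sub>C x + b *\<^sub>C x"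
    by (simp add: scaleC_kspace_def scaleC_kspace'_add_left)
  show "a *\<^sub>C (b *\<^sub>C x) = (a * b) *\<^sub>C x"
    by (simp add: scaleC_kspace_def scaleC_kspace'_scaleC)
  show "complex_of_real r *\<^sub>C x = r *\<^sub>R x"
    by (simp add: scaleC_kspace_def scaleR_kspace_eq)
  have "cinner_kspace' (scaleC_kspace' a x) (scaleC_kspace' a x)
      = a * (cnj a * cinner_kspace' x x)"
    by (subst cinner_kspace'_scale_right, subst cinner_kspace'_commute,
        subst cinner_kspace'_scale_right) (simp flip: cinner_kspace'_commute)
  also have "\<dots> = of_real ((cmod a)\<^sup>2) * cinner_kspace' x x"
    by (simp add: mult.assoc[symmetric] flip: complex_norm_square)
  finally have "inner (a *\<^sub>C x) (a *\<^sub>C x) = (cmod a)\<^sup>2 * inner x x"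
    by (simp add: inner_kspace_def scaleC_kspace_def)
  then show "norm (a *\<^sub>C x) = cmod a * norm x"
    by (simp add: norm_eq_sqrt_inner real_sqrt_mult)
qed
end

lift_definition kform :: "(complex \<times> 'a :: kernel) list \<Rightarrow> 'a kspace" is "\<lambda>p _. p"
  by (rule kequiv_if) (auto simp: fequiv_def)

lemma norm_kform_diff: "norm (kform p - kform q) = fnorm (fdiff p q)"
proof -
  have "kform p - kform q = kform (fdiff p q)"
    unfolding minus_kspace_def by transfer (rule kequiv_if, auto simp: fdiff_def fequiv_def)
  moreover have "norm (kform r) = fnorm r" for r :: "(complex \<times> 'a) list"
    unfolding norm_kspace_def inner_kspace_def fnorm_def by transfer simp
  ultimately show ?thesis by simp
qed

definition kvec :: "'a :: kernel \<Rightarrow> 'a kspace" where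
  "kvec x = kform [(1, x)]"

lemma rep_kspace_fcauchy: "fcauchy (rep_kspace x)"
  using Quotient3_rel_rep[OF Quotient3_kspace, of x x] by (simp add: kequiv_def)

lemma norm_kspace_lim:
  assumes "fcauchy X"
  shows "(\<lambda>n. fnorm (X n)) \<longlonglongrightarrow> norm (abs_kspace X)"
proof -
  have "kequiv X X" using assms by (rule kequiv_if) (auto simp: assms fequiv_def)
  then have "norm (abs_kspace X) = sqrt (Re (lim (\<lambda>n. sip (X n) (X n))))"
    by (simp add: norm_kspace_def inner_kspace_def cinner_kspace'.abs_eq)
  moreover have "(\<lambda>n. sqrt (Re (sip (X n) (X n)))) \<longlonglongrightarrow> sqrt (Re (lim (\<lambda>n. sip (X n) (X n))))"
    using convergent_sip[OF assms assms]
    by (intro tendsto_real_sqrt tendsto_Re) (auto simp: convergent_LIMSEQ_iff)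
  ultimately show ?thesis by (simp add: fnorm_def)
qed

lemma kform_LIMSEQ:
  assumes "fcauchy X"
  shows "(\<lambda>n. kform (X n)) \<longlonglongrightarrow> abs_kspace X"
proof (rule LIMSEQ_I)
  fix e :: real assume "0 < e"
  then obtain M where M: "\<And>m n. m \<ge> M \<Longrightarrow> n \<ge> M \<Longrightarrow> fnorm (fdiff (X m) (X n)) < e / 2"
    using assms unfolding fcauchy_def by (meson half_gt_zero)
  have X: "kequiv X X" using assms by (rule kequiv_if) (auto simp: assms fequiv_def)
  have "norm (kform (X n) - abs_kspace X) < e" if n: "n \<ge> M" for n
  proof -
    have c: "fcauchy (\<lambda>m. fdiff (X n) (X m))"
      unfolding fdiff_def using assms by (intro fcauchy_append fcauchy_scale) auto
    have "kform (X n) - abs_kspace X = abs_kspace (\<lambda>m. fdiff (X n) (X m))"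
      using X kequiv_scale[OF X, of "-1"] by (auto simp: minus_kspace_def kform_def uminus_kspace.abs_eq
          plus_kspace.abs_eq fdiff_def kequiv_if fequiv_def)
    with norm_kspace_lim[OF c]
    have "(\<lambda>m. fnorm (fdiff (X n) (X m))) \<longlonglongrightarrow> norm (kform (X n) - abs_kspace X)" by simp
    then have "norm (kform (X n) - abs_kspace X) \<le> e / 2"
      by (rule LIMSEQ_le_const2) (use M[OF n] less_imp_le in blast)
    then show ?thesis using \<open>0 < e\<close> by linarith
  qed
  then show "\<exists>M. \<forall>n\<ge>M. norm (kform (X n) - abs_kspace X) < e" by blast
qed

lemma abs_rep_kspace: "abs_kspace (rep_kspace x) = x"
  using Quotient3_abs_rep[OF Quotient3_kspace] .

lemma kform_dense:
  assumes "0 < e"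
  obtains p where "norm (kform p - x) < e"
  using LIMSEQ_D[OF kform_LIMSEQ[OF rep_kspace_fcauchy[of x]] assms] that
  by (auto simp: abs_rep_kspace)

instance kspace :: (kernel) complete_space
proof
  fix S :: "nat \<Rightarrow> 'a kspace"
  assume S: "Cauchy S"
  have "\<exists>p. norm (kform p - S n) < inverse (Suc n)" for n
    using kform_dense[of "inverse (Suc n)" "S n"] by (metis inverse_positive_iff_positive of_nat_0_less_iff zero_less_Suc)
  then obtain v where v: "\<And>n. norm (kform (v n) - S n) < inverse (Suc n)" by metis
  have lim: "(\<lambda>n. kform (v n) - S n) \<longlonglongrightarrow> 0"
    by (rule Lim_null_comparison[OF _ LIMSEQ_inverse_real_of_nat])
      (use v less_imp_le in \<open>auto intro!: always_eventually\<close>)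
  have "fcauchy v"
    unfolding fcauchy_def norm_kform_diff[symmetric]
  proof (intro allI impI)
    fix e :: real assume "0 < e"
    then have e3: "0 < e / 3" by simp
    obtain M where M: "\<And>m n. m \<ge> M \<Longrightarrow> n \<ge> M \<Longrightarrow> norm (S m - S n) < e / 3"
      using S e3 unfolding Cauchy_iff by meson
    obtain N where N: "\<And>n. n \<ge> N \<Longrightarrow> norm (kform (v n) - S n) < e / 3"
      using LIMSEQ_D[OF lim e3] by auto
    have "norm (kform (v m) - kform (v n)) < e" if "m \<ge> max M N" "n \<ge> max M N" for m n
    proof -
      have "kform (v m) - kform (v n) = (kform (v m) - S m) + (S m - S n) - (kform (v n) - S n)"
        by simp
      then have "norm (kform (v m) - kform (v n))
          \<le> norm (kform (v m) - S m) + norm (S m - S n) + norm (kform (v n) - S n)"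
        by (simp only:) (rule order_trans[OF norm_triangle_ineq4 add_right_mono[OF norm_triangle_ineq]])
      then show ?thesis using M[of m n] N[of m] N[of n] that by simp
    qed
    then show "\<exists>M. \<forall>m\<ge>M. \<forall>n\<ge>M. norm (kform (v m) - kform (v n)) < e" by blast
  qed
  from kform_LIMSEQ[OF this] have "(\<lambda>n. kform (v n) - (kform (v n) - S n)) \<longlonglongrightarrow> abs_kspace v - 0"
    using lim by (intro tendsto_diff)
  then show "convergent S" by (auto simp: convergent_def)
qed

instantiation kspace :: (kernel) hilbert_space
begin
definition cinner_kspace :: "'a kspace \<Rightarrow> 'a kspace \<Rightarrow> complex" where
  "cinner_kspace = cinner_kspace'"
instance
  by standard
    (simp_all add: cinner_kspace_def scaleC_kspace_def inner_kspace_def cinner_kspace'_add_right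
      cinner_kspace'_scale_right flip: cinner_kspace'_commute)
end

lemma cinner_kvec: "cinner (kvec x) (kvec y) = kern x y"
  unfolding kvec_def cinner_kspace_def by transfer simp

lemma csubspace_cspan: "csubspace (cspan S)"
  unfolding cspan_def by (rule hull_in) (auto simp: csubspace_def)

lemma kform_in_cspan: "kform p \<in> cspan (range kvec)"
proof (induction p)
  case Nil
  have "kform [] = (0 :: 'a kspace)" by transfer (rule kequiv_if, auto simp: fequiv_def)
  then show ?case using csubspace_cspan by (auto simp: csubspace_def)
next
  case (Cons z p)
  obtain a x where z: "z = (a, x)" by force
  have "kform (z # p) = a *\<^sub>C kvec x + kform p"
    unfolding kvec_def scaleC_kspace_def z
    by transfer (rule kequiv_if, auto simp: fequiv_def fscale_def)
  moreover have "kvec x \<in> cspan (range kvec)"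
    unfolding cspan_def by (rule hull_inc) simp
  ultimately show ?case using Cons csubspace_cspan[of "range kvec"] by (auto simp: csubspace_def)
qed

lemma kspace_total: "closure (cspan (range (kvec :: 'a :: kernel \<Rightarrow> _))) = UNIV"
proof -
  have "x \<in> closure (cspan (range kvec))" for x :: "'a kspace"
    unfolding closure_approachable
  proof (intro allI impI)
    fix e :: real assume "0 < e"
    then obtain p where "norm (kform p - x) < e" by (rule kform_dense)
    then show "\<exists>y\<in>cspan (range kvec). dist y x < e"
      using kform_in_cspan by (auto simp: dist_norm)
  qed
  then show ?thesis by blast
qed

section \<open>Tensor products, square-integrable functions and Fock space\<close>

lemma fip_eq: "fip K p q = (\<Sum>z\<leftarrow>p. \<Sum>w\<leftarrow>q. cnj (fst z) * fst w * K (snd z) (snd w))"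
  by (simp add: fip_def case_prod_unfold)

lemma fip_cong:
  assumes "\<And>x y. x \<in> snd ` set p \<Longrightarrow> y \<in> snd ` set q \<Longrightarrow> K x y = K' x y"
  shows "fip K p q = fip K' p q"
  unfolding fip_eq using assms by (intro arg_cong[of _ _ sum_list] map_cong refl) auto

lemma fip_add: "fip (\<lambda>x y. K x y + L x y) p q = fip K p q + fip L p q"
  by (simp add: fip_eq distrib_left sum_list_addf)

lemma fip_reweight:
  "fip (\<lambda>x y. K x y * (cnj (\<alpha> x) * \<alpha> y * of_real r)) p q =
    of_real r * fip K (map (\<lambda>(a, x). (a * \<alpha> x, x)) p) (map (\<lambda>(a, x). (a * \<alpha> x, x)) q)"
  by (simp add: fip_eq case_prod_unfold comp_def algebra_simps flip: sum_list_const_mult)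

lemma cinner_minus_right: "cinner x (- y :: 'a :: hilbert_space) = - cinner x y"
  using cinner_add_right[of x y "- y"] by (simp add: eq_neg_iff_add_eq_0 add.commute)

lemma cinner_diff_right: "cinner x (y - z :: 'a :: hilbert_space) = cinner x y - cinner x z"
  using cinner_add_right[of x y "- z"] by (simp add: cinner_minus_right)

lemma cinner_diff_left: "cinner (x - y :: 'a :: hilbert_space) z = cinner x z - cinner y z"
  by (subst (1 2 3) cinner_commute) (simp add: cinner_diff_right)

lemma cinner_cauchy_schwarz: "cmod (cinner x (y :: 'a :: hilbert_space)) \<le> norm x * norm y"
proof -
  define z where "z = cinner x y"
  show ?thesis
  proof (cases "z = 0")
    case False
    define a where "a = cnj z / of_real (cmod z)"
    have a: "cmod a = 1" using False by (simp add: a_def norm_divide)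
    have "cinner x (a *\<^sub>C y) = of_real (cmod z)"
      using False by (simp add: cinner_scaleC_right a_def field_simps power2_eq_square
          flip: z_def complex_norm_square)
    then have "cmod z = inner x (a *\<^sub>C y)"
      by (simp flip: Re_cinner)
    also have "\<dots> \<le> norm x * norm y"
      using norm_cauchy_schwarz[of x "a *\<^sub>C y"] by (simp add: norm_scaleC a)
    finally show ?thesis by (simp add: z_def)
  qed (simp add: z_def)
qed

lemma bounded_bilinear_cinner: "bounded_bilinear (cinner :: 'a :: hilbert_space \<Rightarrow> 'a \<Rightarrow> complex)"
proof
  fix x y z :: 'a and r :: real
  show "cinner (x + y) z = cinner x z + cinner y z" by (rule cinner_add_left)
  show "cinner x (y + z) = cinner x y + cinner x z" by (rule cinner_add_right)
  show "cinner (r *\<^sub>R x) y = r *\<^sub>R cinner x y"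
    by (simp add: cinner_scaleC_left scaleR_conv_of_real scaleC_of_real[symmetric, where 'a = 'a])
  show "cinner x (r *\<^sub>R y) = r *\<^sub>R cinner x y"
    by (simp add: cinner_scaleC_right scaleR_conv_of_real scaleC_of_real[symmetric, where 'a = 'a])
  show "\<exists>K. \<forall>x y :: 'a. cmod (cinner x y) \<le> norm x * norm y * K"
    by (rule exI[of _ 1]) (simp add: cinner_cauchy_schwarz)
qed

lemma pos_kernel_add: "pos_kernel K \<Longrightarrow> pos_kernel L \<Longrightarrow> pos_kernel (\<lambda>x y. K x y + L x y)"
  unfolding pos_kernel_def fip_add by (metis add_nonneg_nonneg complex_cnj_add plus_complex.sel(1))

lemma pos_kernel_reweight:
  assumes "pos_kernel K" "0 \<le> r"
  shows "pos_kernel (\<lambda>x y. K x y * (cnj (\<alpha> x) * \<alpha> y * of_real r))"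
  unfolding pos_kernel_def
proof (intro conjI allI)
  fix x y
  have "K x y = cnj (K y x)" using assms(1) unfolding pos_kernel_def by blast
  then show "K x y * (cnj (\<alpha> x) * \<alpha> y * of_real r) = cnj (K y x * (cnj (\<alpha> y) * \<alpha> x * of_real r))"
    by simp
next
  fix p
  have "0 \<le> Re (fip K (map (\<lambda>(a, x). (a * \<alpha> x, x)) p) (map (\<lambda>(a, x). (a * \<alpha> x, x)) p))"
    using assms(1) unfolding pos_kernel_def by blast
  with assms(2) show "0 \<le> Re (fip (\<lambda>x y. K x y * (cnj (\<alpha> x) * \<alpha> y * of_real r)) p p)"
    unfolding fip_reweight by simp
qed

lemma pos_kernel_one: "pos_kernel (\<lambda>_ _. 1)"
proof -
  have "fip (\<lambda>_ _. 1) p p = cnj (\<Sum>z\<leftarrow>p. fst z) * (\<Sum>z\<leftarrow>p. fst z)" for p :: "(complex \<times> 'a) list"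
  proof -
    have "fip (\<lambda>_ _. 1) p q = cnj (\<Sum>z\<leftarrow>p. fst z) * (\<Sum>z\<leftarrow>q. fst z)" for q :: "(complex \<times> 'a) list"
      by (induction p) (auto simp: fip_eq sum_list_const_mult distrib_right)
    then show ?thesis .
  qed
  then show ?thesis by (simp add: pos_kernel_def)
qed

text \<open>Schur's product theorem, by Gram--Schmidt elimination on the second factor.\<close>

lemma pos_kernel_mult_cinner:
  fixes v :: "'x \<Rightarrow> 'b :: hilbert_space"
  assumes K: "pos_kernel K"
  shows "pos_kernel (\<lambda>x y. K x y * cinner (v x) (v y))"
proof -
  have sym: "K x y = cnj (K y x)" for x y using K unfolding pos_kernel_def by blast
  have pos: "0 \<le> Re (fip (\<lambda>x y. K x y * cinner (v x) (v y)) p p)" for p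
  proof (induction "card {x \<in> snd ` set p. v x \<noteq> 0}" arbitrary: v rule: less_induct)
    case less
    show ?case
    proof (cases "\<exists>x \<in> snd ` set p. v x \<noteq> 0")
      case False
      then have "fip (\<lambda>x y. K x y * cinner (v x) (v y)) p p = fip (\<lambda>_ _. 0) p p"
        by (intro fip_cong) auto
      also have "\<dots> = 0" by (simp add: fip_eq)
      finally show ?thesis by simp
    next
      case True
      then obtain x0 where x0: "x0 \<in> snd ` set p" "v x0 \<noteq> 0" by blast
      define u where "u = v x0"
      define \<alpha> where "\<alpha> x = cinner u (v x) / of_real ((norm u)\<^sup>2)" for x
      define w where "w x = v x - \<alpha> x *\<^sub>C u" for x
      have u: "norm u \<noteq> 0" using x0 by (simp add: u_def)
      have ow: "cinner u (w x) = 0" for x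
        using u by (simp add: w_def cinner_diff_right cinner_scaleC_right \<alpha>_def cinner_self)
      have ow': "cinner (w x) u = 0" for x
        by (subst cinner_commute) (simp add: ow)
      have v: "v x = w x + \<alpha> x *\<^sub>C u" for x by (simp add: w_def)
      have split: "cinner (v x) (v y) = cinner (w x) (w y) + cnj (\<alpha> x) * \<alpha> y * of_real ((norm u)\<^sup>2)" for x y
        unfolding v[of x] v[of y]
        by (simp add: cinner_add_left cinner_add_right cinner_scaleC_left cinner_scaleC_right ow ow'
            cinner_self)
      have "w x0 = 0"
        using u scaleC_of_real[of 1 u] by (simp add: w_def \<alpha>_def cinner_self flip: u_def)
      moreover have "w x = 0" if "v x = 0" for x
        using that scaleC_of_real[of 0 u] by (simp add: w_def \<alpha>_def)
      ultimately have "{x \<in> snd ` set p. w x \<noteq> 0} \<subset> {x \<in> snd ` set p. v x \<noteq> 0}"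
        using x0 by blast
      then have "card {x \<in> snd ` set p. w x \<noteq> 0} < card {x \<in> snd ` set p. v x \<noteq> 0}"
        by (intro psubset_card_mono) auto
      from less[OF this] have 1: "0 \<le> Re (fip (\<lambda>x y. K x y * cinner (w x) (w y)) p p)" .
      have 2: "0 \<le> Re (fip (\<lambda>x y. K x y * (cnj (\<alpha> x) * \<alpha> y * of_real ((norm u)\<^sup>2))) p p)"
        using pos_kernel_reweight[OF K zero_le_power2[of "norm u"], of \<alpha>] unfolding pos_kernel_def by blast
      from 1 2 show ?thesis
        unfolding split distrib_left fip_add by simp
    qed
  qed
  have "K x y * cinner (v x) (v y) = cnj (K y x * cinner (v y) (v x))" for x y
    using sym[of x y] cinner_commute[of "v x" "v y"] by (metis complex_cnj_mult)
  with pos show ?thesis unfolding pos_kernel_def by blast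
qed

lemma pos_kernel_cinner: "pos_kernel (\<lambda>x y. cinner (v x) (v y :: 'b :: hilbert_space))"
  using pos_kernel_mult_cinner[OF pos_kernel_one, of v] by simp

lemma pos_kernel_cinner_power: "pos_kernel (\<lambda>x y. cinner (v x) (v y :: 'b :: hilbert_space) ^ n)"
proof (induction n)
  case 0
  show ?case using pos_kernel_one by simp
next
  case (Suc n)
  from pos_kernel_mult_cinner[OF this, of v] show ?case by (simp add: mult.commute)
qed

instantiation prod :: (hilbert_space, hilbert_space) kernel
begin
definition kern_prod :: "'a \<times> 'b \<Rightarrow> 'a \<times> 'b \<Rightarrow> complex" where
  "kern_prod p q = cinner (fst p) (fst q) * cinner (snd p) (snd q)"
instance
proof
  show "pos_kernel (kern :: 'a \<times> 'b \<Rightarrow> _)"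
    unfolding kern_prod_def[abs_def]
    by (rule pos_kernel_mult_cinner) (rule pos_kernel_cinner)
qed
end

type_synonym ('a, 'b) htensor = "('a \<times> 'b) kspace"

definition htensor :: "'a :: hilbert_space \<Rightarrow> 'b :: hilbert_space \<Rightarrow> ('a, 'b) htensor"
  (infixr "\<otimes>\<^sub>H" 75) where
  "u \<otimes>\<^sub>H v = kvec (u, v)"

lemma cinner_htensor: "cinner (u \<otimes>\<^sub>H v) (u' \<otimes>\<^sub>H v') = cinner u u' * cinner v v'"
  by (simp add: htensor_def cinner_kvec kern_prod_def)

text \<open>\<open>SymPow n f\<close> stands for \<open>f\<^bsup>\<otimes>n\<^esup>\<close>; these vectors span the symmetric \<open>n\<close>-fold tensor power
  densely, and \<open>n\<close>-particle spaces for different \<open>n\<close> are orthogonal.\<close>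

datatype 'a sympow = SymPow (particles: nat) (particle: 'a)

instantiation sympow :: (hilbert_space) kernel
begin
definition kern_sympow :: "'a sympow \<Rightarrow> 'a sympow \<Rightarrow> complex" where
  "kern_sympow x y = (if particles x = particles y
     then cinner (particle x) (particle y) ^ particles x else 0)"
instance
proof
  define L where "L M x y = (if particles x = particles y \<and> particles x < M
     then cinner (particle x) (particle y) ^ particles x else 0)" for M and x y :: "'a sympow"
  have "pos_kernel (L M)" for M
  proof (induction M)
    case 0
    show ?case by (simp add: pos_kernel_def L_def fip_eq)
  next
    case (Suc M)
    have "pos_kernel (\<lambda>x y. L M x y + cinner (particle x) (particle y) ^ M *
        (cnj (of_bool (particles x = M)) * of_bool (particles y = M) * of_real 1))"
      by (intro pos_kernel_add Suc pos_kernel_reweight pos_kernel_cinner_power) simp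
    also have "(\<lambda>x y. L M x y + cinner (particle x) (particle y) ^ M *
        (cnj (of_bool (particles x = M)) * of_bool (particles y = M) * of_real 1)) = L (Suc M)"
      by (auto simp: L_def fun_eq_iff less_Suc_eq)
    finally show ?case .
  qed
  then have L: "0 \<le> Re (fip (L M) p p)" for M p
    unfolding pos_kernel_def by blast
  have "0 \<le> Re (fip kern p p)" for p :: "(complex \<times> 'a sympow) list"
  proof -
    define M where "M = Suc (Max (insert 0 ((particles \<circ> snd) ` set p)))"
    have "particles x < M" if "x \<in> snd ` set p" for x
      using that by (auto simp: M_def less_Suc_eq_le intro!: Max_ge)
    then have "fip kern p p = fip (L M) p p"
      by (intro fip_cong) (auto simp: kern_sympow_def L_def)
    with L show ?thesis by simp
  qed
  moreover have "kern x y = cnj (kern y x)" for x y :: "'a sympow"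
    unfolding kern_sympow_def by (subst cinner_commute) simp
  ultimately show "pos_kernel (kern :: 'a sympow \<Rightarrow> _)"
    unfolding pos_kernel_def by blast
qed
end

type_synonym 'a fock = "'a sympow kspace"

text \<open>\<open>L\<^sup>2(\<real>\<^sub>+; \<complex>\<^sup>n)\<close>: the completion step only identifies functions that agree almost everywhere.\<close>

typedef (overloaded) 'n sqint = "{f :: real \<Rightarrow> complex ^ 'n :: finite.
    f \<in> borel_measurable lborel \<and> set_integrable lborel {0..} (\<lambda>s. (norm (f s))\<^sup>2)}"
  by (rule exI[of _ "\<lambda>_. 0"]) (simp add: set_integrable_def)

lemma cinner_norm_le: "cmod (cinner x (y :: 'a :: hilbert_space)) \<le> (norm x)\<^sup>2 + (norm y)\<^sup>2"
  using cinner_cauchy_schwarz[of x y] sum_squares_bound[of "norm x" "norm y"]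
    mult_nonneg_nonneg[OF norm_ge_zero norm_ge_zero, of x y]
  unfolding mult.assoc by linarith

lemma fip_integral:
  assumes "\<And>x y. integrable M (\<lambda>s. K s x y)"
  shows "integrable M (\<lambda>s. fip (K s) p q)"
    and "(\<integral>s. fip (K s) p q \<partial>M) = fip (\<lambda>x y. \<integral>s. K s x y \<partial>M) p q"
proof -
  have 1: "integrable M (\<lambda>s. fip (K s) [(1, x)] q) \<and>
    (\<integral>s. fip (K s) [(1, x)] q \<partial>M) = fip (\<lambda>x y. \<integral>s. K s x y \<partial>M) [(1, x)] q" for x
  proof (induction q)
    case (Cons z q)
    obtain b y where z: "z = (b, y)" by force
    show ?case using Cons assms unfolding z fip_Cons_right[of _ _ b y q] by simp
  qed simp
  have "integrable M (\<lambda>s. fip (K s) p q) \<and>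
    (\<integral>s. fip (K s) p q \<partial>M) = fip (\<lambda>x y. \<integral>s. K s x y \<partial>M) p q"
  proof (induction p)
    case (Cons z p)
    obtain a x where z: "z = (a, x)" by force
    show ?case using Cons 1 unfolding z fip_Cons_left[of _ a x p] by simp
  qed simp
  then show "integrable M (\<lambda>s. fip (K s) p q)"
    "(\<integral>s. fip (K s) p q \<partial>M) = fip (\<lambda>x y. \<integral>s. K s x y \<partial>M) p q" by auto
qed

lemma sqint_integrable:
  "set_integrable lborel {0..} (\<lambda>s. cinner (Rep_sqint f s) (Rep_sqint g s))"
proof -
  have meas: "Rep_sqint h \<in> borel_measurable lborel" for h :: "'a sqint"
    using Rep_sqint[of h] by simp
  have comp: "(\<lambda>s. Rep_sqint h s $ i) \<in> borel_measurable lborel" for h :: "'a sqint" and i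
    using measurable_compose[OF meas borel_measurable_continuous_onI[of "\<lambda>x. x $ i"]]
    by (simp add: continuous_on_component continuous_on_id)
  have cn: "(\<lambda>s. cnj (h s)) \<in> borel_measurable lborel" if "h \<in> borel_measurable lborel" for h
    using measurable_compose[OF that borel_measurable_continuous_onI[of cnj]]
    by (simp add: continuous_on_cnj)
  have "(\<lambda>s. cinner (Rep_sqint f s) (Rep_sqint g s)) \<in> borel_measurable lborel"
    unfolding cinner_vec_def cinner_complex_def
    by (intro borel_measurable_sum borel_measurable_times cn comp)
  moreover have "set_integrable lborel {0..} (\<lambda>s. (norm (Rep_sqint f s))\<^sup>2 + (norm (Rep_sqint g s))\<^sup>2)"
    using Rep_sqint[of f] Rep_sqint[of g] by (intro set_integral_add) auto
  ultimately show ?thesis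
    unfolding set_integrable_def
    by (elim Bochner_Integration.integrable_bound)
      (auto simp: indicator_def cinner_norm_le)
qed

instantiation sqint :: (finite) kernel
begin
definition kern_sqint :: "'a sqint \<Rightarrow> 'a sqint \<Rightarrow> complex" where
  "kern_sqint f g = (LINT s:{0..}|lborel. cinner (Rep_sqint f s) (Rep_sqint g s))"
instance
proof
  define K where "K s f g = indicat_real {0..} s *\<^sub>R cinner (Rep_sqint f s) (Rep_sqint g s)"
    for s and f g :: "'a sqint"
  have int: "integrable lborel (\<lambda>s. K s f g)" for f g
    using sqint_integrable[of f g] by (simp add: set_integrable_def K_def)
  have K: "kern = (\<lambda>f g. \<integral>s. K s f g \<partial>lborel)"
    by (simp add: fun_eq_iff kern_sqint_def K_def set_lebesgue_integral_def)
  have "0 \<le> Re (fip (K s) p p)" for s p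
  proof -
    have "pos_kernel (\<lambda>f g. cinner (Rep_sqint f s) (Rep_sqint g s) *
        (cnj 1 * 1 * of_real (indicat_real {0..} s)))"
      by (intro pos_kernel_reweight pos_kernel_cinner) simp
    also have "(\<lambda>f g. cinner (Rep_sqint f s) (Rep_sqint g s) *
        (cnj 1 * 1 * of_real (indicat_real {0..} s))) = K s"
      by (simp add: K_def fun_eq_iff scaleR_conv_of_real)
    finally show ?thesis unfolding pos_kernel_def by blast
  qed
  then have "0 \<le> (\<integral>s. Re (fip (K s) p p) \<partial>lborel)" for p
    by simp
  then have "0 \<le> Re (fip kern p p)" for p :: "(complex \<times> 'a sqint) list"
    unfolding K fip_integral(2)[OF int, symmetric]
    by (subst integral_Re[symmetric]) (use fip_integral(1)[OF int] in auto)
  moreover have "kern f g = cnj (kern g f)" for f g :: "'a sqint"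
  proof -
    have "cnj (kern g f) = (\<integral>s. cnj (K s g f) \<partial>lborel)"
      unfolding K by (simp add: integral_cnj)
    also have "\<dots> = kern f g"
      unfolding K K_def by (simp flip: cinner_commute)
    finally show ?thesis ..
  qed
  ultimately show "pos_kernel (kern :: 'a sqint \<Rightarrow> _)"
    unfolding pos_kernel_def by blast
qed
end

type_synonym 'n L2 = "'n sqint kspace"

definition l2 :: "(real \<Rightarrow> complex ^ 'n :: finite) \<Rightarrow> 'n L2" where
  "l2 f = kvec (Abs_sqint f)"

definition expvec :: "'a :: hilbert_space \<Rightarrow> 'a fock" where
  "expvec f = suminf (\<lambda>n. (1 / sqrt (fact n)) *\<^sub>R kvec (SymPow n f))"

definition nexpvec :: "'a :: hilbert_space \<Rightarrow> 'a fock" where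
  "nexpvec f = exp (- (norm f)\<^sup>2 / 2) *\<^sub>R expvec f"

lemma summable_expvec:
  "summable (\<lambda>n. (1 / sqrt (fact n)) *\<^sub>R kvec (SymPow n (f :: 'a :: hilbert_space)))"
proof (rule summable_norm_cancel)
  have "of_real ((norm (kvec (SymPow n f)))\<^sup>2) = (of_real ((norm f ^ n)\<^sup>2) :: complex)" for n
    unfolding cinner_self[symmetric] cinner_kvec kern_sympow_def
    by (simp add: cinner_self power2_eq_square power_mult_distrib)
  then have n: "norm (kvec (SymPow n f)) = norm f ^ n" for n
    unfolding of_real_eq_iff by (rule power2_eq_imp_eq) auto
  define a where "a n = norm f ^ n / sqrt (fact n)" for n
  obtain M :: nat where M: "(2 * norm f)\<^sup>2 \<le> real M" using real_arch_simple by blast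
  have "summable a"
  proof (rule summable_ratio_test[of "1 / 2" M])
    fix n assume "M \<le> n"
    with M have "(2 * norm f)\<^sup>2 \<le> real (Suc n)" by linarith
    then have "2 * norm f \<le> sqrt (real (Suc n))" by (rule real_le_rsqrt)
    then have "norm f / sqrt (real (Suc n)) \<le> 1 / 2" by (simp add: field_simps)
    then have "a n * (norm f / sqrt (real (Suc n))) \<le> a n * (1 / 2)"
      by (intro mult_left_mono) (auto simp: a_def)
    moreover have "a (Suc n) = a n * (norm f / sqrt (real (Suc n)))"
      by (simp add: a_def real_sqrt_mult mult.commute del: of_nat_Suc)
    moreover have "0 \<le> a m" for m by (simp add: a_def)
    ultimately show "norm (a (Suc n)) \<le> 1 / 2 * norm (a n)" by simp
  qed simp
  then show "summable (\<lambda>n. norm ((1 / sqrt (fact n)) *\<^sub>R kvec (SymPow n f)))"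
    by (simp add: n a_def[abs_def])
qed

lemma cinner_expvec: "cinner (expvec f) (expvec g) = exp (cinner f (g :: 'a :: hilbert_space))"
proof -
  define s where "s f N = (\<Sum>n<N. (1 / sqrt (fact n)) *\<^sub>R kvec (SymPow n f))" for f :: 'a and N
  interpret c: bounded_bilinear "cinner :: 'a fock \<Rightarrow> 'a fock \<Rightarrow> complex"
    by (rule bounded_bilinear_cinner)
  have s: "s f \<longlonglongrightarrow> expvec f" for f
    unfolding s_def[abs_def] expvec_def by (rule summable_LIMSEQ) (rule summable_expvec)
  have "cinner (s f N) (s g N) = (\<Sum>n<N. cinner f g ^ n /\<^sub>R fact n)" for N
  proof -
    have "cinner (s f N) (s g N) = (\<Sum>m<N. \<Sum>n<N. if m = n then cinner f g ^ n /\<^sub>R fact n else 0)"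
      unfolding s_def c.sum_left unfolding c.sum_right
      by (intro sum.cong refl)
        (auto simp: c.scaleR_left c.scaleR_right cinner_kvec kern_sympow_def inverse_eq_divide
          scaleR_conv_of_real simp flip: of_real_mult of_real_divide)
    then show ?thesis by simp
  qed
  moreover have "(\<lambda>N. cinner (s f N) (s g N)) \<longlonglongrightarrow> cinner (expvec f) (expvec g)"
    by (intro c.tendsto s)
  moreover have "(\<lambda>N. \<Sum>n<N. cinner f g ^ n /\<^sub>R fact n) \<longlonglongrightarrow> exp (cinner f g)"
    using exp_converges[of "cinner f g"] by (simp add: sums_def)
  ultimately show ?thesis using LIMSEQ_unique by fastforce
qed

text \<open>The tensor product of a Hilbert space with \<open>\<complex>\<^sup>I\<close>, \<open>I\<close> finite, is the direct sum of \<open>I\<close> copies;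
  \<open>axis i 1\<close> are the standard basis vectors of \<open>\<complex>\<^sup>I\<close>.\<close>

definition ftensor :: "'a :: complex_normed_vector \<Rightarrow> complex ^ 'i \<Rightarrow> 'a ^ 'i" (infixl "\<otimes>\<^sub>F" 74) where
  "u \<otimes>\<^sub>F \<xi> = (\<chi> i. (\<xi> $ i) *\<^sub>C u)"

lemma cinner_ftensor:
  "cinner (u \<otimes>\<^sub>F \<xi>) (v \<otimes>\<^sub>F \<zeta>) = cinner (u :: 'a :: hilbert_space) v * cinner \<xi> (\<zeta> :: complex ^ 'i :: finite)"
  by (simp add: cinner_vec_def ftensor_def cinner_scaleC_left cinner_scaleC_right cinner_complex_def
      sum_distrib_left algebra_simps)

text \<open>\<open>\<complex> \<oplus> \<complex>\<^sup>n\<close> is modelled as \<open>complex ^ 'n option\<close>, the index \<open>None\<close> belonging to the summand \<open>\<complex>\<close>.\<close>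

definition hat :: "complex ^ 'n :: finite \<Rightarrow> complex ^ 'n option" where
  "hat z = (\<chi> \<alpha>. case \<alpha> of None \<Rightarrow> 1 | Some j \<Rightarrow> z $ j)"

definition block ::
  "('a \<Rightarrow> 'b) \<Rightarrow> ('a ^ 'n \<Rightarrow> 'b) \<Rightarrow> ('a \<Rightarrow> 'b ^ 'n) \<Rightarrow> ('a ^ 'n \<Rightarrow> 'b ^ 'n) \<Rightarrow>
   'a ^ 'n :: finite option \<Rightarrow> ('b :: real_normed_vector) ^ 'n option" where
  "block A B C D v = (let v0 = v $ None; v1 = (\<chi> j. v $ Some j) in
     \<chi> \<alpha>. case \<alpha> of None \<Rightarrow> A v0 + B v1 | Some j \<Rightarrow> (C v0 + D v1) $ j)"

definition Delta :: "('a :: real_normed_vector) ^ 'n :: finite option \<Rightarrow> 'a ^ 'n option" where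
  "Delta v = (\<chi> \<alpha>. case \<alpha> of None \<Rightarrow> 0 | Some j \<Rightarrow> v $ Some j)"


section \<open>The free unital \<open>*\<close>-algebra\<close>

datatype 'n letter = Gen 'n | Adj 'n

fun adj_letter :: "'n letter \<Rightarrow> 'n letter" where
  "adj_letter (Gen i) = Adj i"
| "adj_letter (Adj i) = Gen i"

fun gen_index :: "'n letter \<Rightarrow> 'n" where
  "gen_index (Gen i) = i"
| "gen_index (Adj i) = i"

datatype 'n sword = Sword (letters: "'n letter list")

instantiation sword :: (type) monoid_add
begin
definition zero_sword :: "'a sword" where "zero_sword = Sword []"
definition plus_sword :: "'a sword \<Rightarrow> 'a sword \<Rightarrow> 'a sword" where
  "plus_sword v w = Sword (letters v @ letters w)"
instance by standard (simp_all add: zero_sword_def plus_sword_def)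
end

text \<open>Addition of words is concatenation, so the multiplication of \<open>\<Rightarrow>\<^sub>0\<close> is that of non-commutative
  polynomials in the letters.\<close>

type_synonym 'n ncpoly = "'n sword \<Rightarrow>\<^sub>0 complex"

definition pletter :: "'n letter \<Rightarrow> 'n ncpoly" where
  "pletter a = Poly_Mapping.single (Sword [a]) 1"

definition pconst :: "complex \<Rightarrow> 'n ncpoly" where
  "pconst c = Poly_Mapping.single 0 c"

definition star_word :: "'n sword \<Rightarrow> 'n sword" where
  "star_word w = Sword (rev (map adj_letter (letters w)))"

definition pstar :: "'n ncpoly \<Rightarrow> 'n ncpoly" where
  "pstar p = (\<Sum>w\<in>Poly_Mapping.keys p.
     Poly_Mapping.single (star_word w) (cnj (Poly_Mapping.lookup p w)))"


section \<open>The non-commutative spheres\<close>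

definition cstar_seminorm :: "('n ncpoly \<Rightarrow> real) \<Rightarrow> bool" where
  "cstar_seminorm p \<longleftrightarrow>
    (\<forall>x. 0 \<le> p x) \<and>
    (\<forall>x y. p (x + y) \<le> p x + p y) \<and>
    (\<forall>c x. p (pconst c * x) = cmod c * p x) \<and>
    (\<forall>x y. p (x * y) \<le> p x * p y) \<and>
    (\<forall>x. p (pstar x * x) = (p x)\<^sup>2)"

text \<open>The universal unital \<open>C\<^sup>*\<close>-algebra generated by \<open>z\<^sub>i\<close> subject to \<open>r = 0\<close> \<open>(r \<in> R)\<close> is the Hausdorff
  completion of the free unital \<open>*\<close>-algebra for the largest \<open>C\<^sup>*\<close>-seminorm vanishing on \<open>R\<close>. The
  supremum is taken in \<open>[0, \<infinity>]\<close>; it is finite for the relations used here.\<close>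

definition universal_norm :: "'n ncpoly set \<Rightarrow> 'n ncpoly \<Rightarrow> ennreal" where
  "universal_norm R x = (SUP p\<in>{p. cstar_seminorm p \<and> (\<forall>r\<in>R. p r = 0)}. ennreal (p x))"

definition free_sphere_rels :: "'n :: finite ncpoly set" where
  "free_sphere_rels =
    {(\<Sum>i\<in>UNIV. pletter (Gen i) * pletter (Adj i)) - 1,
     (\<Sum>i\<in>UNIV. pletter (Adj i) * pletter (Gen i)) - 1}"

text \<open>In this order: the free sphere, the twisted sphere (\<open>\<alpha>\<beta> = -\<beta>\<alpha>\<close>), the half-liberated sphere
  (\<open>abc = cba\<close>) and its twist (\<open>\<alpha>\<beta>\<gamma> = -\<gamma>\<beta>\<alpha>\<close>).\<close>

datatype sphere = Free | Twisted | Half_Liberated | Twisted_Half_Liberated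

fun sphere_rels :: "sphere \<Rightarrow> 'n ncpoly set" where
  "sphere_rels Free = {}"
| "sphere_rels Twisted =
    {pletter a * pletter b + pletter b * pletter a | a b. gen_index a \<noteq> gen_index b} \<union>
    {pletter a * pletter b - pletter b * pletter a | a b. gen_index a = gen_index b}"
| "sphere_rels Half_Liberated =
    {pletter a * pletter b * pletter c - pletter c * pletter b * pletter a | a b c. True}"
| "sphere_rels Twisted_Half_Liberated =
    {pletter a * pletter b * pletter c + pletter c * pletter b * pletter a | a b c.
       distinct [gen_index a, gen_index b, gen_index c]} \<union>
    {pletter a * pletter b * pletter c - pletter c * pletter b * pletter a | a b c.
       \<not> distinct [gen_index a, gen_index b, gen_index c]}"

definition two_sided_ideal :: "'a :: ring_1 set \<Rightarrow> bool" where
  "two_sided_ideal I \<longleftrightarrow> 0 \<in> I \<and> (\<forall>x\<in>I. \<forall>y\<in>I. x + y \<in> I) \<and> (\<forall>a. \<forall>x\<in>I. a * x \<in> I \<and> x * a \<in> I)"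

text \<open>The norm of the class of \<open>x\<close> in the quotient of the free sphere algebra by the closed ideal
  generated by the relations is the distance of \<open>x\<close> to that ideal; as the ideal of the free
  \<open>*\<close>-algebra generated by the relations is dense in it, it suffices to take the infimum there.\<close>

definition sphere_norm :: "sphere \<Rightarrow> 'n :: finite ncpoly \<Rightarrow> ennreal" where
  "sphere_norm K x =
    (INF y\<in>two_sided_ideal hull (sphere_rels K). universal_norm free_sphere_rels (x + y))"

fun letter_op :: "('n \<Rightarrow> 'h :: hilbert_space \<Rightarrow>\<^sub>L 'h) \<Rightarrow> 'n letter \<Rightarrow> 'h \<Rightarrow>\<^sub>L 'h" where
  "letter_op Z (Gen i) = Z i"
| "letter_op Z (Adj i) = adj (Z i)"

definition word_op :: "('n \<Rightarrow> 'h :: hilbert_space \<Rightarrow>\<^sub>L 'h) \<Rightarrow> 'n sword \<Rightarrow> 'h \<Rightarrow>\<^sub>L 'h" where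
  "word_op Z w = foldr (\<lambda>a T. letter_op Z a o\<^sub>L T) (letters w) id_blinfun"

definition poly_op :: "('n \<Rightarrow> 'h :: hilbert_space \<Rightarrow>\<^sub>L 'h) \<Rightarrow> 'n ncpoly \<Rightarrow> 'h \<Rightarrow>\<^sub>L 'h" where
  "poly_op Z p = (\<Sum>w\<in>Poly_Mapping.keys p. Poly_Mapping.lookup p w *\<^sub>C word_op Z w)"

text \<open>A sphere algebra regarded as a unital \<open>C\<^sup>*\<close>-subalgebra of \<open>B(h)\<close>: the unital
  \<open>*\<close>-homomorphism sending the generators to the operators \<open>Z i\<close> is an isometry for the norm of
  the sphere algebra, equivalently an injective \<open>*\<close>-homomorphism on it.\<close>

definition sphere_in_B :: "sphere \<Rightarrow> ('n :: finite \<Rightarrow> 'h :: hilbert_space \<Rightarrow>\<^sub>L 'h) \<Rightarrow> bool" where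
  "sphere_in_B K Z \<longleftrightarrow> (\<forall>i. Z i \<in> bop) \<and> (\<forall>x. ennreal (norm (poly_op Z x)) = sphere_norm K x)"

definition unital_star_subalgebra :: "('h :: hilbert_space \<Rightarrow>\<^sub>L 'h) set \<Rightarrow> bool" where
  "unital_star_subalgebra B \<longleftrightarrow>
    csubspace B \<and> id_blinfun \<in> B \<and> (\<forall>x\<in>B. \<forall>y\<in>B. x o\<^sub>L y \<in> B) \<and> (\<forall>x\<in>B. adj x \<in> B)"

definition A0 :: "('n \<Rightarrow> 'h :: hilbert_space \<Rightarrow>\<^sub>L 'h) \<Rightarrow> ('h \<Rightarrow>\<^sub>L 'h) set" where
  "A0 Z = unital_star_subalgebra hull (range Z)"

definition Aclosed :: "('n \<Rightarrow> 'h :: hilbert_space \<Rightarrow>\<^sub>L 'h) \<Rightarrow> ('h \<Rightarrow>\<^sub>L 'h) set" where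
  "Aclosed Z = closure (A0 Z)"

definition star_hom ::
  "('h :: hilbert_space \<Rightarrow>\<^sub>L 'h) set \<Rightarrow> (('h \<Rightarrow>\<^sub>L 'h) \<Rightarrow> ('g :: hilbert_space \<Rightarrow>\<^sub>L 'g)) \<Rightarrow> bool" where
  "star_hom A \<pi> \<longleftrightarrow> clinear_on A \<pi> \<and> \<pi> ` A \<subseteq> bop \<and>
    (\<forall>x\<in>A. \<forall>y\<in>A. \<pi> (x o\<^sub>L y) = \<pi> x o\<^sub>L \<pi> y) \<and> (\<forall>x\<in>A. \<pi> (adj x) = adj (\<pi> x))"


section \<open>The generator\<close>

definition charge :: "'n \<Rightarrow> 'n sword \<Rightarrow> int" where
  "charge j w = int (count_list (letters w) (Gen j)) - int (count_list (letters w) (Adj j))"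

definition charge_derivation ::
  "('n \<Rightarrow> 'h :: hilbert_space \<Rightarrow>\<^sub>L 'h) \<Rightarrow> 'n \<Rightarrow> (('h \<Rightarrow>\<^sub>L 'h) \<Rightarrow> ('h \<Rightarrow>\<^sub>L 'h)) \<Rightarrow> bool" where
  "charge_derivation Z j D \<longleftrightarrow>
    D ` A0 Z \<subseteq> A0 Z \<and> clinear_on (A0 Z) D \<and>
    (\<forall>x\<in>A0 Z. \<forall>y\<in>A0 Z. D (x o\<^sub>L y) = (D x o\<^sub>L y) + (x o\<^sub>L D y)) \<and>
    (\<forall>w. D (word_op Z w) = of_int (charge j w) *\<^sub>C word_op Z w)"

definition delta ::
  "('n :: finite \<Rightarrow> complex) \<Rightarrow> ('n \<Rightarrow> ('h :: hilbert_space \<Rightarrow>\<^sub>L 'h) \<Rightarrow> ('h \<Rightarrow>\<^sub>L 'h)) \<Rightarrow>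
    ('h \<Rightarrow>\<^sub>L 'h) \<Rightarrow> 'h \<Rightarrow> 'h ^ 'n" where
  "delta c d x u = (\<Sum>j\<in>UNIV. c j *\<^sub>C (d j x u \<otimes>\<^sub>F axis j 1))"

definition tau ::
  "('n :: finite \<Rightarrow> complex) \<Rightarrow> ('n \<Rightarrow> ('h :: hilbert_space \<Rightarrow>\<^sub>L 'h) \<Rightarrow> ('h \<Rightarrow>\<^sub>L 'h)) \<Rightarrow>
    ('h \<Rightarrow>\<^sub>L 'h) \<Rightarrow> 'h \<Rightarrow>\<^sub>L 'h" where
  "tau c d x = (- 1 / 2) *\<^sub>R (\<Sum>j\<in>UNIV. (cmod (c j))\<^sup>2 *\<^sub>R d j (d j x))"

definition phi ::
  "('n :: finite \<Rightarrow> complex) \<Rightarrow> ('n \<Rightarrow> ('h :: hilbert_space \<Rightarrow>\<^sub>L 'h) \<Rightarrow> ('h \<Rightarrow>\<^sub>L 'h)) \<Rightarrow>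
    ('h \<Rightarrow>\<^sub>L 'h) \<Rightarrow> ('h ^ 'n option) \<Rightarrow>\<^sub>L ('h ^ 'n option)" where
  "phi c d x = Blinfun (block (tau c d x) (cadj (delta c d (adj x))) (delta c d x) (\<lambda>_. 0))"

definition op_ftensor ::
  "('h :: hilbert_space \<Rightarrow>\<^sub>L 'h) \<Rightarrow> ((complex ^ 'i) \<Rightarrow>\<^sub>L (complex ^ 'i)) \<Rightarrow> ('h ^ 'i :: finite) \<Rightarrow>\<^sub>L ('h ^ 'i)" where
  "op_ftensor y T = Blinfun (\<lambda>v. \<Sum>\<beta>\<in>UNIV. y (v $ \<beta>) \<otimes>\<^sub>F T (axis \<beta> 1))"

definition A0_tensor_B ::
  "('n :: finite \<Rightarrow> 'h :: hilbert_space \<Rightarrow>\<^sub>L 'h) \<Rightarrow> (('h ^ 'n option) \<Rightarrow>\<^sub>L ('h ^ 'n option)) set" where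
  "A0_tensor_B Z = cspan {op_ftensor y T | y T. y \<in> A0 Z \<and> T \<in> bop}"

text \<open>The matrix entry \<open>E\<^bsup>e\<^sub>\<alpha>\<^esup> M E\<^bsub>e\<^sub>\<beta>\<^esub>\<close> of an operator \<open>M\<close> on \<open>h \<otimes> \<complex>\<^sup>I\<close>.\<close>

definition entry ::
  "(('h :: hilbert_space ^ 'i) \<Rightarrow>\<^sub>L ('h ^ 'i)) \<Rightarrow> 'i :: finite \<Rightarrow> 'i \<Rightarrow> 'h \<Rightarrow>\<^sub>L 'h" where
  "entry M \<alpha> \<beta> = Blinfun (\<lambda>u. M (u \<otimes>\<^sub>F axis \<beta> 1) $ \<alpha>)"

text \<open>The linear extension of \<open>y \<otimes> T \<mapsto> J y \<otimes> T\<close>, computed from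
  \<open>M = \<Sum>\<^sub>\<alpha>\<^sub>\<beta> entry M \<alpha> \<beta> \<otimes> |e\<^sub>\<alpha>\<rangle>\<langle>e\<^sub>\<beta>|\<close>; see \<open>jtilde_op_ftensor\<close> below.\<close>

definition jtilde ::
  "(('h :: hilbert_space \<Rightarrow>\<^sub>L 'h) \<Rightarrow> 'g \<Rightarrow> 'g) \<Rightarrow> (('h ^ 'i) \<Rightarrow>\<^sub>L ('h ^ 'i)) \<Rightarrow>
    'g :: hilbert_space ^ 'i :: finite \<Rightarrow> 'g ^ 'i" where
  "jtilde J M v = (\<chi> \<alpha>. \<Sum>\<beta>\<in>UNIV. J (entry M \<alpha> \<beta>) (v $ \<beta>))"

lemma bounded_linear_ftensor:
  "bounded_linear (\<lambda>u :: 'a :: complex_normed_vector. u \<otimes>\<^sub>F (\<xi> :: complex ^ 'i :: finite))"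
proof (rule bounded_linear_intro[where K = "norm \<xi>"])
  fix u v :: 'a and r :: real
  show "(u + v) \<otimes>\<^sub>F \<xi> = u \<otimes>\<^sub>F \<xi> + v \<otimes>\<^sub>F \<xi>"
    by (simp add: ftensor_def vec_eq_iff scaleC_add_right)
  show "(r *\<^sub>R u) \<otimes>\<^sub>F \<xi> = r *\<^sub>R (u \<otimes>\<^sub>F \<xi>)"
    by (simp add: ftensor_def vec_eq_iff scaleC_scaleC mult.commute scaleC_of_real[symmetric, where 'a = 'a])
  show "norm (u \<otimes>\<^sub>F \<xi>) \<le> norm u * norm \<xi>"
    by (simp add: ftensor_def norm_vec_def norm_scaleC mult.commute flip: L2_set_right_distrib)
qed

lemma op_ftensor_apply:
  "op_ftensor y T v = (\<Sum>\<beta>\<in>UNIV. y (v $ \<beta>) \<otimes>\<^sub>F T (axis \<beta> 1))"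
proof -
  have "bounded_linear (\<lambda>v :: 'a ^ 'b. y (v $ \<beta>) \<otimes>\<^sub>F T (axis \<beta> 1))" for \<beta>
    by (rule bounded_linear_compose[OF bounded_linear_ftensor
        bounded_linear_compose[OF blinfun.bounded_linear_right bounded_linear_vec_nth]])
  then have "bounded_linear (\<lambda>v :: 'a ^ 'b. \<Sum>\<beta>\<in>UNIV. y (v $ \<beta>) \<otimes>\<^sub>F T (axis \<beta> 1))"
    by (intro bounded_linear_sum) auto
  then show ?thesis by (simp add: op_ftensor_def bounded_linear_Blinfun_apply)
qed

lemma entry_apply: "entry M \<alpha> \<beta> u = M (u \<otimes>\<^sub>F axis \<beta> 1) $ \<alpha>"
proof -
  have "bounded_linear (\<lambda>u. M (u \<otimes>\<^sub>F axis \<beta> 1) $ \<alpha>)"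
    by (rule bounded_linear_compose[OF bounded_linear_vec_nth
        bounded_linear_compose[OF blinfun.bounded_linear_right bounded_linear_ftensor]])
  then show ?thesis by (simp add: entry_def bounded_linear_Blinfun_apply)
qed

lemma jtilde_op_ftensor:
  fixes y :: "'h :: hilbert_space \<Rightarrow>\<^sub>L 'h" and v :: "'g :: hilbert_space ^ 'i :: finite"
  assumes "\<And>\<beta>. clinear_on A (\<lambda>y. J y (v $ \<beta>))" "y \<in> A"
  shows "jtilde J (op_ftensor y T) v = (\<Sum>\<beta>\<in>UNIV. J y (v $ \<beta>) \<otimes>\<^sub>F T (axis \<beta> 1))"
proof -
  have "entry (op_ftensor y T) \<alpha> \<beta> = T (axis \<beta> 1) $ \<alpha> *\<^sub>C y" for \<alpha> \<beta>
  proof (rule blinfun_eqI)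
    fix u
    have "entry (op_ftensor y T) \<alpha> \<beta> u = (\<Sum>\<gamma>\<in>UNIV. T (axis \<gamma> 1) $ \<alpha> *\<^sub>C y ((axis \<beta> 1 $ \<gamma>) *\<^sub>C u))"
      by (simp add: entry_apply op_ftensor_apply ftensor_def)
    also have "\<dots> = (\<Sum>\<gamma>\<in>{\<beta>}. T (axis \<gamma> 1) $ \<alpha> *\<^sub>C y ((axis \<beta> 1 $ \<gamma>) *\<^sub>C u))"
    proof (rule sum.mono_neutral_right)
      show "\<forall>\<gamma>\<in>UNIV - {\<beta>}. T (axis \<gamma> 1) $ \<alpha> *\<^sub>C y ((axis \<beta> 1 $ \<gamma>) *\<^sub>C u) = 0"
        using scaleC_of_real[of 0 u] norm_scaleC[of _ "0 :: 'h"]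
        by (auto simp: axis_def blinfun.zero_right)
    qed auto
    also have "\<dots> = T (axis \<beta> 1) $ \<alpha> *\<^sub>C y u"
      using scaleC_of_real[of 1 u] by (simp add: axis_def)
    also have "\<dots> = (T (axis \<beta> 1) $ \<alpha> *\<^sub>C y) u" by (simp add: scaleC_blinfun.rep_eq)
    finally show "entry (op_ftensor y T) \<alpha> \<beta> u = (T (axis \<beta> 1) $ \<alpha> *\<^sub>C y) u" .
  qed
  with assms show ?thesis
    by (simp add: jtilde_def clinear_on_def vec_eq_iff ftensor_def)
qed


section \<open>Quantum stochastic processes and solutions\<close>

text \<open>Right-continuous step functions of compact support on \<open>\<real>\<^sub>+\<close>, extended by \<open>0\<close> to negative times.\<close>

definition Lstep :: "(real \<Rightarrow> complex ^ 'n :: finite) set" where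
  "Lstep = {f. \<exists>(m :: nat) a b z. (\<forall>i<m. 0 \<le> a i) \<and>
     f = (\<lambda>t. \<Sum>i<m. indicat_real {a i..<b i} t *\<^sub>R z i)}"

lemma Rep_Abs_sqint:
  assumes "f \<in> Lstep"
  shows "Rep_sqint (Abs_sqint f) = f"
proof -
  obtain m a b z where f: "f = (\<lambda>t. \<Sum>i<(m :: nat). indicat_real {a i..<b i} t *\<^sub>R z i)"
    using assms by (auto simp: Lstep_def)
  have int: "integrable lborel f"
  proof -
    have "integrable lborel (indicat_real {a i..<b i})" for i
      by (cases "a i \<le> b i") (auto intro!: integrable_real_indicator)
    then show ?thesis
      unfolding f by (intro Bochner_Integration.integrable_sum integrable_scaleR_left) auto
  qed
  define B where "B = (\<Sum>i<m. norm (z i))"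
  have B: "norm (f t) \<le> B" for t
    unfolding f B_def
    by (rule order_trans[OF norm_sum sum_mono]) (auto simp: indicator_def)
  have "integrable lborel (\<lambda>s. indicat_real {0..} s *\<^sub>R (norm (f s))\<^sup>2)"
  proof (rule Bochner_Integration.integrable_bound)
    show "integrable lborel (\<lambda>s. B * norm (f s))" using int by simp
    show "(\<lambda>s. indicat_real {0..} s *\<^sub>R (norm (f s))\<^sup>2) \<in> borel_measurable lborel"
      using int by auto
    have "indicat_real {0..} s *\<^sub>R (norm (f s))\<^sup>2 \<le> B * norm (f s)" for s
      using mult_right_mono[OF B[of s], of "norm (f s)"] order_trans[OF norm_ge_zero B[of s]]
      by (auto simp: indicator_def power2_eq_square)
    moreover have "0 \<le> B" using order_trans[OF norm_ge_zero B[of 0]] .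
    ultimately show "AE s in lborel.
        norm (indicat_real {0..} s *\<^sub>R (norm (f s))\<^sup>2) \<le> norm (B * norm (f s))"
      by (intro AE_I2) (simp add: abs_mult)
  qed
  with int show ?thesis by (intro Abs_sqint_inverse) (auto simp: set_integrable_def)
qed

definition before :: "real \<Rightarrow> (real \<Rightarrow> complex ^ 'n :: finite) \<Rightarrow> real \<Rightarrow> complex ^ 'n" where
  "before t f = (\<lambda>s. indicat_real {0..<t} s *\<^sub>R f s)"

definition after :: "real \<Rightarrow> (real \<Rightarrow> complex ^ 'n :: finite) \<Rightarrow> real \<Rightarrow> complex ^ 'n" where
  "after t f = (\<lambda>s. indicat_real {t..} s *\<^sub>R f s)"

abbreviation varpi :: "(real \<Rightarrow> complex ^ 'n :: finite) \<Rightarrow> 'n L2 fock" where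
  "varpi f \<equiv> nexpvec (l2 f)"

type_synonym ('h, 'n) hF = "('h, 'n L2 fock) htensor"

definition Edom :: "'n :: finite L2 fock set" where
  "Edom = cspan {expvec (l2 f) | f. f \<in> Lstep}"

definition hEdom :: "('h :: hilbert_space, 'n :: finite) hF set" where
  "hEdom = cspan {u \<otimes>\<^sub>H e | u e. e \<in> Edom}"

definition hEkdom :: "(('h :: hilbert_space, 'n :: finite) hF ^ 'n option) set" where
  "hEkdom = cspan {\<theta> \<otimes>\<^sub>F \<xi> | \<theta> \<xi>. \<theta> \<in> hEdom}"

text \<open>Operators with domain \<open>h \<otimes> E\<close> (algebraic tensor product) are represented by total functions, of
  which only the values on \<open>hEdom\<close> matter. \<open>E\<^sub>z\<close> is written out as \<open>\<lambda>u. u \<otimes>\<^sub>H z\<close> and \<open>E\<^sup>z\<close> as its adjoint.\<close>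

definition operator_process ::
  "(real \<Rightarrow> ('h :: hilbert_space, 'n :: finite) hF \<Rightarrow> ('h, 'n) hF) \<Rightarrow> bool" where
  "operator_process X \<longleftrightarrow>
    (\<forall>t\<ge>0. clinear_on hEdom (X t)) \<and>
    (\<forall>\<xi>\<in>hEdom. \<forall>\<eta>. (\<lambda>t. cinner \<eta> (X t \<xi>)) \<in> borel_measurable (lebesgue_on {0..})) \<and>
    (\<forall>t\<ge>0. \<forall>f\<in>Lstep. \<forall>g\<in>Lstep. \<forall>u.
      cadj (\<lambda>u. u \<otimes>\<^sub>H varpi f) (X t (u \<otimes>\<^sub>H varpi g)) =
      cinner (varpi (after t f)) (varpi (after t g)) *\<^sub>C
        cadj (\<lambda>u. u \<otimes>\<^sub>H varpi (before t f)) (X t (u \<otimes>\<^sub>H varpi (before t g))))"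

definition strongly_measurable :: "(real \<Rightarrow> 'g :: real_normed_vector) \<Rightarrow> bool" where
  "strongly_measurable F \<longleftrightarrow>
    (\<exists>s. (\<forall>i :: nat. simple_function (lebesgue_on {0..}) (s i)) \<and>
         (AE t in lebesgue_on {0..}. (\<lambda>i. s i t) \<longlonglongrightarrow> F t))"

definition locally_integrable_power :: "nat \<Rightarrow> (real \<Rightarrow> 'g :: real_normed_vector) \<Rightarrow> bool" where
  "locally_integrable_power p F \<longleftrightarrow>
    strongly_measurable F \<and> (\<forall>T\<ge>0. set_integrable lebesgue {0..T} (\<lambda>t. norm (F t) ^ p))"

definition integrable_process ::
  "(real \<Rightarrow> ('h :: hilbert_space, 'n :: finite) hF ^ 'n option \<Rightarrow> ('h, 'n) hF ^ 'n option) \<Rightarrow> bool" where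
  "integrable_process L \<longleftrightarrow>
    (AE t in lebesgue_on {0..}. \<forall>f\<in>Lstep. \<forall>g\<in>Lstep. \<forall>\<xi> \<zeta> u.
      cadj (\<lambda>u. (u \<otimes>\<^sub>H varpi f) \<otimes>\<^sub>F \<xi>) (L t ((u \<otimes>\<^sub>H varpi g) \<otimes>\<^sub>F \<zeta>)) =
      cinner (varpi (after t f)) (varpi (after t g)) *\<^sub>C
        cadj (\<lambda>u. (u \<otimes>\<^sub>H varpi (before t f)) \<otimes>\<^sub>F \<xi>) (L t ((u \<otimes>\<^sub>H varpi (before t g)) \<otimes>\<^sub>F \<zeta>))) \<and>
    (\<forall>\<theta>\<in>hEkdom. strongly_measurable (\<lambda>t. L t \<theta>)) \<and>
    (\<forall>u. \<forall>f\<in>Lstep.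
      locally_integrable_power 1
        (\<lambda>t. L t ((u \<otimes>\<^sub>H varpi f) \<otimes>\<^sub>F hat (f t)) - Delta (L t ((u \<otimes>\<^sub>H varpi f) \<otimes>\<^sub>F hat (f t)))) \<and>
      locally_integrable_power 2 (\<lambda>t. Delta (L t ((u \<otimes>\<^sub>H varpi f) \<otimes>\<^sub>F hat (f t)))))"

definition solution ::
  "('n :: finite \<Rightarrow> 'h :: hilbert_space \<Rightarrow>\<^sub>L 'h) \<Rightarrow>
    (real \<Rightarrow> ('h \<Rightarrow>\<^sub>L 'h) \<Rightarrow> ('h, 'n) hF \<Rightarrow> ('h, 'n) hF) \<Rightarrow> bool" where
  "solution Z j \<longleftrightarrow>
    (\<forall>t\<ge>0. \<forall>\<xi>\<in>hEdom. clinear_on (A0 Z) (\<lambda>x. j t x \<xi>)) \<and>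
    (\<forall>x\<in>A0 Z. operator_process (\<lambda>t. j t x))"

definition strong_solution ::
  "('n :: finite \<Rightarrow> 'h :: hilbert_space \<Rightarrow>\<^sub>L 'h) \<Rightarrow>
    (('h \<Rightarrow>\<^sub>L 'h) \<Rightarrow> (('h ^ 'n option) \<Rightarrow>\<^sub>L ('h ^ 'n option))) \<Rightarrow>
    (real \<Rightarrow> ('h \<Rightarrow>\<^sub>L 'h) \<Rightarrow> ('h, 'n) hF \<Rightarrow> ('h, 'n) hF) \<Rightarrow> bool" where
  "strong_solution Z \<phi> j \<longleftrightarrow> solution Z j \<and>
    (\<forall>x\<in>A0 Z.
      (\<forall>u. \<forall>e\<in>Edom. j 0 x (u \<otimes>\<^sub>H e) = x u \<otimes>\<^sub>H e) \<and>
      integrable_process (\<lambda>t. jtilde (j t) (\<phi> x)) \<and>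
      (\<forall>u v. \<forall>f\<in>Lstep. \<forall>g\<in>Lstep. \<forall>t\<ge>0.
        cinner (u \<otimes>\<^sub>H varpi f) (j t x (v \<otimes>\<^sub>H varpi g) - j 0 x (v \<otimes>\<^sub>H varpi g)) =
        (LINT s:{0..t}|lebesgue. cinner (u \<otimes>\<^sub>H varpi f)
          (cadj (\<lambda>\<theta>. \<theta> \<otimes>\<^sub>F hat (f s))
            (jtilde (j s) (\<phi> x) ((v \<otimes>\<^sub>H varpi g) \<otimes>\<^sub>F hat (g s)))))))"

definition weakly_multiplicative ::
  "('n :: finite \<Rightarrow> 'h :: hilbert_space \<Rightarrow>\<^sub>L 'h) \<Rightarrow>
    (real \<Rightarrow> ('h \<Rightarrow>\<^sub>L 'h) \<Rightarrow> ('h, 'n) hF \<Rightarrow> ('h, 'n) hF) \<Rightarrow> bool" where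
  "weakly_multiplicative Z j \<longleftrightarrow>
    (\<forall>t\<ge>0. \<forall>x\<in>A0 Z. \<forall>y\<in>A0 Z. \<forall>\<zeta>\<in>hEdom. \<forall>\<xi>\<in>hEdom.
      cinner (j t x \<zeta>) (j t y \<xi>) = cinner \<zeta> (j t (adj x o\<^sub>L y) \<xi>))"

end

theory Submission
  imports Defs
begin

text \<open>The solution is explicit: on a word \<open>b\<close> with charges \<open>n\<^sub>1, \<dots>, n\<^sub>N\<close> it is \<open>j\<^sub>t(b) = b \<otimes> W(\<xi> 1\<^bsub>[0,t)\<^esub>)\<close>,
  where \<open>\<xi> = (c\<^sub>i n\<^sub>i)\<^sub>i\<close> and \<open>W\<close> are the Weyl operators. The inner products of such vectors \<open>\<xi>\<close> are
  real, so the Weyl operators involved commute and \<open>j\<^sub>t\<close> is the substitution \<open>z\<^sub>i \<mapsto> z\<^sub>i \<otimes> U\<^sub>i\<close> with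
  commuting unitaries \<open>U\<^sub>i\<close>. The defining relations of the spheres are homogeneous for the charge
  grading, hence are preserved by this substitution, and universality of the sphere norm makes \<open>j\<^sub>t\<close>
  well defined and contractive. The same argument for scalar \<open>U\<^sub>i\<close> gives the gauge automorphisms,
  whose derivatives are the derivations. The differential equation holds because the matrix elements of
  \<open>j\<^sub>t(b)\<close> in exponential vectors are exponentials of piecewise linear functions of \<open>t\<close>.\<close>

text \<open>On a word with charge vector n every entry of the generator is a scalar multiple of that
  word, so the stochastic equation reduces to scalar equations for matrix elements of W(\<xi>
  1_[0,t)), and no iteration scheme enters. The logarithm of such an element has derivative <f(t),
  \<xi>> - <\<xi>, g(t)> - ||\<xi>||^2 / 2. The three terms are \<delta>, its adjoint (the minus
  sign reflects that adjoint words have opposite charge) and \<tau>, since ||\<xi>||^2 is the sum of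
  |c_j|^2 n_j^2. The obstacle is that words may be linearly dependent in the concrete algebra, whose
  dependencies are known only through its norm, so nothing can be defined word by word without an
  estimate. The estimate used twice concerns representations whose words have the form T_n(b), with
  T_n linear and dependent only on the charge n of b. T_n is multiplication by a phase for the
  derivations, and x -> x \<otimes> W_t(n) for the solution. All measurability and integrability
  demanded of the processes is derived from one property, right-continuity together with local
  boundedness.\<close>

section \<open>Complex subspaces, spans and linear maps\<close>

lemma scaleC_one [simp]: "1 *\<^sub>C x = (x :: 'a :: complex_normed_vector)"
  using scaleC_of_real[of 1 x] by simp

lemma scaleC_zero_left [simp]: "0 *\<^sub>C x = (0 :: 'a :: complex_normed_vector)"
  using scaleC_of_real[of 0 x] by simp

lemma bounded_bilinear_scaleC:
  "bounded_bilinear (scaleC :: complex \<Rightarrow> 'a :: complex_normed_vector \<Rightarrow> 'a)"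
proof
  fix a a' :: complex and x x' :: 'a and r :: real
  show "(a + a') *\<^sub>C x = a *\<^sub>C x + a' *\<^sub>C x" by (rule scaleC_add_left)
  show "a *\<^sub>C (x + x') = a *\<^sub>C x + a *\<^sub>C x'" by (rule scaleC_add_right)
  show "(r *\<^sub>R a) *\<^sub>C x = r *\<^sub>R a *\<^sub>C x"
    by (simp add: scaleC_scaleC scaleR_conv_of_real flip: scaleC_of_real[where 'a = 'a])
  show "a *\<^sub>C r *\<^sub>R x = r *\<^sub>R a *\<^sub>C x"
    by (simp add: scaleC_scaleC mult.commute flip: scaleC_of_real[where 'a = 'a])
  show "\<exists>K. \<forall>a (x :: 'a). norm (a *\<^sub>C x) \<le> norm a * norm x * K"
    by (rule exI[of _ 1]) (simp add: norm_scaleC)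
qed

interpretation scaleC: bounded_bilinear "scaleC :: complex \<Rightarrow> 'a :: complex_normed_vector \<Rightarrow> 'a"
  by (rule bounded_bilinear_scaleC)

interpretation cinner: bounded_bilinear "cinner :: 'a :: hilbert_space \<Rightarrow> 'a \<Rightarrow> complex"
  by (rule bounded_bilinear_cinner)

lemma scaleC_minus_one: "(- 1) *\<^sub>C x = - (x :: 'a :: complex_normed_vector)"
  using scaleC_of_real[of "- 1" x] by simp

lemma clinear_on_0: "clinear_on S f \<Longrightarrow> 0 \<in> S \<Longrightarrow> f 0 = 0"
  unfolding clinear_on_def by (metis scaleC_zero_left)

lemma clinear_on_diff:
  "clinear_on S f \<Longrightarrow> csubspace S \<Longrightarrow> x \<in> S \<Longrightarrow> y \<in> S \<Longrightarrow> f (x - y) = f x - f y"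
  unfolding clinear_on_def csubspace_def
  by (metis add_uminus_conv_diff scaleC_minus_one)

lemma csubspace_sum:
  "csubspace S \<Longrightarrow> (\<And>i. i \<in> I \<Longrightarrow> f i \<in> S) \<Longrightarrow> (\<Sum>i\<in>I. f i) \<in> S"
  by (induction I rule: infinite_finite_induct) (auto simp: csubspace_def)

lemma clinear_on_sum:
  assumes "clinear_on S g" "csubspace S" "\<And>i. i \<in> I \<Longrightarrow> f i \<in> S"
  shows "g (\<Sum>i\<in>I. f i) = (\<Sum>i\<in>I. g (f i))"
  using assms(3)
proof (induction I rule: infinite_finite_induct)
  case (insert i I)
  then have "(\<Sum>i\<in>I. f i) \<in> S" using csubspace_sum[OF assms(2)] by blast
  with insert assms(1) show ?case by (simp add: clinear_on_def)
qed (use assms(1,2) in \<open>auto intro: clinear_on_0 simp: csubspace_def\<close>)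

lemma csubspace_diff: "csubspace S \<Longrightarrow> x \<in> S \<Longrightarrow> y \<in> S \<Longrightarrow> x - y \<in> S"
  unfolding csubspace_def by (metis add_uminus_conv_diff scaleC_minus_one)

lemma csubspace_scaleR: "csubspace S \<Longrightarrow> x \<in> S \<Longrightarrow> r *\<^sub>R x \<in> S"
  unfolding csubspace_def by (metis scaleC_of_real)

lemma csubspace_closure:
  assumes S: "csubspace S"
  shows "csubspace (closure S)"
  unfolding csubspace_def
proof (intro conjI allI ballI)
  show "0 \<in> closure S" using S closure_subset by (auto simp: csubspace_def)
next
  fix x y assume "x \<in> closure S" "y \<in> closure S"
  then obtain f g where "\<And>n. f n \<in> S" "f \<longlonglongrightarrow> x" "\<And>n. g n \<in> S" "g \<longlonglongrightarrow> y"
    unfolding closure_sequential by blast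
  with S show "x + y \<in> closure S"
    unfolding closure_sequential csubspace_def
    by (intro exI[of _ "\<lambda>n. f n + g n"]) (auto intro: tendsto_add)
next
  fix a x assume "x \<in> closure S"
  then obtain f where "\<And>n. f n \<in> S" "f \<longlonglongrightarrow> x"
    unfolding closure_sequential by blast
  with S show "a *\<^sub>C x \<in> closure S"
    unfolding closure_sequential csubspace_def
    by (intro exI[of _ "\<lambda>n. a *\<^sub>C f n"]) (auto intro: scaleC.tendsto)
qed

lemma cspan_superset: "S \<subseteq> cspan S"
  by (simp add: cspan_def hull_subset)

lemma cspan_minimal: "S \<subseteq> T \<Longrightarrow> csubspace T \<Longrightarrow> cspan S \<subseteq> T"
  unfolding cspan_def by (rule hull_minimal)

lemma cspan_induct [consumes 1, case_names base zero add scaleC]: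
  assumes "x \<in> cspan S" "\<And>x. x \<in> S \<Longrightarrow> P x" "P 0" "\<And>x y. P x \<Longrightarrow> P y \<Longrightarrow> P (x + y)"
    "\<And>a x. P x \<Longrightarrow> P (a *\<^sub>C x)"
  shows "P x"
  using cspan_minimal[of S "{x. P x}"] assms by (auto simp: csubspace_def)

lemma hilbert_eqI:
  assumes "\<And>z. cinner z x = cinner z (y :: 'a :: hilbert_space)"
  shows "x = y"
proof -
  have "cinner (x - y) (x - y) = 0" by (simp add: cinner_diff_right assms)
  then show ?thesis by (simp add: cinner_self)
qed


section \<open>Adjoints\<close>

text \<open>The representing vector minimises \<open>\<parallel>x\<parallel>\<^sup>2 - 2 f x\<close>; a minimising sequence is Cauchy by the
  parallelogram law.\<close>

lemma riesz_real:
  fixes f :: "'a :: {real_inner, complete_space} \<Rightarrow> real"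
  assumes "bounded_linear f"
  shows "\<exists>y. \<forall>x. f x = inner y x"
proof -
  interpret f: bounded_linear f by fact
  define Q where "Q x = (norm x)\<^sup>2 - 2 * f x" for x
  obtain K where K: "\<And>x. norm (f x) \<le> norm x * K" using f.bounded by blast
  \<comment> \<open>Completing the square in the lower bound
    \<open>(norm x)\<^sup>2 - 2 * K * norm x\<close> for \<open>Q x\<close>.\<close>
  have lower: "- K\<^sup>2 \<le> Q x" for x
  proof -
    have "0 \<le> (norm x - K)\<^sup>2" by simp
    with K[of x] show ?thesis by (simp add: Q_def power2_diff)
  qed
  then have bdd: "bdd_below (range Q)" by (intro bdd_belowI2)
  define m where "m = Inf (range Q)"
  have m: "m \<le> Q x" for x unfolding m_def using bdd by (intro cInf_lower) auto
  have "\<exists>x. Q x < m + inverse (Suc n)" for n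
  proof -
    have "Inf (range Q) < m + inverse (Suc n)" by (simp add: m_def)
    then show ?thesis using cInf_lessD[of "range Q"] by blast
  qed
  then obtain x where x: "\<And>n. Q (x n) < m + inverse (Suc n)" by metis
  have par: "(norm (u - v))\<^sup>2 \<le> 2 * (Q u - m) + 2 * (Q v - m)" for u v
  proof -
    have "2 * Q u + 2 * Q v - 4 * Q ((1 / 2) *\<^sub>R (u + v)) = (norm (u - v))\<^sup>2"
      by (simp add: Q_def f.scaleR f.add power_mult_distrib power2_norm_eq_inner inner_simps
          inner_commute[of v u] field_simps)
    moreover have "m \<le> Q ((1 / 2) *\<^sub>R (u + v))" by (rule m)
    ultimately show ?thesis by (simp add: algebra_simps)
  qed
  have "Cauchy x"
  proof (rule CauchyI)
    fix e :: real assume "0 < e"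
    then obtain M where M: "inverse (real (Suc M)) < e\<^sup>2 / 4"
      using reals_Archimedean[of "e\<^sup>2 / 4"] by auto
    have "norm (x i - x k) < e" if "i \<ge> M" "k \<ge> M" for i k
    proof -
      have *: "inverse (real (Suc l)) < e\<^sup>2 / 4" if "l \<ge> M" for l
        using that M by (intro le_less_trans[OF _ M]) (auto intro!: le_imp_inverse_le)
      have "Q (x i) - m < e\<^sup>2 / 4" "Q (x k) - m < e\<^sup>2 / 4"
        using x[of i] x[of k] *[OF that(1)] *[OF that(2)] by linarith+
      then have "(norm (x i - x k))\<^sup>2 < e\<^sup>2"
        using par[of "x i" "x k"] by argo
      then show ?thesis using \<open>0 < e\<close> by (simp add: power2_less_imp_less)
    qed
    then show "\<exists>M. \<forall>i\<ge>M. \<forall>k\<ge>M. norm (x i - x k) < e" by blast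
  qed
  then obtain y where y: "x \<longlonglongrightarrow> y" using Cauchy_convergent_iff convergentD by blast
  have "(\<lambda>n. Q (x n)) \<longlonglongrightarrow> Q y"
    unfolding Q_def by (intro tendsto_intros y f.tendsto)
  moreover have "(\<lambda>n. m + inverse (real (Suc n))) \<longlonglongrightarrow> m + 0"
    by (intro tendsto_intros LIMSEQ_inverse_real_of_nat)
  ultimately have "Q y \<le> m + 0"
    by (rule LIMSEQ_le) (use x less_imp_le in blast)
  then have Qy: "Q y = m" using m[of y] by simp
  have "f z = inner y z" for z
  proof (rule ccontr)
    define d where "d = inner y z - f z"
    assume "f z \<noteq> inner y z"
    then have d: "d \<noteq> 0" by (simp add: d_def)
    have *: "0 \<le> 2 * t * d + t\<^sup>2 * (norm z)\<^sup>2" for t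
    proof -
      have "Q (y + t *\<^sub>R z) = Q y + (2 * t * d + t\<^sup>2 * (norm z)\<^sup>2)"
        unfolding Q_def d_def f.scaleR f.add power2_norm_eq_inner
        by (simp add: inner_simps inner_commute[of z y] algebra_simps power2_eq_square)
      with m[of "y + t *\<^sub>R z"] Qy show ?thesis by linarith
    qed
    \<comment> \<open>This \<open>t\<close> nearly minimises the quadratic in \<open>*\<close>; the
      summand 1 avoids division by zero for \<open>z = 0\<close> and still makes the value strictly
      negative.\<close>
    have "0 < (norm z)\<^sup>2 + 1" by (simp add: add_nonneg_pos)
    moreover define t where "t = - d / ((norm z)\<^sup>2 + 1)"
    ultimately have t: "t * ((norm z)\<^sup>2 + 1) = - d" by simp
    have "0 \<le> t * (2 * d + t * (norm z)\<^sup>2)"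
      using *[of t] by (simp add: algebra_simps power2_eq_square)
    also have "2 * d + t * (norm z)\<^sup>2 = d - t" using t by (simp add: algebra_simps)
    finally have "0 \<le> (t * ((norm z)\<^sup>2 + 1)) * ((d - t) * ((norm z)\<^sup>2 + 1))"
      using \<open>0 < (norm z)\<^sup>2 + 1\<close> by (metis mult.assoc mult.commute mult_nonneg_nonneg less_imp_le)
    also have "(d - t) * ((norm z)\<^sup>2 + 1) = d * ((norm z)\<^sup>2 + 2)"
      using t by (simp add: algebra_simps)
    also have "t * ((norm z)\<^sup>2 + 1) * (d * ((norm z)\<^sup>2 + 2)) = - (d\<^sup>2 * ((norm z)\<^sup>2 + 2))"
      using t by (simp add: power2_eq_square)
    finally have "d\<^sup>2 * ((norm z)\<^sup>2 + 2) \<le> 0" by simp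
    moreover have "0 < d\<^sup>2 * ((norm z)\<^sup>2 + 2)"
      using d by (intro mult_pos_pos) (auto simp: add_nonneg_pos)
    ultimately show False by simp
  qed
  then show ?thesis by blast
qed

text \<open>The real part of \<open>f\<close> has a real representing vector; evaluating at
  \<open>\<i> *\<^sub>C x\<close> shows that the same vector also gives the imaginary part.\<close>

lemma riesz:
  fixes f :: "'a :: hilbert_space \<Rightarrow> complex"
  assumes f: "bounded_linear f" and lin: "clinear_on UNIV f"
  shows "\<exists>y. \<forall>x. f x = cinner y x"
proof -
  have "bounded_linear (\<lambda>x. Re (f x))"
    using bounded_linear_compose[OF bounded_linear_Re f] .
  then obtain y where y: "\<And>x. Re (f x) = inner y x" using riesz_real by blast
  have "f x = cinner y x" for x
  proof (rule complex_eqI)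
    show "Re (f x) = Re (cinner y x)" by (simp add: y Re_cinner)
    have "Re (f (\<i> *\<^sub>C x)) = Re (cinner y (\<i> *\<^sub>C x))" by (simp add: y Re_cinner)
    then show "Im (f x) = Im (cinner y x)"
      using lin by (simp add: clinear_on_def cinner_scaleC_right scaleC_complex_def)
  qed
  then show ?thesis by blast
qed

text \<open>The inner product separates vectors, so exhibiting any formal adjoint, without a
  boundedness check, determines the choice made in \<open>cadj\<close>.\<close>

lemma cadj_eqI:
  assumes "\<And>x y. cinner (T x) y = cinner x (S y)"
  shows "cadj T = S"
proof -
  have "\<forall>x y. cinner (T x) y = cinner x (cadj T y)"
    unfolding cadj_def by (rule someI[of _ S]) (simp add: assms)
  then have "cinner x (cadj T y) = cinner x (S y)" for x y by (simp add: assms)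
  then show ?thesis by (rule ext[OF hilbert_eqI])
qed

text \<open>The Riesz theorem for \<open>\<lambda>x. cinner y (T x)\<close>, one \<open>y\<close> at
  a time, supplies the witness that the choice in \<open>cadj\<close> requires.\<close>

lemma cinner_cadj:
  fixes T :: "'a :: hilbert_space \<Rightarrow> 'b :: hilbert_space"
  assumes "bounded_linear T" "clinear_on UNIV T"
  shows "cinner (T x) y = cinner x (cadj T y)"
proof -
  have "\<exists>z. \<forall>x. cinner y (T x) = cinner z x" for y
  proof (rule riesz)
    show "bounded_linear (\<lambda>x. cinner y (T x))"
      by (rule bounded_linear_compose[OF cinner.bounded_linear_right assms(1)])
    show "clinear_on UNIV (\<lambda>x. cinner y (T x))"
      using assms(2) by (simp add: clinear_on_def cinner_add_right cinner_scaleC_right scaleC_complex_def)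
  qed
  then obtain S where "\<And>x y. cinner y (T x) = cinner (S y) x" by metis
  then have S: "cinner (T x) y = cinner x (S y)" for x y
    by (metis cinner_commute)
  with cadj_eqI[of T S] show ?thesis by simp
qed

lemma bop_add: "T \<in> bop \<Longrightarrow> blinfun_apply T (x + y) = T x + T y"
  and bop_scaleC: "T \<in> bop \<Longrightarrow> blinfun_apply T (a *\<^sub>C x) = a *\<^sub>C T x"
  by (auto simp: bop_def clinear_on_def)

lemma bopI: "(\<And>a x. blinfun_apply T (a *\<^sub>C x) = a *\<^sub>C T x) \<Longrightarrow> T \<in> bop"
  by (simp add: bop_def clinear_on_def blinfun.add_right)

lemma clinear_on_bop: "T \<in> bop \<Longrightarrow> clinear_on S (blinfun_apply T)"
  by (simp add: clinear_on_def bop_add bop_scaleC)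

lemma csubspace_bop: "csubspace bop"
  by (auto simp: csubspace_def scaleC_blinfun.rep_eq blinfun.add_left bop_scaleC scaleC_add_right
      scaleC_scaleC scaleC.zero_right mult.commute intro!: bopI)

lemma id_blinfun_bop: "id_blinfun \<in> bop"
  by (rule bopI) simp

lemma compose_bop: "S \<in> bop \<Longrightarrow> T \<in> bop \<Longrightarrow> S o\<^sub>L T \<in> bop"
  by (rule bopI) (simp add: bop_scaleC)

text \<open>Complex linearity is an intersection of closed conditions, one for each scalar and
  vector. This keeps norm limits of represented elements inside \<open>bop\<close>.\<close>

lemma closed_bop: "closed (bop :: ('a :: complex_normed_vector \<Rightarrow>\<^sub>L 'b :: complex_normed_vector) set)"
proof -
  have *: "closed {T :: 'a \<Rightarrow>\<^sub>L 'b. T (a *\<^sub>C x) = a *\<^sub>C T x}" for a x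
    by (intro closed_Collect_eq continuous_intros blinfun.continuous_on scaleC.continuous_on)
  have "bop = (\<Inter>a. \<Inter>x. {T :: 'a \<Rightarrow>\<^sub>L 'b. T (a *\<^sub>C x) = a *\<^sub>C T x})"
    by (auto simp: bop_scaleC intro: bopI)
  with * show ?thesis by (metis (no_types, lifting) closed_INT)
qed

lemma adj_eqI:
  assumes "\<And>x y. cinner (blinfun_apply T x) y = cinner x (blinfun_apply S y)"
  shows "adj T = S"
  unfolding adj_def using cadj_eqI[of "blinfun_apply T" "blinfun_apply S"] assms
  by (simp add: blinfun_apply_inverse)

text \<open>Writing T* for the adjoint, the bound comes from testing at T* x itself: ||T* x||^2 = <T
  T* x, x> \<le> K ||T* x|| ||x||.\<close>

lemma bounded_linear_cadj:
  assumes "bounded_linear T" "clinear_on UNIV T"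
  shows "bounded_linear (cadj T)"
proof -
  note c = cinner_cadj[OF assms, symmetric]
  obtain K where K: "0 \<le> K" "\<And>x. norm (T x) \<le> norm x * K"
    using bounded_linear.nonneg_bounded[OF assms(1)] by blast
  show ?thesis
  proof (rule bounded_linear_intro[where K = K])
    fix x y r
    show "cadj T (x + y) = cadj T x + cadj T y"
      by (rule hilbert_eqI) (simp add: c cinner_add_right)
    show "cadj T (r *\<^sub>R x) = r *\<^sub>R cadj T x"
      by (rule hilbert_eqI) (simp add: c cinner.scaleR_right)
    show "norm (cadj T x) \<le> norm x * K"
    proof (cases "cadj T x = 0")
      case False
      have "(norm (cadj T x))\<^sup>2 = cmod (cinner (cadj T x) (cadj T x))"
        by (simp add: cinner_self norm_power)
      also have "\<dots> \<le> norm (T (cadj T x)) * norm x"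
        unfolding c by (rule cinner_cauchy_schwarz)
      also have "\<dots> \<le> norm (cadj T x) * K * norm x"
        by (intro mult_right_mono K) simp
      finally show ?thesis using False by (simp add: power2_eq_square mult.commute mult.left_commute)
    qed (simp add: K)
  qed
qed

lemma cinner_adj:
  assumes "T \<in> bop"
  shows "cinner (blinfun_apply T x) y = cinner x (adj T y)"
proof -
  have "bounded_linear (blinfun_apply T)" "clinear_on UNIV (blinfun_apply T)"
    using assms by (auto simp: bop_def blinfun.bounded_linear_right)
  with bounded_linear_cadj cinner_cadj show ?thesis
    by (metis adj_def bounded_linear_Blinfun_apply)
qed

lemma cinner_adj': "T \<in> bop \<Longrightarrow> cinner (adj T x) y = cinner x (blinfun_apply T y)"
  by (metis cinner_adj cinner_commute)

lemma adj_bop: "T \<in> bop \<Longrightarrow> adj T \<in> bop"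
  by (rule bopI, rule hilbert_eqI) (simp add: cinner_adj[symmetric] cinner_scaleC_right)

lemma adj_adj: "T \<in> bop \<Longrightarrow> adj (adj T) = T"
  by (rule adj_eqI) (rule cinner_adj')

lemma adj_compose: "S \<in> bop \<Longrightarrow> T \<in> bop \<Longrightarrow> adj (S o\<^sub>L T) = adj T o\<^sub>L adj S"
  by (rule adj_eqI) (simp add: cinner_adj)

lemma adj_add: "S \<in> bop \<Longrightarrow> T \<in> bop \<Longrightarrow> adj (S + T) = adj S + adj T"
  by (rule adj_eqI) (simp add: blinfun.add_left cinner_add_left cinner_add_right cinner_adj)

lemma adj_scaleC: "T \<in> bop \<Longrightarrow> adj (a *\<^sub>C T) = cnj a *\<^sub>C adj T"
  by (rule adj_eqI)
    (simp add: scaleC_blinfun.rep_eq cinner_scaleC_left cinner_scaleC_right cinner_adj)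

lemma adj_id [simp]: "adj id_blinfun = id_blinfun"
  by (rule adj_eqI) simp

lemma adj_zero [simp]: "adj 0 = 0"
  by (rule adj_eqI) simp

text \<open>The C*-identity rests on ||S x||^2 = <x, S* S x>. It is what makes the norm of a
  represented polynomial a C*-seminorm, a competitor in the universal norm.\<close>

lemma norm_adj_compose:
  assumes "T \<in> bop"
  shows "norm (adj T o\<^sub>L T) = (norm T)\<^sup>2" and norm_adj: "norm (adj T) = norm T"
proof -
  have le: "(norm S)\<^sup>2 \<le> norm (adj S o\<^sub>L S)" if "S \<in> bop" for S :: "'x :: hilbert_space \<Rightarrow>\<^sub>L 'y :: hilbert_space"
  proof -
    have "norm (S x) \<le> sqrt (norm (adj S o\<^sub>L S)) * norm x" for x
    proof (rule power2_le_imp_le)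
      have "(norm (S x))\<^sup>2 = cmod (cinner x ((adj S o\<^sub>L S) x))"
        using arg_cong[OF cinner_adj[OF that, of x "S x"], of cmod] by (simp add: cinner_self norm_power)
      also have "\<dots> \<le> norm x * norm ((adj S o\<^sub>L S) x)" by (rule cinner_cauchy_schwarz)
      also have "\<dots> \<le> norm x * (norm (adj S o\<^sub>L S) * norm x)"
        by (intro mult_left_mono norm_blinfun) simp
      finally show "(norm (S x))\<^sup>2 \<le> (sqrt (norm (adj S o\<^sub>L S)) * norm x)\<^sup>2"
        by (simp add: power_mult_distrib power2_eq_square mult_ac)
    qed simp
    then have "norm S \<le> sqrt (norm (adj S o\<^sub>L S))" by (intro norm_blinfun_bound) auto
    then show ?thesis by (metis norm_ge_zero power_mono real_sqrt_pow2)
  qed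
  have le': "norm S \<le> norm (adj S)" if "S \<in> bop" for S :: "'x :: hilbert_space \<Rightarrow>\<^sub>L 'y :: hilbert_space"
  proof (cases "norm S = 0")
    case False
    have "(norm S)\<^sup>2 \<le> norm (adj S) * norm S"
      using le[OF that] norm_blinfun_compose[of "adj S" S] by linarith
    with False show ?thesis by (simp add: power2_eq_square)
  qed simp
  show n: "norm (adj T) = norm T"
    using le'[OF assms] le'[OF adj_bop[OF assms]] by (simp add: adj_adj assms)
  show "norm (adj T o\<^sub>L T) = (norm T)\<^sup>2"
    using le[OF assms] norm_blinfun_compose[of "adj T" T] by (simp add: n power2_eq_square)
qed

section \<open>Non-commutative polynomials in the generators\<close>

lemma ncpoly_sum:
  fixes p :: "'a \<Rightarrow>\<^sub>0 'b :: comm_monoid_add"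
  shows "p = (\<Sum>w\<in>Poly_Mapping.keys p. Poly_Mapping.single w (Poly_Mapping.lookup p w))"
proof (rule poly_mapping_eqI)
  fix w
  have "(\<Sum>v\<in>Poly_Mapping.keys p. Poly_Mapping.lookup p v when v = w) = Poly_Mapping.lookup p w"
    by (simp add: when_def sum.delta in_keys_iff)
  then show "Poly_Mapping.lookup p w = Poly_Mapping.lookup
      (\<Sum>w\<in>Poly_Mapping.keys p. Poly_Mapping.single w (Poly_Mapping.lookup p w)) w"
    by (simp add: lookup_sum lookup_single)
qed

lemma ncpoly_induct [case_names zero single add]:
  fixes p :: "'a \<Rightarrow>\<^sub>0 'b :: comm_monoid_add"
  assumes "P 0" "\<And>w a. P (Poly_Mapping.single w a)" "\<And>p q. P p \<Longrightarrow> P q \<Longrightarrow> P (p + q)"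
  shows "P p"
proof -
  have "P (\<Sum>w\<in>W. Poly_Mapping.single w (Poly_Mapping.lookup p w))" for W
    by (induction W rule: infinite_finite_induct) (auto intro: assms)
  then show ?thesis by (subst ncpoly_sum)
qed

lemma compose_id_blinfun [simp]: "id_blinfun o\<^sub>L T = T" "T o\<^sub>L id_blinfun = T"
  by (auto intro: blinfun_eqI)

lemma poly_op_zero [simp]: "poly_op Z 0 = 0"
  by (simp add: poly_op_def)

lemma poly_op_single [simp]: "poly_op Z (Poly_Mapping.single w a) = a *\<^sub>C word_op Z w"
  by (simp add: poly_op_def)

lemma poly_op_add: "poly_op Z (p + q) = poly_op Z p + poly_op Z q"
  unfolding poly_op_def by (rule setsum_keys_plus_distrib) (auto simp: scaleC_add_left)

lemma word_op_zero [simp]: "word_op Z 0 = id_blinfun"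
  by (simp add: word_op_def zero_sword_def)

lemma word_op_plus: "word_op Z (v + w) = word_op Z v o\<^sub>L word_op Z w"
proof -
  have "foldr (\<lambda>a T. letter_op Z a o\<^sub>L T) as T =
      foldr (\<lambda>a T. letter_op Z a o\<^sub>L T) as id_blinfun o\<^sub>L T" for as T
    by (induction as) (auto intro: blinfun_eqI)
  then show ?thesis by (simp add: word_op_def plus_sword_def)
qed

lemma word_op_Cons: "word_op Z (Sword (a # as)) = letter_op Z a o\<^sub>L word_op Z (Sword as)"
  by (simp add: word_op_def)

lemma word_op_Nil [simp]: "word_op Z (Sword []) = id_blinfun"
  by (simp add: word_op_def)

lemma word_op_single: "word_op Z (Sword [a]) = letter_op Z a"
  by (simp add: word_op_def)

lemma scaleC_in_bop: "T \<in> bop \<Longrightarrow> a *\<^sub>C T \<in> bop"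
  using csubspace_bop by (auto simp: csubspace_def)

lemma compose_scaleC_left: "(a *\<^sub>C S) o\<^sub>L T = a *\<^sub>C (S o\<^sub>L T)"
  by (rule blinfun_eqI) (simp add: scaleC_blinfun.rep_eq)

lemma compose_scaleC_right: "S \<in> bop \<Longrightarrow> S o\<^sub>L (a *\<^sub>C T) = a *\<^sub>C (S o\<^sub>L T)"
  by (rule blinfun_eqI) (simp add: scaleC_blinfun.rep_eq bop_scaleC)

lemma compose_add_left: "(S + S') o\<^sub>L T = (S o\<^sub>L T) + (S' o\<^sub>L T)"
  by (rule blinfun_eqI) (simp add: blinfun.add_left)

lemma compose_add_right: "S o\<^sub>L (T + T') = (S o\<^sub>L T) + (S o\<^sub>L T')"
  by (rule blinfun_eqI) (simp add: blinfun.add_left blinfun.add_right)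

lemma letter_op_bop: "(\<And>i. Z i \<in> bop) \<Longrightarrow> letter_op Z a \<in> bop"
  by (cases a) (auto intro: adj_bop)

lemma word_op_bop: "(\<And>i. Z i \<in> bop) \<Longrightarrow> word_op Z w \<in> bop"
proof (induction w)
  case (Sword as)
  then show ?case
    by (induction as) (auto simp: word_op_Cons compose_bop letter_op_bop id_blinfun_bop word_op_def)
qed

lemma poly_op_bop: "(\<And>i. Z i \<in> bop) \<Longrightarrow> poly_op Z p \<in> bop"
  unfolding poly_op_def
  by (intro csubspace_sum csubspace_bop bopI)
    (simp add: scaleC_blinfun.rep_eq bop_scaleC[OF word_op_bop] scaleC_scaleC mult.commute)

lemma poly_op_mult:
  assumes "\<And>i. Z i \<in> bop"
  shows "poly_op Z (p * q) = poly_op Z p o\<^sub>L poly_op Z q"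
proof (induction p rule: ncpoly_induct)
  case (single v a)
  show ?case
  proof (induction q rule: ncpoly_induct)
    case (single w b)
    show ?case
      by (simp add: mult_single word_op_plus compose_scaleC_left compose_scaleC_right word_op_bop
          assms scaleC_scaleC)
  qed (auto simp: distrib_left poly_op_add compose_add_right intro: blinfun_eqI)
qed (auto simp: distrib_right poly_op_add compose_add_left intro: blinfun_eqI)

lemma letter_op_adj_letter: "(\<And>i. Z i \<in> bop) \<Longrightarrow> letter_op Z (adj_letter a) = adj (letter_op Z a)"
  by (cases a) (auto simp: adj_adj)

lemma word_op_star_word:
  assumes "\<And>i. Z i \<in> bop"
  shows "word_op Z (star_word w) = adj (word_op Z w)"
proof (induction w)
  case (Sword as)
  then show ?case
  proof (induction as)
    case Nil
    then show ?case by (simp add: star_word_def word_op_def)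
  next
    case (Cons a as)
    have "star_word (Sword (a # as)) = star_word (Sword as) + Sword [adj_letter a]"
      by (simp add: star_word_def plus_sword_def)
    then show ?case
      using Cons assms
      by (simp add: word_op_plus word_op_Cons adj_compose letter_op_bop word_op_bop
          letter_op_adj_letter)
  qed
qed

lemma pstar_add: "pstar (p + q) = pstar p + pstar q"
  unfolding pstar_def by (rule setsum_keys_plus_distrib) (auto simp: single_add)

lemma poly_op_pstar:
  assumes "\<And>i. Z i \<in> bop"
  shows "poly_op Z (pstar p) = adj (poly_op Z p)"
proof (induction p rule: ncpoly_induct)
  case zero
  show ?case by (simp add: pstar_def)
next
  case (single w a)
  have "pstar (Poly_Mapping.single w a) = Poly_Mapping.single (star_word w) (cnj a)"
    by (simp add: pstar_def)
  then show ?case using assms by (simp add: adj_scaleC word_op_bop word_op_star_word)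
next
  case (add p q)
  then show ?case using assms by (simp add: pstar_add poly_op_add adj_add poly_op_bop)
qed

lemma poly_op_pconst_mult:
  "(\<And>i. Z i \<in> bop) \<Longrightarrow> poly_op Z (pconst a * p) = a *\<^sub>C poly_op Z p"
  by (simp add: poly_op_mult pconst_def compose_scaleC_left)

lemma poly_op_sum: "poly_op Z (\<Sum>i\<in>I. p i) = (\<Sum>i\<in>I. poly_op Z (p i))"
  by (induction I rule: infinite_finite_induct) (auto simp: poly_op_add)

lemma poly_op_uminus: "poly_op Z (- p) = - poly_op Z p"
  using poly_op_add[of Z p "- p"] by (simp add: add_eq_0_iff)

lemma poly_op_diff: "poly_op Z (p - q) = poly_op Z p - poly_op Z q"
  using poly_op_add[of Z p "- q"] by (simp add: poly_op_uminus)

lemma unital_star_subalgebra_A0: "unital_star_subalgebra (A0 Z)"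
  unfolding A0_def by (rule hull_in) (fastforce simp: unital_star_subalgebra_def csubspace_def)

lemma csubspace_A0: "csubspace (A0 Z)"
  using unital_star_subalgebra_A0[of Z] by (simp add: unital_star_subalgebra_def)

lemma generator_in_A0: "Z i \<in> A0 Z"
  unfolding A0_def by (rule hull_inc) simp

lemma word_op_in_A0: "word_op Z w \<in> A0 Z"
proof (induction w)
  case (Sword as)
  have "letter_op Z a \<in> A0 Z" for a
    using unital_star_subalgebra_A0[of Z] generator_in_A0[of Z]
    by (cases a) (auto simp: unital_star_subalgebra_def)
  then show ?case
    using unital_star_subalgebra_A0[of Z]
    by (induction as) (auto simp: word_op_def unital_star_subalgebra_def)
qed

text \<open>Elements of \<open>A0 Z\<close> thereby have polynomial representatives, and a map on
  \<open>A0 Z\<close> can be given on polynomials once it is shown to respect the kernel of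
  \<open>poly_op Z\<close>.\<close>

lemma A0_eq_range_poly_op:
  assumes "\<And>i. Z i \<in> bop"
  shows "A0 Z = range (poly_op Z)"
proof
  show "A0 Z \<subseteq> range (poly_op Z)"
    unfolding A0_def
  proof (rule hull_minimal)
    show "range Z \<subseteq> range (poly_op Z)"
      by (auto intro!: image_eqI[where x = "Poly_Mapping.single (Sword [Gen _]) 1"]
          simp: word_op_single)
    have "poly_op Z p + poly_op Z q \<in> range (poly_op Z)"
      "poly_op Z p o\<^sub>L poly_op Z q \<in> range (poly_op Z)"
      "a *\<^sub>C poly_op Z p \<in> range (poly_op Z)" "adj (poly_op Z p) \<in> range (poly_op Z)"
      "id_blinfun \<in> range (poly_op Z)" "0 \<in> range (poly_op Z)" for p q a
      by (metis poly_op_add rangeI, metis poly_op_mult assms rangeI,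
          metis poly_op_pconst_mult assms rangeI, metis poly_op_pstar assms rangeI,
          metis poly_op_single word_op_zero scaleC_one rangeI, metis poly_op_zero rangeI)
    then show "unital_star_subalgebra (range (poly_op Z))"
      by (auto simp: unital_star_subalgebra_def csubspace_def)
  qed
  show "range (poly_op Z) \<subseteq> A0 Z"
    using csubspace_A0[of Z] word_op_in_A0[of Z]
    by (auto simp: poly_op_def csubspace_def intro!: csubspace_sum csubspace_A0)
qed

text \<open>Linear identities need checking only on words, where the charge derivations act by
  scalars. Zero has no case of its own, being 0 times the empty word.\<close>

lemma A0_induct [consumes 2, case_names word add scaleC]:
  assumes "\<And>i. Z i \<in> bop" "x \<in> A0 Z" "\<And>w. P (word_op Z w)"
    "\<And>x y. x \<in> A0 Z \<Longrightarrow> y \<in> A0 Z \<Longrightarrow> P x \<Longrightarrow> P y \<Longrightarrow> P (x + y)"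
    "\<And>a x. x \<in> A0 Z \<Longrightarrow> P x \<Longrightarrow> P (a *\<^sub>C x)"
  shows "P x"
proof -
  have "P (poly_op Z p)" for p
  proof (induction p rule: ncpoly_induct)
    case zero
    show ?case using assms(5)[of "word_op Z 0" 0] assms(3)[of 0] word_op_in_A0[of Z 0] by simp
  next
    case (single w a)
    show ?case by (simp add: assms(3,5) word_op_in_A0)
  next
    case (add p q)
    have "poly_op Z p \<in> A0 Z" for p using A0_eq_range_poly_op[of Z, OF assms(1)] by blast
    with add show ?case by (simp add: assms(4) poly_op_add)
  qed
  then show ?thesis using assms(2) A0_eq_range_poly_op[of Z, OF assms(1)] by auto
qed

lemma A0_subset_bop: "(\<And>i. Z i \<in> bop) \<Longrightarrow> A0 Z \<subseteq> bop"
  by (simp add: A0_eq_range_poly_op image_subset_iff poly_op_bop)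


section \<open>Representations of the sphere algebras\<close>

lemma cstar_seminorm_poly_op:
  assumes "\<And>i. V i \<in> bop"
  shows "cstar_seminorm (\<lambda>x. norm (poly_op V x))"
proof -
  have "norm (poly_op V (pconst c * x)) = cmod c * norm (poly_op V x)" for c x
    by (simp add: poly_op_pconst_mult[of V] assms norm_scaleC)
  then show ?thesis
    using assms
    by (auto simp: cstar_seminorm_def poly_op_add poly_op_mult poly_op_pstar
        norm_adj_compose poly_op_bop intro: norm_triangle_ineq norm_blinfun_compose)
qed

lemma poly_op_zero_ideal:
  assumes "\<And>i. V i \<in> bop"
  shows "two_sided_ideal {x. poly_op V x = 0}"
  using assms by (auto simp: two_sided_ideal_def poly_op_add poly_op_mult intro: blinfun_eqI)

text \<open>The seminorm \<open>\<lambda>x. norm (poly_op V x)\<close> competes in the supremum of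
  the universal norm and is constant on cosets of the ideal, so it lies below every term of the
  infimum defining \<open>sphere_norm\<close>.\<close>

lemma norm_poly_op_le_sphere:
  assumes Z: "sphere_in_B K Z" and V: "\<And>i. V i \<in> bop"
    and rels: "\<And>r. r \<in> free_sphere_rels \<union> sphere_rels K \<Longrightarrow> poly_op V r = 0"
  shows "norm (poly_op V x) \<le> norm (poly_op Z x)"
proof -
  have "two_sided_ideal hull (sphere_rels K) \<subseteq> {x. poly_op V x = 0}"
    by (rule hull_minimal) (use rels poly_op_zero_ideal[of V] V in auto)
  then have ideal: "poly_op V (x + y) = poly_op V x" if "y \<in> two_sided_ideal hull (sphere_rels K)" for y
    using that by (auto simp: poly_op_add)
  have "ennreal (norm (poly_op V y)) \<le> universal_norm free_sphere_rels y" for y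
    unfolding universal_norm_def
    by (rule SUP_upper2[of "\<lambda>x. norm (poly_op V x)"]) (use V cstar_seminorm_poly_op rels in auto)
  then have "ennreal (norm (poly_op V x)) \<le> sphere_norm K x"
    unfolding sphere_norm_def by (intro INF_greatest) (metis ideal)
  also have "\<dots> = ennreal (norm (poly_op Z x))"
    using Z by (simp add: sphere_in_B_def)
  finally show ?thesis by simp
qed

lemma universal_norm_rel:
  assumes "r \<in> R"
  shows "universal_norm R r = 0"
  unfolding universal_norm_def using assms by (auto intro!: antisym[OF SUP_least] simp: bot_ennreal)

lemma universal_norm_zero: "universal_norm R 0 = 0"
proof -
  have "p 0 = 0" if "cstar_seminorm p" for p :: "'a ncpoly \<Rightarrow> real"
  proof -
    have "p (pconst 0 * 0) = cmod 0 * p 0" using that unfolding cstar_seminorm_def by blast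
    then show ?thesis by simp
  qed
  then have "universal_norm R 0 \<le> 0"
    unfolding universal_norm_def by (intro SUP_least) force
  then show ?thesis by simp
qed

text \<open>In the infimum defining \<open>sphere_norm\<close>, the ideal element 0 handles a free
  sphere relation, whose universal norm vanishes; for an additional relation \<open>r\<close> the
  element \<open>- r\<close> cancels it.\<close>

lemma sphere_relation:
  assumes Z: "sphere_in_B K Z" and r: "r \<in> free_sphere_rels \<union> sphere_rels K"
  shows "poly_op Z r = 0"
proof -
  have I: "0 \<in> two_sided_ideal hull S" "s \<in> S \<Longrightarrow> - s \<in> two_sided_ideal hull S"
    for S :: "'a ncpoly set" and s
  proof -
    show "0 \<in> two_sided_ideal hull S" by (auto simp: hull_def two_sided_ideal_def)
    assume "s \<in> S"
    then have "- s \<in> I" if "two_sided_ideal I" "S \<subseteq> I" for I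
      using that unfolding two_sided_ideal_def by (metis mult_minus1 subsetD)
    then show "- s \<in> two_sided_ideal hull S" by (auto simp: hull_def)
  qed
  have "sphere_norm K r \<le> 0"
    using r
  proof
    assume "r \<in> free_sphere_rels"
    then show ?thesis
      unfolding sphere_norm_def by (intro INF_lower2[OF I(1)]) (simp add: universal_norm_rel)
  next
    assume "r \<in> sphere_rels K"
    then show ?thesis
      unfolding sphere_norm_def by (intro INF_lower2[OF I(2)]) (auto simp: universal_norm_zero)
  qed
  then have "ennreal (norm (poly_op Z r)) \<le> 0" using Z by (simp add: sphere_in_B_def)
  then show ?thesis by simp
qed

section \<open>The charge grading and homogeneity of the sphere relations\<close>

definition homogeneous :: "('n \<Rightarrow> int) \<Rightarrow> 'n ncpoly \<Rightarrow> bool" where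
  "homogeneous n p \<longleftrightarrow> (\<forall>w\<in>Poly_Mapping.keys p. (\<lambda>j. charge j w) = n)"

lemma charge_plus: "charge j (v + w) = charge j v + charge j w"
  by (simp add: charge_def plus_sword_def)

lemma homogeneous_zero: "homogeneous n 0"
  by (simp add: homogeneous_def)

lemma homogeneous_add: "homogeneous n p \<Longrightarrow> homogeneous n q \<Longrightarrow> homogeneous n (p + q)"
  unfolding homogeneous_def using keys_add[of p q] by blast

lemma homogeneous_diff: "homogeneous n p \<Longrightarrow> homogeneous n q \<Longrightarrow> homogeneous n (p - q)"
  unfolding homogeneous_def using keys_diff[of p q] by blast

lemma homogeneous_sum: "(\<And>i. i \<in> I \<Longrightarrow> homogeneous n (p i)) \<Longrightarrow> homogeneous n (\<Sum>i\<in>I. p i)"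
  by (induction I rule: infinite_finite_induct) (auto intro: homogeneous_add simp: homogeneous_zero)

lemma homogeneous_mult:
  "homogeneous m p \<Longrightarrow> homogeneous n q \<Longrightarrow> homogeneous (\<lambda>j. m j + n j) (p * q)"
  unfolding homogeneous_def using keys_mult[of p q] by (force simp: charge_plus)

definition letter_charge :: "'n letter \<Rightarrow> 'n \<Rightarrow> int" where
  "letter_charge a j = charge j (Sword [a])"

lemma letter_charge_simps [simp]:
  "letter_charge (Gen i) j = of_bool (i = j)" "letter_charge (Adj i) j = - of_bool (i = j)"
  by (auto simp: letter_charge_def charge_def)

lemma charge_Cons: "charge j (Sword (a # as)) = letter_charge a j + charge j (Sword as)"
  using charge_plus[of j "Sword [a]" "Sword as"] by (simp add: plus_sword_def letter_charge_def)

lemma homogeneous_pletter: "homogeneous (letter_charge a) (pletter a)"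
  by (auto simp: homogeneous_def pletter_def letter_charge_def)

lemma homogeneous_pletter_mult:
  "homogeneous (\<lambda>j. letter_charge a j + letter_charge b j) (pletter a * pletter b)"
  "homogeneous (\<lambda>j. letter_charge a j + letter_charge b j + letter_charge c j)
    (pletter a * pletter b * pletter c)"
  by (intro homogeneous_mult homogeneous_pletter)+

text \<open>Each additional relation compares a monomial with its reversal, up to sign, and charges
  do not see the order of letters. In the free sphere relations a generator meets its own adjoint,
  matching the charge 0 of the constant 1.\<close>

lemma homogeneous_sphere_rels:
  assumes "r \<in> free_sphere_rels \<union> sphere_rels K"
  shows "\<exists>n. homogeneous n r"
  using assms
proof
  have "homogeneous (\<lambda>_. 0) 1" by (auto simp: homogeneous_def charge_def zero_sword_def)
  moreover have "homogeneous (\<lambda>_. 0) (pletter (Gen i) * pletter (Adj i))"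
    "homogeneous (\<lambda>_. 0) (pletter (Adj i) * pletter (Gen i))" for i :: 'a
    using homogeneous_pletter_mult(1)[of "Gen i" "Adj i"] homogeneous_pletter_mult(1)[of "Adj i" "Gen i"]
    by simp_all
  moreover assume "r \<in> free_sphere_rels"
  ultimately show ?thesis
    unfolding free_sphere_rels_def by (auto intro!: exI homogeneous_diff homogeneous_sum)
next
  let ?h2 = "\<lambda>a b j. letter_charge a j + letter_charge b j :: int"
  let ?h3 = "\<lambda>a b c j. letter_charge a j + letter_charge b j + letter_charge c j :: int"
  have 2: "homogeneous (?h2 a b) (pletter a * pletter b + pletter b * pletter a)"
    "homogeneous (?h2 a b) (pletter a * pletter b - pletter b * pletter a)" for a b :: "'a letter"
    using homogeneous_pletter_mult(1)[of a b] homogeneous_pletter_mult(1)[of b a]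
    by (simp_all add: add.commute homogeneous_add homogeneous_diff)
  have 3: "homogeneous (?h3 a b c)
      (pletter a * pletter b * pletter c + pletter c * pletter b * pletter a)"
    "homogeneous (?h3 a b c)
      (pletter a * pletter b * pletter c - pletter c * pletter b * pletter a)" for a b c :: "'a letter"
    using homogeneous_pletter_mult(2)[of a b c] homogeneous_pletter_mult(2)[of c b a]
    by (simp_all add: ac_simps homogeneous_add homogeneous_diff)
  assume "r \<in> sphere_rels K"
  then show ?thesis
    by (cases K) (use 2 3 in \<open>simp_all, (blast)+\<close>)
qed

text \<open>All relations are homogeneous for the charge grading, so they survive a charge-dependent linear
  modification of the words; the universal norm then makes the modified representation
  contractive.\<close>

lemma norm_poly_op_le_twist:
  assumes Z: "sphere_in_B K Z" and V: "\<And>i. V i \<in> bop"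
    and T: "\<And>n. clinear_on (A0 Z) (T n)" and w: "\<And>w. word_op V w = T (\<lambda>j. charge j w) (word_op Z w)"
  shows "norm (poly_op V x) \<le> norm (poly_op Z x)"
proof (rule norm_poly_op_le_sphere[OF Z V])
  fix r :: "'a ncpoly" assume r: "r \<in> free_sphere_rels \<union> sphere_rels K"
  then obtain n where n: "homogeneous n r" using homogeneous_sphere_rels by blast
  \<comment> \<open>Every word of a homogeneous \<open>r\<close> sees the same linear map
    \<open>T n\<close>, which can then be pulled out of the sum.\<close>
  have "poly_op V r = (\<Sum>w\<in>Poly_Mapping.keys r. T n (Poly_Mapping.lookup r w *\<^sub>C word_op Z w))"
    unfolding poly_op_def using n T word_op_in_A0[of Z]
    by (intro sum.cong) (auto simp: w homogeneous_def clinear_on_def)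
  also have "\<dots> = T n (poly_op Z r)"
    unfolding poly_op_def using word_op_in_A0[of Z] csubspace_A0[of Z]
    by (intro clinear_on_sum[OF T csubspace_A0, symmetric]) (auto simp: csubspace_def)
  also have "poly_op Z r = 0" by (rule sphere_relation[OF Z r])
  also have "T n 0 = 0"
    using clinear_on_0[OF T] csubspace_A0[of Z] by (simp add: csubspace_def)
  finally show "poly_op V r = 0" .
qed


section \<open>The charge derivations\<close>

text \<open>The lift of the derivation to the free algebra: words form a basis there, so prescribing
  it on words raises no question of well-definedness.\<close>

definition cpoly :: "'n \<Rightarrow> 'n ncpoly \<Rightarrow> 'n ncpoly" where
  "cpoly j p = (\<Sum>w\<in>Poly_Mapping.keys p.
     Poly_Mapping.single w (of_int (charge j w) * Poly_Mapping.lookup p w))"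

lemma cpoly_add: "cpoly j (p + q) = cpoly j p + cpoly j q"
  unfolding cpoly_def by (rule setsum_keys_plus_distrib) (auto simp: single_add distrib_left)

lemma poly_op_cpoly:
  "poly_op Z (cpoly j p) = (\<Sum>w\<in>Poly_Mapping.keys p.
     Poly_Mapping.lookup p w *\<^sub>C (of_int (charge j w) *\<^sub>C word_op Z w))"
  by (simp add: cpoly_def poly_op_sum scaleC_scaleC mult.commute)

lemma word_op_gauge:
  assumes "\<And>i. Z i \<in> bop"
  shows "word_op (\<lambda>i. (if i = j then cis \<theta> else 1) *\<^sub>C Z i) w = cis (\<theta> * real_of_int (charge j w)) *\<^sub>C word_op Z w"
proof (induction w)
  case (Sword as)
  show ?case
  proof (induction as)
    case Nil
    show ?case by (simp add: word_op_def charge_def)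
  next
    case (Cons a as)
    have "letter_op (\<lambda>i. (if i = j then cis \<theta> else 1) *\<^sub>C Z i) a
        = cis (\<theta> * real_of_int (letter_charge a j)) *\<^sub>C letter_op Z a"
      using assms by (cases a) (auto simp: adj_scaleC cis_cnj)
    then show ?case
      using Cons assms
      by (simp add: charge_Cons word_op_Cons compose_scaleC_left compose_scaleC_right letter_op_bop scaleC_scaleC
          cis_mult distrib_left)
  qed
qed

text \<open>Differentiating the gauge automorphisms at \<open>\<theta> = 0\<close> shows that the derivation is well defined.\<close>

lemma poly_op_cpoly_zero:
  assumes Z: "sphere_in_B K Z" and p: "poly_op Z p = 0"
  shows "poly_op Z (cpoly j p) = 0"
proof -
  have bop: "Z i \<in> bop" for i using Z by (simp add: sphere_in_B_def)
  define V where "V \<theta> i = (if i = j then cis \<theta> else 1) *\<^sub>C Z i" for \<theta> i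
  have V: "V \<theta> i \<in> bop" for \<theta> i by (simp add: V_def scaleC_in_bop bop)
  have word: "word_op (V \<theta>) w = cis (\<theta> * real_of_int (charge j w)) *\<^sub>C word_op Z w" for \<theta> w
    unfolding V_def by (rule word_op_gauge[OF bop])
  \<comment> \<open>Charge n is twisted by the scalar \<open>cis (\<theta> * n j)\<close>;
    contractivity then makes the rotated polynomial vanish for every angle, so the curve to be
    differentiated is identically zero.\<close>
  have "norm (poly_op (V \<theta>) p) \<le> norm (poly_op Z p)" for \<theta>
    by (rule norm_poly_op_le_twist[where T = "\<lambda>n x. cis (\<theta> * real_of_int (n j)) *\<^sub>C x", OF Z V])
      (auto simp: clinear_on_def word scaleC_add_right scaleC_scaleC mult.commute)
  then have zero: "poly_op (V \<theta>) p = 0" for \<theta> using p by simp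
  have "((\<lambda>\<theta>. poly_op (V \<theta>) p) has_vector_derivative
      (\<Sum>w\<in>Poly_Mapping.keys p. Poly_Mapping.lookup p w *\<^sub>C
        ((of_int (charge j w) * \<i>) *\<^sub>C word_op Z w))) (at 0)"
    unfolding poly_op_def word
  proof (rule has_vector_derivative_sum)
    fix w
    have "((\<lambda>\<theta>. cis (\<theta> * real_of_int (charge j w))) has_vector_derivative of_int (charge j w) * \<i>) (at 0)"
      unfolding cis_conv_exp
    proof -
      have "((\<lambda>z. exp (\<i> * (z * of_int (charge j w)))) has_field_derivative
          of_int (charge j w) * \<i>) (at (of_real 0))"
        by (auto intro!: derivative_eq_intros)
      from has_vector_derivative_real_field[OF this]
      show "((\<lambda>\<theta>. exp (\<i> * of_real (\<theta> * of_int (charge j w)))) has_vector_derivative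
          of_int (charge j w) * \<i>) (at 0)" by simp
    qed
    note bounded_linear.has_vector_derivative[OF scaleC.bounded_linear_right
        bounded_linear.has_vector_derivative[OF scaleC.bounded_linear_left this]]
    then show "((\<lambda>\<theta>. Poly_Mapping.lookup p w *\<^sub>C (cis (\<theta> * real_of_int (charge j w)) *\<^sub>C word_op Z w))
      has_vector_derivative Poly_Mapping.lookup p w *\<^sub>C ((of_int (charge j w) * \<i>) *\<^sub>C word_op Z w)) (at 0)"
      by blast
  qed
  moreover have "((\<lambda>\<theta>. poly_op (V \<theta>) p) has_vector_derivative 0) (at 0)"
    by (simp add: zero)
  ultimately have "0 = (\<Sum>w\<in>Poly_Mapping.keys p. Poly_Mapping.lookup p w *\<^sub>C
        ((of_int (charge j w) * \<i>) *\<^sub>C word_op Z w))"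
    using vector_derivative_unique_at by blast
  also have "\<dots> = \<i> *\<^sub>C poly_op Z (cpoly j p)"
    by (simp add: poly_op_cpoly scaleC.sum_right scaleC_scaleC mult_ac)
  finally have "\<i> *\<^sub>C poly_op Z (cpoly j p) = 0" by simp
  then have "norm (\<i> *\<^sub>C poly_op Z (cpoly j p)) = 0" by simp
  then show ?thesis by (simp add: norm_scaleC)
qed

text \<open>On \<open>A0 Z\<close> the choice of the representing polynomial is immaterial, because
  \<open>cpoly j\<close> preserves the kernel of \<open>poly_op Z\<close>.\<close>

definition charge_deriv ::
  "('n \<Rightarrow> 'h :: hilbert_space \<Rightarrow>\<^sub>L 'h) \<Rightarrow> 'n \<Rightarrow> ('h \<Rightarrow>\<^sub>L 'h) \<Rightarrow> ('h \<Rightarrow>\<^sub>L 'h)" where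
  "charge_deriv Z j x = poly_op Z (cpoly j (SOME p. poly_op Z p = x))"

lemma charge_deriv_poly_op:
  assumes Z: "sphere_in_B K Z"
  shows "charge_deriv Z j (poly_op Z p) = poly_op Z (cpoly j p)"
proof -
  define q where "q = (SOME q. poly_op Z q = poly_op Z p)"
  have "poly_op Z q = poly_op Z p" unfolding q_def by (rule someI[of _ p]) simp
  then have "poly_op Z (cpoly j (q - p)) = 0"
    using poly_op_cpoly_zero[OF Z] by (simp add: poly_op_diff)
  moreover have "cpoly j q = cpoly j (q - p) + cpoly j p"
    using cpoly_add[of j "q - p" p] by simp
  ultimately show ?thesis by (simp add: charge_deriv_def poly_op_add flip: q_def)
qed

lemma charge_deriv_word:
  assumes Z: "sphere_in_B K Z"
  shows "charge_deriv Z j (word_op Z w) = of_int (charge j w) *\<^sub>C word_op Z w"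
  using charge_deriv_poly_op[OF Z, of j "Poly_Mapping.single w 1"] by (simp add: cpoly_def)

text \<open>For words the Leibniz rule is additivity of charges under concatenation; two nested
  inductions extend it bilinearly to \<open>A0 Z\<close>.\<close>

lemma charge_derivation_charge_deriv:
  assumes Z: "sphere_in_B K Z"
  shows "charge_derivation Z j (charge_deriv Z j)"
proof -
  have bop: "Z i \<in> bop" for i using Z by (simp add: sphere_in_B_def)
  note A0 = A0_eq_range_poly_op[OF bop]
  have range: "charge_deriv Z j ` A0 Z \<subseteq> A0 Z"
    unfolding A0 by (auto simp: charge_deriv_poly_op[OF Z])
  have d_add: "charge_deriv Z j (x + y) = charge_deriv Z j x + charge_deriv Z j y"
    if xy: "x \<in> A0 Z" "y \<in> A0 Z" for x y
  proof -
    obtain p q where "x = poly_op Z p" "y = poly_op Z q" using xy unfolding A0 by blast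
    then show ?thesis
      using charge_deriv_poly_op[OF Z, of j "p + q"]
      by (simp add: charge_deriv_poly_op[OF Z] cpoly_add poly_op_add)
  qed
  have d_scale: "charge_deriv Z j (a *\<^sub>C x) = a *\<^sub>C charge_deriv Z j x" if x: "x \<in> A0 Z" for x a
  proof -
    obtain p where p: "x = poly_op Z p" using x unfolding A0 by blast
    have "poly_op Z (cpoly j (pconst a * p)) = a *\<^sub>C poly_op Z (cpoly j p)"
    proof (induction p rule: ncpoly_induct)
      case zero
      then show ?case by (simp add: cpoly_def scaleC.zero_right)
    next
      case (single w b)
      then show ?case
        by (cases "a = 0"; cases "b = 0")
            (auto simp: pconst_def mult_single cpoly_def scaleC_scaleC mult_ac scaleC.zero_right)
    next
      case (add p q)
      then show ?case by (simp add: distrib_left cpoly_add poly_op_add scaleC_add_right)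
    qed
    then show ?thesis
      unfolding p using charge_deriv_poly_op[OF Z, of j "pconst a * p"]
      by (simp add: charge_deriv_poly_op[OF Z] poly_op_pconst_mult[OF bop])
  qed
  have A0_bop: "x \<in> bop" if "x \<in> A0 Z" for x using A0_subset_bop[of Z, OF bop] that by blast
  have comp: "x o\<^sub>L y \<in> A0 Z" if "x \<in> A0 Z" "y \<in> A0 Z" for x y
    using unital_star_subalgebra_A0[of Z] that by (simp add: unital_star_subalgebra_def)
  have "charge_deriv Z j (x o\<^sub>L y) = (charge_deriv Z j x o\<^sub>L y) + (x o\<^sub>L charge_deriv Z j y)"
    if x: "x \<in> A0 Z" and y: "y \<in> A0 Z" for x y
    using bop x
  proof (induction x rule: A0_induct)
    case (word v)
    show ?case
      using bop y
    proof (induction y rule: A0_induct)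
      case (word w)
      show ?case
        by (simp add: charge_deriv_word[OF Z] charge_plus scaleC_add_left compose_scaleC_left
            compose_scaleC_right word_op_bop[OF bop] flip: word_op_plus)
    next
      case (add x y)
      then show ?case
        by (simp add: compose_add_right d_add comp word_op_in_A0 algebra_simps)
    next
      case (scaleC a x)
      then show ?case
        using range word_op_in_A0
        by (simp add: compose_scaleC_right d_scale comp word_op_in_A0 A0_bop scaleC_add_right
            image_subset_iff)
    qed
  next
    case (add x x')
    then show ?case using y by (simp add: compose_add_left d_add comp algebra_simps)
  next
    case (scaleC a x)
    then show ?case using y
      by (simp add: compose_scaleC_left d_scale comp scaleC_add_right)
  qed
  with range d_add d_scale charge_deriv_word[OF Z] show ?thesis
    by (simp add: charge_derivation_def clinear_on_def)
qed

lemma charge_derivation_unique: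
  assumes bop: "\<And>i. Z i \<in> bop"
    and D: "charge_derivation Z j D" and D': "charge_derivation Z j D'" and x: "x \<in> A0 Z"
  shows "D x = D' x"
  using bop x
  by (induction x rule: A0_induct) (use D D' in \<open>auto simp: charge_derivation_def clinear_on_def\<close>)

section \<open>Bounded operators from their values on a total family\<close>

text \<open>The bound makes \<open>f\<close> Lipschitz, hence uniformly continuous and extendable to
  the closure; linearity and the same constant survive along approximating sequences.\<close>

lemma bounded_extension:
  fixes f :: "'a :: complex_normed_vector \<Rightarrow> 'b :: {complex_normed_vector, banach}"
  assumes S: "csubspace S" and lin: "clinear_on S f" and bound: "\<And>x. x \<in> S \<Longrightarrow> norm (f x) \<le> C * norm x"
  shows "\<exists>g. clinear_on (closure S) g \<and> (\<forall>x\<in>closure S. norm (g x) \<le> C * norm x) \<and> (\<forall>x\<in>S. g x = f x)"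
proof -
  \<comment> \<open>The sign of \<open>C\<close> is not prescribed, whereas a Lipschitz constant has
    to be nonnegative.\<close>
  have "\<bar>C\<bar>-lipschitz_on S f"
  proof (rule lipschitz_onI)
    fix x y assume "x \<in> S" "y \<in> S"
    then have "norm (f (x - y)) \<le> C * norm (x - y)" "f (x - y) = f x - f y"
      by (auto intro: bound csubspace_diff[OF S] clinear_on_diff[OF lin S])
    moreover have "C * norm (x - y) \<le> \<bar>C\<bar> * norm (x - y)" by (intro mult_right_mono) auto
    ultimately show "dist (f x) (f y) \<le> \<bar>C\<bar> * dist x y" by (simp add: dist_norm)
  qed simp
  then have "uniformly_continuous_on S f" by (rule lipschitz_on_uniformly_continuous)
  then obtain g where g: "uniformly_continuous_on (closure S) g" "\<And>x. x \<in> S \<Longrightarrow> f x = g x"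
    using uniformly_continuous_on_extension_on_closure by metis
  have lim: "(\<lambda>n. f (s n)) \<longlonglongrightarrow> g x" if "x \<in> closure S" "\<And>n. s n \<in> S" "s \<longlonglongrightarrow> x" for s x
  proof -
    have "(\<lambda>n. g (s n)) \<longlonglongrightarrow> g x"
      using continuous_on_tendsto_compose[OF uniformly_continuous_imp_continuous[OF g(1)] that(3,1)]
        that(2) closure_subset by (auto intro!: always_eventually)
    then show ?thesis using g(2) that(2) by simp
  qed
  have "clinear_on (closure S) g"
    unfolding clinear_on_def
  proof (intro conjI allI ballI)
    fix x y assume x: "x \<in> closure S" and y: "y \<in> closure S"
    then obtain s r where s: "\<And>n. s n \<in> S" "s \<longlonglongrightarrow> x" and r: "\<And>n. r n \<in> S" "r \<longlonglongrightarrow> y"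
      unfolding closure_sequential by blast
    have "(\<lambda>n. f (s n + r n)) \<longlonglongrightarrow> g (x + y)"
      using S s r csubspace_closure[OF S] x y
      by (intro lim tendsto_add) (auto simp: csubspace_def)
    moreover have "(\<lambda>n. f (s n + r n)) \<longlonglongrightarrow> g x + g y"
      using tendsto_add[OF lim[OF x s] lim[OF y r]] lin s(1) r(1) by (simp add: clinear_on_def)
    ultimately show "g (x + y) = g x + g y" by (rule LIMSEQ_unique)
  next
    fix a x assume x: "x \<in> closure S"
    then obtain s where s: "\<And>n. s n \<in> S" "s \<longlonglongrightarrow> x"
      unfolding closure_sequential by blast
    have "(\<lambda>n. f (a *\<^sub>C s n)) \<longlonglongrightarrow> g (a *\<^sub>C x)"
      using S s csubspace_closure[OF S] x
      by (intro lim scaleC.tendsto tendsto_const) (auto simp: csubspace_def)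
    moreover have "(\<lambda>n. f (a *\<^sub>C s n)) \<longlonglongrightarrow> a *\<^sub>C g x"
      using scaleC.tendsto[OF tendsto_const[of a] lim[OF x s]] lin s(1) by (simp add: clinear_on_def)
    ultimately show "g (a *\<^sub>C x) = a *\<^sub>C g x" by (rule LIMSEQ_unique)
  qed
  moreover have "norm (g x) \<le> C * norm x" if x: "x \<in> closure S" for x
  proof -
    from x obtain s where s: "\<And>n. s n \<in> S" "s \<longlonglongrightarrow> x"
      unfolding closure_sequential by blast
    show ?thesis
      by (rule LIMSEQ_le[OF tendsto_norm[OF lim[OF x s]] tendsto_mult[OF tendsto_const tendsto_norm[OF s(2)]]])
        (use bound s(1) in auto)
  qed
  ultimately show ?thesis using g(2) by (intro exI[of _ g]) auto
qed

text \<open>Contractivity from the twisting argument makes the passage from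
  \<open>poly_op Z p\<close> to \<open>poly_op V p\<close> well defined and extendable to the
  closure. Products and adjoints are norm continuous, so the algebraic identities pass to
  limits.\<close>

lemma star_hom_extension:
  fixes Z :: "'n :: finite \<Rightarrow> 'h :: hilbert_space \<Rightarrow>\<^sub>L 'h" and V :: "'n \<Rightarrow> 'g :: hilbert_space \<Rightarrow>\<^sub>L 'g"
  assumes Z: "sphere_in_B K Z" and V: "\<And>i. V i \<in> bop"
    and T: "\<And>n. clinear_on (A0 Z) (T n)" and w: "\<And>w. word_op V w = T (\<lambda>j. charge j w) (word_op Z w)"
  shows "\<exists>\<pi>. star_hom (Aclosed Z) \<pi> \<and> (\<forall>p. \<pi> (poly_op Z p) = poly_op V p)"
proof -
  have bop: "Z i \<in> bop" for i using Z by (simp add: sphere_in_B_def)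
  note A0 = A0_eq_range_poly_op[of Z, OF bop]
  note S = csubspace_A0[of Z]
  define f where "f x = poly_op V (SOME p. poly_op Z p = x)" for x
  note le = norm_poly_op_le_twist[OF Z V T w]
  have f: "f (poly_op Z p) = poly_op V p" for p
  proof -
    define q where "q = (SOME q. poly_op Z q = poly_op Z p)"
    have "poly_op Z q = poly_op Z p" unfolding q_def by (rule someI[of _ p]) simp
    \<comment> \<open>Two representatives of one element differ by a polynomial of norm zero, which
      contractivity sends to zero.\<close>
    then have "norm (poly_op V (q - p)) \<le> 0" using le[of "q - p"] by (simp add: poly_op_diff)
    then show ?thesis by (simp add: f_def poly_op_diff flip: q_def)
  qed
  have lin: "clinear_on (A0 Z) f"
    unfolding clinear_on_def A0
  proof (intro conjI allI ballI; elim rangeE; hypsubst)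
    fix p q show "f (poly_op Z p + poly_op Z q) = f (poly_op Z p) + f (poly_op Z q)"
      using f[of "p + q"] by (simp add: f poly_op_add)
    fix a show "f (a *\<^sub>C poly_op Z p) = a *\<^sub>C f (poly_op Z p)"
      using f[of "pconst a * p"] by (simp add: f poly_op_pconst_mult[of Z, OF bop] poly_op_pconst_mult[of V, OF V])
  qed
  have bound: "norm (f x) \<le> 1 * norm x" if "x \<in> A0 Z" for x
    using that le unfolding A0 by (auto simp: f)
  obtain g where g: "clinear_on (Aclosed Z) g" "\<And>x. x \<in> Aclosed Z \<Longrightarrow> norm (g x) \<le> norm x"
      "\<And>x. x \<in> A0 Z \<Longrightarrow> g x = f x"
    using bounded_extension[OF S lin bound] by (auto simp: Aclosed_def)
  have Ac: "csubspace (Aclosed Z)" unfolding Aclosed_def by (rule csubspace_closure[OF S])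
  have sub: "A0 Z \<subseteq> Aclosed Z" unfolding Aclosed_def by (rule closure_subset)
  have lim: "(\<lambda>n. f (s n)) \<longlonglongrightarrow> g x" if "x \<in> Aclosed Z" "\<And>n. s n \<in> A0 Z" "s \<longlonglongrightarrow> x" for s x
  proof -
    have "norm (f (s n) - g x) \<le> norm (s n - x)" for n
    proof -
      have sn: "s n \<in> Aclosed Z" using that(2) sub by blast
      have "g (s n - x) = f (s n) - g x"
        using clinear_on_diff[OF g(1) Ac sn that(1)] g(3)[OF that(2)] by simp
      with g(2)[OF csubspace_diff[OF Ac sn that(1)]] show ?thesis by simp
    qed
    moreover have "(\<lambda>n. norm (s n - x)) \<longlonglongrightarrow> 0"
      using that(3) by (simp add: LIM_zero_iff tendsto_norm_zero_iff)
    ultimately have "(\<lambda>n. f (s n) - g x) \<longlonglongrightarrow> 0"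
      by (rule Lim_null_comparison[OF always_eventually[OF allI]])
    then show ?thesis by (simp add: LIM_zero_iff)
  qed
  have seq: "\<exists>s. (\<forall>n. s n \<in> A0 Z) \<and> s \<longlonglongrightarrow> x" if "x \<in> Aclosed Z" for x
    using that unfolding Aclosed_def closure_sequential .
  have clos: "x \<in> Aclosed Z" if "\<And>n. s n \<in> A0 Z" "s \<longlonglongrightarrow> x" for s x
    using that unfolding Aclosed_def closure_sequential by blast
  have Ac_bop: "Aclosed Z \<subseteq> bop"
    unfolding Aclosed_def by (rule closure_minimal[OF A0_subset_bop[of Z, OF bop] closed_bop])
  have sub_A0: "x o\<^sub>L y \<in> A0 Z" "adj x \<in> A0 Z" if "x \<in> A0 Z" "y \<in> A0 Z" for x y
    using unital_star_subalgebra_A0[of Z] that by (simp_all add: unital_star_subalgebra_def)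
  have f_bop: "f x \<in> bop" if "x \<in> A0 Z" for x
    using that unfolding A0 by (auto simp: f poly_op_bop V)
  have f_comp: "f (x o\<^sub>L y) = f x o\<^sub>L f y" if xy: "x \<in> A0 Z" "y \<in> A0 Z" for x y
  proof -
    obtain p q where "x = poly_op Z p" "y = poly_op Z q" using xy unfolding A0 by blast
    then show ?thesis
      using f[of "p * q"] by (simp add: f poly_op_mult[of Z, OF bop] poly_op_mult[of V, OF V])
  qed
  have f_adj: "f (adj x) = adj (f x)" if x: "x \<in> A0 Z" for x
  proof -
    obtain p where "x = poly_op Z p" using x unfolding A0 by blast
    then show ?thesis
      using f[of "pstar p"] by (simp add: f poly_op_pstar[of Z, OF bop] poly_op_pstar[of V, OF V])
  qed
  \<comment> \<open>Taking adjoints is additive and isometric on \<open>bop\<close>, hence norm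
    continuous.\<close>
  have adj_lim: "(\<lambda>n. adj (s n)) \<longlonglongrightarrow> adj x"
    if "\<And>n. s n \<in> bop" "x \<in> bop" "s \<longlonglongrightarrow> x" for s and x :: "'a :: hilbert_space \<Rightarrow>\<^sub>L 'b :: hilbert_space"
  proof -
    have "norm (adj (s n) - adj x) \<le> norm (s n - x)" for n
    proof -
      have "s n - x \<in> bop" by (rule csubspace_diff[OF csubspace_bop that(1,2)])
      moreover have "adj (s n) = adj (s n - x) + adj x"
        using adj_add[OF \<open>s n - x \<in> bop\<close> that(2)] by simp
      ultimately show ?thesis by (simp add: norm_adj)
    qed
    moreover have "(\<lambda>n. norm (s n - x)) \<longlonglongrightarrow> 0"
      using that(3) by (simp add: LIM_zero_iff tendsto_norm_zero_iff)
    ultimately have "(\<lambda>n. adj (s n) - adj x) \<longlonglongrightarrow> 0"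
      by (rule Lim_null_comparison[OF always_eventually[OF allI]])
    then show ?thesis by (simp add: LIM_zero_iff)
  qed
  have g_bop: "g x \<in> bop" if x: "x \<in> Aclosed Z" for x
  proof -
    obtain s where s: "\<And>n. s n \<in> A0 Z" "s \<longlonglongrightarrow> x" using seq[OF x] by blast
    show ?thesis by (rule closed_sequentially[OF closed_bop f_bop lim[OF x s]]) (rule s(1))
  qed
  have "g (x o\<^sub>L y) = g x o\<^sub>L g y" if x: "x \<in> Aclosed Z" and y: "y \<in> Aclosed Z" for x y
  proof -
    obtain s r where s: "\<And>n. s n \<in> A0 Z" "s \<longlonglongrightarrow> x" and r: "\<And>n. r n \<in> A0 Z" "r \<longlonglongrightarrow> y"
      using seq[OF x] seq[OF y] by blast
    have c: "(\<lambda>n. s n o\<^sub>L r n) \<longlonglongrightarrow> (x o\<^sub>L y)"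
      by (rule bounded_bilinear.tendsto[OF bounded_bilinear_blinfun_compose s(2) r(2)])
    have "(\<lambda>n. f (s n o\<^sub>L r n)) \<longlonglongrightarrow> g (x o\<^sub>L y)"
      by (rule lim[OF clos[OF _ c] _ c]) (auto intro: sub_A0 s(1) r(1))
    moreover have "(\<lambda>n. f (s n) o\<^sub>L f (r n)) \<longlonglongrightarrow> (g x o\<^sub>L g y)"
      by (rule bounded_bilinear.tendsto[OF bounded_bilinear_blinfun_compose lim[OF x s] lim[OF y r]])
    ultimately show ?thesis using s(1) r(1) by (simp add: f_comp LIMSEQ_unique)
  qed
  moreover have "g (adj x) = adj (g x)" if x: "x \<in> Aclosed Z" for x
  proof -
    obtain s where s: "\<And>n. s n \<in> A0 Z" "s \<longlonglongrightarrow> x" using seq[OF x] by blast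
    have s_bop: "s n \<in> bop" for n using s(1) sub Ac_bop by blast
    have c: "(\<lambda>n. adj (s n)) \<longlonglongrightarrow> adj x"
      by (rule adj_lim) (use s_bop x Ac_bop s(2) in auto)
    have "(\<lambda>n. f (adj (s n))) \<longlonglongrightarrow> g (adj x)"
      by (rule lim[OF clos[OF _ c] _ c]) (auto intro: sub_A0 s(1))
    moreover have "(\<lambda>n. adj (f (s n))) \<longlonglongrightarrow> adj (g x)"
      by (rule adj_lim[OF f_bop g_bop[OF x] lim[OF x s]]) (rule s(1))
    ultimately show ?thesis using s(1) by (simp add: f_adj LIMSEQ_unique)
  qed
  ultimately have "star_hom (Aclosed Z) g"
    using g(1) g_bop by (auto simp: star_hom_def)
  moreover have "g (poly_op Z p) = poly_op V p" for p
    using g(3)[of "poly_op Z p"] A0 by (simp add: f)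
  ultimately show ?thesis by blast
qed

section \<open>Total families and operators prescribed on them\<close>

text \<open>Lists of coefficients and indices are the format of \<open>fip\<close>, so an inner
  product of two combinations is \<open>fip\<close> of a Gram kernel and positivity of kernels
  yields norm estimates.\<close>

definition lincomb :: "(complex \<times> 'i) list \<Rightarrow> ('i \<Rightarrow> 'a :: complex_normed_vector) \<Rightarrow> 'a" where
  "lincomb p e = (\<Sum>(a, x)\<leftarrow>p. a *\<^sub>C e x)"

lemma lincomb_simps [simp]:
  "lincomb [] e = 0" "lincomb ((a, x) # p) e = a *\<^sub>C e x + lincomb p e"
  "lincomb (p @ q) e = lincomb p e + lincomb q e"
  by (simp_all add: lincomb_def)

lemma lincomb_fscale [simp]: "lincomb (fscale a p) e = a *\<^sub>C lincomb p e"
  by (induction p) (auto simp: fscale_def scaleC_add_right scaleC_scaleC scaleC.zero_right)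

lemma lincomb_fdiff [simp]: "lincomb (fdiff p q) e = lincomb p e - lincomb q e"
  by (simp add: fdiff_def scaleC_minus_one)

lemma cinner_lincomb: "cinner (lincomb p e) (lincomb q e') = fip (\<lambda>x y. cinner (e x) (e' y)) p q"
proof -
  have "cinner (e x) (lincomb q e') = fip (\<lambda>x y. cinner (e x) (e' y)) [(1, x)] q" for x
    by (induction q) (auto simp: fip_def cinner_add_right cinner_scaleC_right)
  then have "cinner (lincomb ((a, x) # p) e) (lincomb q e') =
      fip (\<lambda>x y. cinner (e x) (e' y)) ((a, x) # p) q"
    if "cinner (lincomb p e) (lincomb q e') = fip (\<lambda>x y. cinner (e x) (e' y)) p q" for a x p
    using that fip_Cons_left[of _ a x p q] by (simp add: cinner_add_left cinner_scaleC_left)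
  then show ?thesis
    by (induction p) auto
qed

lemma cspan_range_lincomb: "cspan (range e) = range (\<lambda>p. lincomb p e)"
proof
  show "cspan (range e) \<subseteq> range (\<lambda>p. lincomb p e)"
  proof (rule cspan_minimal)
    show "range e \<subseteq> range (\<lambda>p. lincomb p e)"
      by (auto intro!: image_eqI[where x = "[(1, _)]"])
    have "0 \<in> range (\<lambda>p. lincomb p e)" by (metis lincomb_simps(1) rangeI)
    moreover have "lincomb p e + lincomb q e \<in> range (\<lambda>p. lincomb p e)" for p q
      by (metis lincomb_simps(3) rangeI)
    moreover have "a *\<^sub>C lincomb p e \<in> range (\<lambda>p. lincomb p e)" for a p
      by (metis lincomb_fscale rangeI)
    ultimately show "csubspace (range (\<lambda>p. lincomb p e))" by (auto simp: csubspace_def)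
  qed
  have "lincomb p e \<in> cspan (range e)" for p
    using csubspace_cspan[of "range e"] cspan_superset[of "range e"]
    by (induction p) (auto simp: csubspace_def image_subset_iff)
  then show "range (\<lambda>p. lincomb p e) \<subseteq> cspan (range e)" by blast
qed

definition total :: "('i \<Rightarrow> 'a :: complex_normed_vector) \<Rightarrow> bool" where
  "total e \<longleftrightarrow> closure (cspan (range e)) = UNIV"

lemma total_induct:
  assumes "total e" "closed S" "csubspace S" "\<And>i. e i \<in> S"
  shows "x \<in> S"
proof -
  have "closure (cspan (range e)) \<subseteq> S"
    using assms(2-) by (intro closure_minimal cspan_minimal) auto
  then show ?thesis using assms(1) by (auto simp: total_def)
qed

lemma total_cinner_eqI:
  fixes x y :: "'a :: hilbert_space"
  assumes "total e" "\<And>i. cinner (e i) x = cinner (e i) y"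
  shows "x = y"
proof (rule hilbert_eqI)
  fix z
  have "z \<in> {z. cinner z x = cinner z y}"
    using assms(1)
  proof (rule total_induct)
    show "closed {z. cinner z x = cinner z y}"
      by (intro closed_Collect_eq cinner.continuous_on continuous_intros)
    show "csubspace {z. cinner z x = cinner z y}"
      by (auto simp: csubspace_def cinner_add_left cinner_scaleC_left)
  qed (use assms(2) in auto)
  then show "cinner z x = cinner z y" by simp
qed

lemma total_bop_eqI:
  assumes "total e" "S \<in> bop" "T \<in> bop" "\<And>i. blinfun_apply S (e i) = blinfun_apply T (e i)"
  shows "S = T"
proof (rule blinfun_eqI)
  fix x
  have "x \<in> {x. S x = T x}"
    using assms(1)
  proof (rule total_induct)
    show "closed {x. S x = T x}"
      by (intro closed_Collect_eq blinfun.continuous_on continuous_intros)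
    show "csubspace {x. S x = T x}"
      using assms(2,3) by (auto simp: csubspace_def bop_add bop_scaleC)
  qed (use assms(4) in auto)
  then show "S x = T x" by simp
qed

text \<open>The family may be linearly dependent. The bound over all formal combinations forces
  dependencies among the \<open>e i\<close> to hold among the \<open>e' i\<close> as well, and also
  gives continuity.\<close>

lemma operator_from_family:
  fixes e :: "'i \<Rightarrow> 'a :: complex_normed_vector"
    and e' :: "'i \<Rightarrow> 'b :: {complex_normed_vector, banach}"
  assumes tot: "total e" and bound: "\<And>p. norm (lincomb p e') \<le> C * norm (lincomb p e)"
  shows "\<exists>T\<in>bop. \<forall>i. blinfun_apply T (e i) = e' i"
proof -
  define S where "S = cspan (range e)"
  have S: "csubspace S" unfolding S_def by (rule csubspace_cspan)
  define f where "f x = lincomb (SOME p. lincomb p e = x) e'" for x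
  have f: "f (lincomb p e) = lincomb p e'" for p
  proof -
    define q where "q = (SOME q. lincomb q e = lincomb p e)"
    have "lincomb q e = lincomb p e" unfolding q_def by (rule someI[of _ p]) simp
    then have "norm (lincomb q e' - lincomb p e') \<le> 0"
      using bound[of "fdiff q p"] by simp
    then show ?thesis by (simp add: f_def flip: q_def)
  qed
  have Sr: "S = range (\<lambda>p. lincomb p e)" by (simp add: S_def cspan_range_lincomb)
  have "clinear_on S f"
    unfolding clinear_on_def
  proof (intro conjI allI ballI)
    fix x y assume "x \<in> S" "y \<in> S"
    then obtain p q where "x = lincomb p e" "y = lincomb q e" unfolding Sr by blast
    then show "f (x + y) = f x + f y" using f[of "p @ q"] by (simp add: f)
  next
    fix a x assume "x \<in> S"
    then obtain p where "x = lincomb p e" unfolding Sr by blast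
    then show "f (a *\<^sub>C x) = a *\<^sub>C f x" using f[of "fscale a p"] by (simp add: f)
  qed
  moreover have "norm (f x) \<le> C * norm x" if "x \<in> S" for x
    using that bound by (auto simp: Sr f)
  ultimately obtain g where g: "clinear_on (closure S) g"
    "\<And>x. x \<in> closure S \<Longrightarrow> norm (g x) \<le> C * norm x" "\<And>x. x \<in> S \<Longrightarrow> g x = f x"
    using bounded_extension[OF S] by blast
  have cS: "closure S = UNIV" using tot by (simp add: total_def S_def)
  have "bounded_linear g"
  proof (rule bounded_linear_intro[where K = C])
    show "g (x + y) = g x + g y" for x y using g(1) by (simp add: cS clinear_on_def)
    show "g (r *\<^sub>R x) = r *\<^sub>R g x" for r x
      using g(1) by (simp add: cS clinear_on_def flip: scaleC_of_real)
    show "norm (g x) \<le> norm x * C" for x using g(2) by (simp add: cS mult.commute)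
  qed
  then have app: "blinfun_apply (Blinfun g) = g" by (rule bounded_linear_Blinfun_apply)
  then have "Blinfun g \<in> bop" using g(1) by (simp add: bop_def cS)
  moreover have "g (e i) = e' i" for i
    using g(3)[of "e i"] f[of "[(1, i)]"] cspan_superset[of "range e"] by (auto simp: S_def)
  ultimately show ?thesis using app by metis
qed

definition isometry :: "('a :: hilbert_space \<Rightarrow>\<^sub>L 'b :: hilbert_space) \<Rightarrow> bool" where
  "isometry T \<longleftrightarrow> T \<in> bop \<and> (\<forall>x y. cinner (T x) (T y) = cinner x y)"

text \<open>Norms of combinations depend only on the Gram kernel, so equal Gram kernels give a
  bounded operator with constant 1.\<close>

lemma isometry_from_family:
  assumes tot: "total e" and e: "\<And>x y. cinner (e' x) (e' y) = cinner (e x) (e y)"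
  shows "\<exists>T. isometry T \<and> (\<forall>i. blinfun_apply T (e i) = e' i)"
proof -
  have "(norm (lincomb p e'))\<^sup>2 = (norm (lincomb p e))\<^sup>2" for p
  proof -
    have "of_real ((norm (lincomb p e'))\<^sup>2) = (of_real ((norm (lincomb p e))\<^sup>2) :: complex)"
      unfolding cinner_self[symmetric] cinner_lincomb e ..
    then show ?thesis by (simp only: of_real_eq_iff)
  qed
  then have "norm (lincomb p e') \<le> 1 * norm (lincomb p e)" for p by simp
  from operator_from_family[OF tot this]
  obtain T where T: "T \<in> bop" "\<And>i. blinfun_apply T (e i) = e' i" by blast
  \<comment> \<open>Preservation of all inner products is equivalent to this identity, which only
    has to be tested on the total family, on both sides of the inner product.\<close>
  have "adj T (T x) = x" for x
  proof -
    have "adj T o\<^sub>L T = id_blinfun"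
    proof (rule total_bop_eqI[OF tot])
      fix i
      show "(adj T o\<^sub>L T) (e i) = id_blinfun (e i)"
        by (rule total_cinner_eqI[OF tot]) (simp add: T e flip: cinner_adj[OF T(1)])
    qed (use T in \<open>auto intro: compose_bop adj_bop id_blinfun_bop\<close>)
    then show ?thesis by (metis blinfun_apply_blinfun_compose blinfun_apply_id_blinfun id_apply)
  qed
  with T show ?thesis unfolding isometry_def by (metis cinner_adj)
qed


section \<open>Tensor products of operators\<close>

lemma total_kvec: "total kvec"
  by (simp add: total_def kspace_total)

lemma total_htensor: "total (\<lambda>(u, v). u \<otimes>\<^sub>H v)"
  using total_kvec by (simp add: htensor_def)

text \<open>Simple tensors are mere generators of the kernel space. Bilinearity holds because null
  vectors were divided out, so it is seen by pairing with all simple tensors.\<close>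

lemma bounded_bilinear_htensor:
  "bounded_bilinear (htensor :: 'a :: hilbert_space \<Rightarrow> 'b :: hilbert_space \<Rightarrow> _)"
proof
  have tens: "x = y" if "\<And>u v. cinner (u \<otimes>\<^sub>H v) x = cinner (u \<otimes>\<^sub>H v) y" for x y :: "('a, 'b) htensor"
    by (rule total_cinner_eqI[OF total_htensor]) (use that in auto)
  fix u u' :: 'a and v v' :: 'b and r
  show "(u + u') \<otimes>\<^sub>H v = u \<otimes>\<^sub>H v + u' \<otimes>\<^sub>H v"
    by (rule tens) (simp add: cinner_htensor cinner_add_right algebra_simps)
  show "u \<otimes>\<^sub>H (v + v') = u \<otimes>\<^sub>H v + u \<otimes>\<^sub>H v'"
    by (rule tens) (simp add: cinner_htensor cinner_add_right algebra_simps)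
  show "(r *\<^sub>R u) \<otimes>\<^sub>H v = r *\<^sub>R (u \<otimes>\<^sub>H v)"
    by (rule tens) (simp add: cinner_htensor cinner.scaleR_right)
  show "u \<otimes>\<^sub>H (r *\<^sub>R v) = r *\<^sub>R (u \<otimes>\<^sub>H v)"
    by (rule tens) (simp add: cinner_htensor cinner.scaleR_right)
  have "norm (u \<otimes>\<^sub>H v) = norm u * norm v" for u :: 'a and v :: 'b
  proof -
    have "of_real ((norm (u \<otimes>\<^sub>H v))\<^sup>2) = (of_real ((norm u * norm v)\<^sup>2) :: complex)"
      unfolding cinner_self[symmetric] cinner_htensor
      by (simp add: cinner_self power_mult_distrib)
    then show ?thesis unfolding of_real_eq_iff by (rule power2_eq_imp_eq) auto
  qed
  then show "\<exists>K. \<forall>u v. norm ((u :: 'a) \<otimes>\<^sub>H (v :: 'b)) \<le> norm u * norm v * K"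
    by (intro exI[of _ 1]) simp
qed

interpretation htensor: bounded_bilinear "htensor :: 'a :: hilbert_space \<Rightarrow> 'b :: hilbert_space \<Rightarrow> _"
  by (rule bounded_bilinear_htensor)

lemma htensor_scaleC_left: "(a *\<^sub>C u) \<otimes>\<^sub>H v = a *\<^sub>C (u \<otimes>\<^sub>H v)"
  by (rule total_cinner_eqI[OF total_htensor]) (auto simp: cinner_htensor cinner_scaleC_right)

text \<open>Boundedness of \<open>A \<otimes> B\<close> is Schur's product theorem for the positive kernel
  \<open>\<parallel>A\<parallel>\<^sup>2 \<langle>u, u'\<rangle> - \<langle>A u, A u'\<rangle>\<close>.\<close>

lemma op_tensor_exists:
  fixes A :: "'a :: hilbert_space \<Rightarrow>\<^sub>L 'b :: hilbert_space"
    and B :: "'e :: hilbert_space \<Rightarrow>\<^sub>L 'd :: hilbert_space"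
  assumes A: "A \<in> bop" and B: "isometry B"
  shows "\<exists>T\<in>bop. \<forall>u v. blinfun_apply T (u \<otimes>\<^sub>H v) = A u \<otimes>\<^sub>H B v"
proof -
  define K where "K x y = of_real ((norm A)\<^sup>2) * cinner (fst x) (fst y) - cinner (A (fst x)) (A (fst y))"
    for x y :: "'a \<times> 'e"
  have fipK: "fip K p q = of_real ((norm A)\<^sup>2) * cinner (lincomb p fst) (lincomb q fst)
      - cinner (A (lincomb p fst)) (A (lincomb q fst))" for p q
  proof -
    have *: "A (lincomb p fst) = lincomb p (\<lambda>x. A (fst x))" for p
      by (induction p) (auto simp: bop_add[OF A] bop_scaleC[OF A] blinfun.zero_right)
    have "fip K p q = of_real ((norm A)\<^sup>2) * fip (\<lambda>x y. cinner (fst x) (fst y)) p q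
        - fip (\<lambda>x y. cinner (A (fst x)) (A (fst y))) p q"
      by (simp add: fip_eq K_def right_diff_distrib sum_list_subtractf mult_ac flip: sum_list_const_mult)
    then show ?thesis by (simp add: * cinner_lincomb)
  qed
  have "pos_kernel K"
    unfolding pos_kernel_def
  proof (intro conjI allI)
    fix x y show "K x y = cnj (K y x)" by (simp add: K_def flip: cinner_commute)
  next
    fix p :: "(complex \<times> 'a \<times> 'e) list"
    have "(norm (A (lincomb p fst)))\<^sup>2 \<le> (norm A * norm (lincomb p fst))\<^sup>2"
      by (intro power_mono norm_blinfun) simp
    then show "0 \<le> Re (fip K p p)"
      by (simp add: fipK cinner_self power_mult_distrib)
  qed
  from pos_kernel_mult_cinner[OF this, of snd]
  have pos: "0 \<le> Re (fip (\<lambda>x y. K x y * cinner (snd x) (snd y)) p p)" for p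
    unfolding pos_kernel_def by blast
  have "norm (lincomb p (\<lambda>(u, v). A u \<otimes>\<^sub>H B v)) \<le> norm A * norm (lincomb p (\<lambda>(u, v). u \<otimes>\<^sub>H v))" for p
  proof (rule power2_le_imp_le)
    let ?l = "lincomb p (\<lambda>(u, v). A u \<otimes>\<^sub>H B v)" and ?r = "lincomb p (\<lambda>(u, v). u \<otimes>\<^sub>H v)"
    \<comment> \<open>Since \<open>B\<close> preserves inner products, the second factor may be read
      before or after applying it; the Schur product thus becomes a difference of two squared
      norms.\<close>
    have "fip (\<lambda>x y. K x y * cinner (snd x) (snd y)) p p
      = of_real ((norm A)\<^sup>2) * cinner ?r ?r - cinner ?l ?l"
      using B unfolding cinner_lincomb
      by (simp add: fip_eq K_def right_diff_distrib left_diff_distrib sum_list_subtractf mult_ac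
          case_prod_unfold cinner_htensor isometry_def flip: sum_list_const_mult)
    then have "0 \<le> (norm A)\<^sup>2 * (norm ?r)\<^sup>2 - (norm ?l)\<^sup>2"
      using pos[of p] by (simp add: cinner_self)
    then show "(norm ?l)\<^sup>2 \<le> (norm A * norm ?r)\<^sup>2" by (simp add: power_mult_distrib)
  qed simp
  from operator_from_family[OF total_htensor this] show ?thesis by auto
qed

lemma add_in_bop: "S \<in> bop \<Longrightarrow> T \<in> bop \<Longrightarrow> S + T \<in> bop"
  using csubspace_bop unfolding csubspace_def by blast

definition op_tensor ::
  "('a :: hilbert_space \<Rightarrow>\<^sub>L 'b :: hilbert_space) \<Rightarrow> ('c :: hilbert_space \<Rightarrow>\<^sub>L 'd :: hilbert_space) \<Rightarrow>
    ('a, 'c) htensor \<Rightarrow>\<^sub>L ('b, 'd) htensor" where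
  "op_tensor A B = (SOME T. T \<in> bop \<and> (\<forall>u v. blinfun_apply T (u \<otimes>\<^sub>H v) = A u \<otimes>\<^sub>H B v))"

lemma op_tensor:
  assumes "A \<in> bop" "isometry B"
  shows op_tensor_bop: "op_tensor A B \<in> bop"
    and op_tensor_apply: "op_tensor A B (u \<otimes>\<^sub>H v) = A u \<otimes>\<^sub>H B v"
proof -
  have "op_tensor A B \<in> bop \<and> (\<forall>u v. blinfun_apply (op_tensor A B) (u \<otimes>\<^sub>H v) = A u \<otimes>\<^sub>H B v)"
    unfolding op_tensor_def
    by (rule someI_ex) (use op_tensor_exists[OF assms] in blast)
  then show "op_tensor A B \<in> bop" "op_tensor A B (u \<otimes>\<^sub>H v) = A u \<otimes>\<^sub>H B v" by auto
qed

lemma bop_htensor_eqI: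
  assumes "S \<in> bop" "T \<in> bop" "\<And>u v. blinfun_apply S (u \<otimes>\<^sub>H v) = blinfun_apply T (u \<otimes>\<^sub>H v)"
  shows "S = T"
  by (rule total_bop_eqI[OF total_htensor assms(1,2)]) (use assms(3) in auto)

lemma isometry_compose: "isometry S \<Longrightarrow> isometry T \<Longrightarrow> isometry (S o\<^sub>L T)"
  by (auto simp: isometry_def compose_bop)

lemma op_tensor_compose:
  "A \<in> bop \<Longrightarrow> A' \<in> bop \<Longrightarrow> isometry B \<Longrightarrow> isometry B' \<Longrightarrow>
    op_tensor A B o\<^sub>L op_tensor A' B' = op_tensor (A o\<^sub>L A') (B o\<^sub>L B')"
  by (rule bop_htensor_eqI) (auto simp: op_tensor_apply op_tensor_bop compose_bop isometry_compose)

text \<open>The adjoint of \<open>B\<close> is assumed isometric too, so that the right-hand side is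
  an instance of the specification of \<open>op_tensor\<close>; for Weyl operators this holds
  because their adjoints are Weyl operators.\<close>

lemma op_tensor_adj:
  assumes "A \<in> bop" "isometry B" "isometry (adj B)"
  shows "adj (op_tensor A B) = op_tensor (adj A) (adj B)"
proof (rule bop_htensor_eqI)
  fix u v
  show "adj (op_tensor A B) (u \<otimes>\<^sub>H v) = op_tensor (adj A) (adj B) (u \<otimes>\<^sub>H v)"
    using assms
    by (intro total_cinner_eqI[OF total_htensor])
      (auto simp: cinner_htensor op_tensor_apply adj_bop cinner_adj isometry_def
        simp flip: cinner_adj[OF op_tensor_bop])
qed (use assms in \<open>auto intro: adj_bop op_tensor_bop\<close>)

lemma op_tensor_id: "op_tensor id_blinfun id_blinfun = id_blinfun"
  by (rule bop_htensor_eqI) (auto simp: op_tensor_apply op_tensor_bop id_blinfun_bop isometry_def)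

lemma clinear_on_op_tensor:
  assumes "S \<subseteq> bop" "csubspace S" "isometry B"
  shows "clinear_on S (\<lambda>A. op_tensor A B)"
  unfolding clinear_on_def
proof (intro conjI allI ballI)
  fix A A' assume A: "A \<in> S" "A' \<in> S"
  then have *: "A \<in> bop" "A' \<in> bop" "A + A' \<in> bop"
    using assms by (auto simp: csubspace_def)
  show "op_tensor (A + A') B = op_tensor A B + op_tensor A' B"
    by (rule bop_htensor_eqI)
      (use * assms(3) in \<open>auto simp: op_tensor_apply op_tensor_bop blinfun.add_left
        htensor.add_left add_in_bop\<close>)
next
  fix a A assume A: "A \<in> S"
  then have *: "A \<in> bop" "a *\<^sub>C A \<in> bop" using assms by (auto simp: csubspace_def)
  show "op_tensor (a *\<^sub>C A) B = a *\<^sub>C op_tensor A B"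
    by (rule bop_htensor_eqI)
      (use * assms(3) in \<open>auto simp: op_tensor_apply op_tensor_bop scaleC_blinfun.rep_eq
        htensor_scaleC_left scaleC_in_bop\<close>)
qed


section \<open>Weyl operators\<close>

lemma kvec_SymPow_scaleR: "kvec (SymPow n (s *\<^sub>R f)) = s ^ n *\<^sub>R kvec (SymPow n f)"
  by (rule total_cinner_eqI[OF total_kvec])
    (simp add: cinner_kvec kern_sympow_def cinner.scaleR_right scaleR_power)

text \<open>The \<open>n\<close>-particle vector \<open>f\<^bsup>\<otimes>n\<^esup>\<close> is, up to a scalar, the limit for \<open>s \<rightarrow> 0\<close> of the \<open>n\<close>-th Taylor
  remainder of \<open>s \<mapsto> expvec (s f)\<close>.\<close>

lemma total_expvec: "total (expvec :: 'a :: hilbert_space \<Rightarrow> 'a fock)"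
proof -
  define V where "V = closure (cspan (range (expvec :: 'a \<Rightarrow> 'a fock)))"
  have V: "csubspace V" "closed V"
    unfolding V_def by (auto intro: csubspace_closure csubspace_cspan)
  have exp_V: "expvec f \<in> V" for f
    unfolding V_def using closure_subset cspan_superset[of "range expvec"] by blast
  have sym: "kvec (SymPow n f) \<in> V" for n f
  proof -
    define a where "a n = (1 / sqrt (fact n)) *\<^sub>R kvec (SymPow n f)" for n
    have a_s: "(1 / sqrt (fact n)) *\<^sub>R kvec (SymPow n (s *\<^sub>R f)) = s ^ n *\<^sub>R a n" for n s
      by (simp add: a_def kvec_SymPow_scaleR)
    have sums: "(\<lambda>n. s ^ n *\<^sub>R a n) sums expvec (s *\<^sub>R f)" for s
      using summable_sums[OF summable_expvec[of "s *\<^sub>R f"]] by (simp add: expvec_def a_s)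
    \<comment> \<open>Convergence at \<open>s = 2\<close> forces geometric decay of the coefficients
      \<open>a n\<close>, which controls the remainders uniformly for
      \<open>s \<le> 1\<close>.\<close>
    obtain B where B: "\<And>n. norm (2 ^ n *\<^sub>R a n) \<le> B"
      using summable_imp_Bseq[OF sums_summable[OF sums[of 2]]] by (auto simp: Bseq_def)
    have a_le: "norm (a n) \<le> B * (1 / 2) ^ n" for n
      using B[of n] by (simp add: field_simps power_one_over)
    have "0 \<le> B" using order_trans[OF norm_ge_zero B[of 0]] .
    have a_V: "a n \<in> V" for n
    proof (induction n rule: less_induct)
      case (less n)
      define r where "r s = (inverse s) ^ n *\<^sub>R (expvec (s *\<^sub>R f) - (\<Sum>m<n. s ^ m *\<^sub>R a m))" for s :: real
      have r_V: "r s \<in> V" for s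
        unfolding r_def using less
        by (intro csubspace_scaleR csubspace_diff csubspace_sum V exp_V) auto
      have r_a: "norm (r s - a n) \<le> s * (2 * B)" if s: "0 < s" "s \<le> 1" for s
      proof -
        have "(\<lambda>k. s ^ (k + n) *\<^sub>R a (k + n)) sums (expvec (s *\<^sub>R f) - (\<Sum>m<n. s ^ m *\<^sub>R a m))"
          using sums_iff_shift'[of "\<lambda>k. s ^ k *\<^sub>R a k"] sums[of s] by blast
        from sums_scaleR_right[OF this, of "(inverse s) ^ n"]
        have "(\<lambda>k. s ^ k *\<^sub>R a (k + n)) sums r s"
          using s by (simp add: r_def power_add field_simps)
        \<comment> \<open>The term with \<open>k = 0\<close> is \<open>a n\<close>; removing it
          leaves a series divisible by \<open>s\<close>.\<close>
        then have 1: "(\<lambda>k. s ^ Suc k *\<^sub>R a (Suc k + n)) sums (r s - a n)"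
          by (subst sums_Suc_iff) simp
        have 2: "(\<lambda>k. s * (B * (1 / 2) ^ k)) sums (s * (B * 2))"
          by (intro sums_mult) (use geometric_sums[of "1 / 2 :: real"] in simp)
        have le: "norm (s ^ Suc k *\<^sub>R a (Suc k + n)) \<le> s * (B * (1 / 2) ^ k)" for k
        proof -
          have "norm (a (Suc k + n)) \<le> B * (1 / 2) ^ (Suc k + n)" by (rule a_le)
          also have "\<dots> \<le> B * (1 / 2) ^ k"
            using \<open>0 \<le> B\<close> by (intro mult_left_mono power_decreasing) auto
          finally have "s ^ Suc k * norm (a (Suc k + n)) \<le> s ^ 1 * (B * (1 / 2) ^ k)"
            using s \<open>0 \<le> B\<close> by (intro mult_mono power_decreasing) auto
          with s show ?thesis by simp
        qed
        have "norm (suminf (\<lambda>k. s ^ Suc k *\<^sub>R a (Suc k + n))) \<le> suminf (\<lambda>k. s * (B * (1 / 2) ^ k))"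
          using le by (intro suminf_le order_trans[OF summable_norm]
              summable_comparison_test[OF _ sums_summable[OF 2]] sums_summable[OF 2])
            (auto intro!: exI[of _ 0] summable_comparison_test[OF _ sums_summable[OF 2]])
        then show ?thesis using 1 2 by (simp add: sums_iff mult.commute)
      qed
      have "(\<lambda>k. r (inverse (real (Suc k))) - a n) \<longlonglongrightarrow> 0"
      proof (rule Lim_null_comparison)
        show "(\<lambda>k. inverse (real (Suc k)) * (2 * B)) \<longlonglongrightarrow> 0"
          by (intro tendsto_mult_left_zero LIMSEQ_inverse_real_of_nat)
        show "\<forall>\<^sub>F k in sequentially. norm (r (inverse (real (Suc k))) - a n) \<le> inverse (real (Suc k)) * (2 * B)"
          by (intro always_eventually allI r_a) (auto simp: field_simps)
      qed
      then have "(\<lambda>k. r (inverse (real (Suc k)))) \<longlonglongrightarrow> a n" by (simp add: LIM_zero_iff)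
      then show ?case by (rule closed_sequentially[OF V(2) r_V])
    qed
    have "kvec (SymPow n f) = sqrt (fact n) *\<^sub>R a n" by (simp add: a_def)
    with a_V V(1) show ?thesis by (simp add: csubspace_scaleR)
  qed
  have "x \<in> V" for x
    using total_kvec by (rule total_induct) (use V sym in \<open>auto, metis sympow.collapse\<close>)
  then show ?thesis by (auto simp: total_def V_def)
qed

definition weyl :: "'a :: hilbert_space \<Rightarrow> 'a fock \<Rightarrow>\<^sub>L 'a fock" where
  "weyl f = (SOME T. isometry T \<and>
    (\<forall>g. blinfun_apply T (expvec g) = exp (- of_real ((norm f)\<^sup>2) / 2 - cinner f g) *\<^sub>C expvec (f + g)))"

text \<open>The prefactors contribute - ||f||^2 - <g, f> - <f, h> to the exponent and cancel all
  terms of <f + g, f + h> except <g, h>, so the Gram kernel of exponential vectors is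
  preserved.\<close>

lemma weyl: "isometry (weyl f)"
  "weyl f (expvec g) = exp (- of_real ((norm f)\<^sup>2) / 2 - cinner f g) *\<^sub>C expvec (f + g)"
proof -
  let ?e = "\<lambda>g. exp (- of_real ((norm f)\<^sup>2) / 2 - cinner f g) *\<^sub>C expvec (f + g)"
  have "cinner (?e g) (?e h) = cinner (expvec g) (expvec h)" for g h
    by (simp add: cinner_scaleC_left cinner_scaleC_right cinner_expvec cinner_add_left cinner_add_right
        cinner_self exp_cnj flip: exp_add cinner_commute)
  from isometry_from_family[of expvec ?e, OF total_expvec this]
  have "\<exists>T. isometry T \<and> (\<forall>g. blinfun_apply T (expvec g) = ?e g)" .
  from someI_ex[OF this] show "isometry (weyl f)" "weyl f (expvec g) = ?e g"
    unfolding weyl_def by auto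
qed

lemma weyl_bop: "weyl f \<in> bop"
  using weyl(1)[of f] by (simp add: isometry_def)

lemma weyl_zero: "weyl 0 = id_blinfun"
  by (rule total_bop_eqI[OF total_expvec weyl_bop id_blinfun_bop]) (simp add: weyl)

lemma weyl_adj: "adj (weyl f) = weyl (- f)"
proof (rule total_bop_eqI[OF total_expvec])
  fix g :: 'a
  show "adj (weyl f) (expvec g) = weyl (- f) (expvec g)"
    by (rule total_cinner_eqI[OF total_expvec])
      (simp add: weyl cinner_adj[OF weyl_bop, symmetric] cinner_scaleC_left cinner_scaleC_right
        cinner_expvec exp_cnj cinner_add_left cinner.add_right cinner.diff_right cinner.minus_left cinner.minus_right
        algebra_simps flip: exp_add cinner_commute)
qed (auto intro: weyl_bop adj_bop)

text \<open>In general the product carries the phase exp(- i Im <f, g>), which is 1 when the inner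
  product is real.\<close>

lemma weyl_compose:
  assumes "cinner f g \<in> \<real>"
  shows "weyl f o\<^sub>L weyl g = weyl (f + g)"
proof (rule total_bop_eqI[OF total_expvec])
  fix h :: 'a
  obtain r where r: "cinner f g = of_real r" using assms by (auto elim: Reals_cases)
  have "cinner g f = of_real r" by (subst cinner_commute) (simp add: r)
  then have "of_real ((norm (f + g))\<^sup>2) = of_real ((norm f)\<^sup>2) + of_real ((norm g)\<^sup>2) + 2 * (of_real r :: complex)"
    unfolding cinner_self[symmetric] by (simp add: cinner_add_left cinner_add_right r)
  then show "(weyl f o\<^sub>L weyl g) (expvec h) = weyl (f + g) (expvec h)"
    by (auto simp: weyl bop_scaleC[OF weyl_bop] scaleC_scaleC cinner_add_left cinner_add_right r
        add.assoc field_simps simp flip: exp_add intro!: arg_cong2[of _ _ _ _ scaleC] arg_cong[of _ _ exp])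
qed (auto intro: weyl_bop compose_bop)

text \<open>Expanding ||expvec x - expvec y||^2 leaves four exponentials of inner products, whose
  limits cancel.\<close>

lemma continuous_on_expvec: "continuous_on S (expvec :: 'a :: hilbert_space \<Rightarrow> _)"
proof -
  have "(\<lambda>n. expvec (x n)) \<longlonglongrightarrow> expvec y" if x: "x \<longlonglongrightarrow> y" for x :: "nat \<Rightarrow> 'a" and y
  proof -
    have "(norm (expvec (x n) - expvec y))\<^sup>2 =
        Re (exp (cinner (x n) (x n)) - exp (cinner (x n) y) - exp (cinner y (x n)) + exp (cinner y y))" for n
      unfolding power2_norm_eq_inner Re_cinner[symmetric]
      by (simp add: cinner_diff_left cinner_diff_right cinner_expvec)
    moreover have "(\<lambda>n. Re (exp (cinner (x n) (x n)) - exp (cinner (x n) y) - exp (cinner y (x n))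
        + exp (cinner y y))) \<longlonglongrightarrow> Re (exp (cinner y y) - exp (cinner y y) - exp (cinner y y) + exp (cinner y y))"
      by (intro tendsto_intros cinner.tendsto x)
    ultimately have "(\<lambda>n. (norm (expvec (x n) - expvec y))\<^sup>2) \<longlonglongrightarrow> 0" by simp
    then have "(\<lambda>n. norm (expvec (x n) - expvec y)) \<longlonglongrightarrow> 0"
      using tendsto_real_sqrt by fastforce
    then show ?thesis by (simp add: LIM_zero_iff tendsto_norm_zero_iff)
  qed
  then show ?thesis
    by (intro continuous_at_imp_continuous_on) (auto simp: continuous_at_sequentially o_def)
qed


section \<open>Step functions\<close>

lemma Lstep_indicator: "0 \<le> a \<Longrightarrow> (\<lambda>s. indicat_real {a..<b} s *\<^sub>R z) \<in> Lstep"
  unfolding Lstep_def by (intro CollectI exI[of _ "1 :: nat"] exI[of _ "\<lambda>_. a"] exI[of _ "\<lambda>_. b"]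
      exI[of _ "\<lambda>_. z"]) auto

lemma Lstep_zero: "(\<lambda>_. 0) \<in> Lstep"
  unfolding Lstep_def by (intro CollectI exI[of _ "0 :: nat"]) auto

lemma Lstep_add:
  assumes "f \<in> Lstep" "g \<in> Lstep"
  shows "(\<lambda>s. f s + g s) \<in> Lstep"
proof -
  obtain m a b z where f: "\<And>i. i < (m :: nat) \<Longrightarrow> 0 \<le> a i"
    "f = (\<lambda>t. \<Sum>i<m. indicat_real {a i..<b i} t *\<^sub>R z i)"
    using assms(1) by (auto simp: Lstep_def)
  obtain m' a' b' z' where g: "\<And>i. i < (m' :: nat) \<Longrightarrow> 0 \<le> a' i"
    "g = (\<lambda>t. \<Sum>i<m'. indicat_real {a' i..<b' i} t *\<^sub>R z' i)"
    using assms(2) by (auto simp: Lstep_def)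
  define A where "A i = (if i < m then a i else a' (i - m))" for i
  define B where "B i = (if i < m then b i else b' (i - m))" for i
  define Y where "Y i = (if i < m then z i else z' (i - m))" for i
  have "(\<lambda>s. f s + g s) = (\<lambda>t. \<Sum>i<m + m'. indicat_real {A i..<B i} t *\<^sub>R Y i)"
  proof
    fix t
    let ?h = "\<lambda>i. indicat_real {A i..<B i} t *\<^sub>R Y i"
    have "(\<Sum>i<m + m'. ?h i) = (\<Sum>i<m. ?h i) + (\<Sum>i<m'. ?h (m + i))"
      using sum.atLeastLessThan_concat[of 0 m "m + m'" ?h]
        sum.shift_bounds_nat_ivl[of ?h 0 m m'] by (simp add: atLeast0LessThan add.commute)
    then show "f t + g t = (\<Sum>i<m + m'. ?h i)"
      unfolding f g by (simp add: A_def B_def Y_def)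
  qed
  moreover have "0 \<le> A i" if "i < m + m'" for i using f(1) g(1) that by (auto simp: A_def)
  ultimately show ?thesis unfolding Lstep_def by blast
qed

lemma Lstep_induct [consumes 1, case_names zero add]:
  assumes "f \<in> Lstep" "P (\<lambda>_. 0)"
    "\<And>f a b z. f \<in> Lstep \<Longrightarrow> 0 \<le> a \<Longrightarrow> P f \<Longrightarrow> P (\<lambda>s. f s + indicat_real {a..<b} s *\<^sub>R z)"
  shows "P f"
proof -
  obtain m a b z where f: "\<And>i. i < (m :: nat) \<Longrightarrow> 0 \<le> a i"
    "f = (\<lambda>t. \<Sum>i<m. indicat_real {a i..<b i} t *\<^sub>R z i)"
    using assms(1) by (auto simp: Lstep_def)
  have "(\<lambda>t. \<Sum>i<k. indicat_real {a i..<b i} t *\<^sub>R z i) \<in> Lstep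
      \<and> P (\<lambda>t. \<Sum>i<k. indicat_real {a i..<b i} t *\<^sub>R z i)" if "k \<le> m" for k
    using that
  proof (induction k)
    case (Suc k)
    let ?h = "\<lambda>t. \<Sum>i<k. indicat_real {a i..<b i} t *\<^sub>R z i"
    have "0 \<le> a k" "?h \<in> Lstep" "P ?h" using Suc f(1) by auto
    then show ?case
      unfolding sum.lessThan_Suc by (intro conjI assms(3) Lstep_add Lstep_indicator)
  qed (use assms(2) Lstep_zero in auto)
  then show ?thesis using f(2) by blast
qed

lemma indicat_inter:
  "indicat_real A s *\<^sub>R (indicat_real B s *\<^sub>R (z :: 'a :: real_vector)) = indicat_real (A \<inter> B) s *\<^sub>R z"
  by (auto simp: indicator_def)

lemma Lstep_before: "f \<in> Lstep \<Longrightarrow> before t f \<in> Lstep"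
proof (induction f rule: Lstep_induct)
  case zero
  then show ?case using Lstep_zero by (simp add: before_def)
next
  case (add f a b z)
  have "{0..<t} \<inter> {a..<b} = {a..<min t b}" using \<open>0 \<le> a\<close> by auto
  then show ?case
    using Lstep_add[OF add.IH Lstep_indicator[OF \<open>0 \<le> a\<close>, of "min t b" z]]
    by (simp add: before_def scaleR_add_right indicat_inter del: scaleR_scaleR)
qed

lemma Lstep_after: "f \<in> Lstep \<Longrightarrow> 0 \<le> t \<Longrightarrow> after t f \<in> Lstep"
proof (induction f rule: Lstep_induct)
  case zero
  then show ?case using Lstep_zero by (simp add: after_def)
next
  case (add f a b z)
  have "{t..} \<inter> {a..<b} = {max t a..<b}" by auto
  then show ?case
    using Lstep_add[OF add.IH[OF add.prems] Lstep_indicator[of "max t a" b z]] add.prems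
    by (simp add: after_def scaleR_add_right indicat_inter del: scaleR_scaleR)
qed

lemma before_add_after: "f \<in> Lstep \<Longrightarrow> 0 \<le> t \<Longrightarrow> (\<lambda>s. before t f s + after t f s) = f"
proof
  fix s assume f: "f \<in> Lstep" "0 \<le> t"
  \<comment> \<open>The pieces before and after \<open>t\<close> only cover nonnegative times, so
    vanishing at negative times is required here.\<close>
  have "f s = 0" if "s < 0"
    using f(1) that by (induction f rule: Lstep_induct) (auto simp: indicator_def)
  then show "before t f s + after t f s = f s"
    using f(2) by (auto simp: before_def after_def indicator_def not_le)
qed

section \<open>Step functions as vectors of the one-particle space, and pulses on [0,t)\<close>

definition pulse :: "real \<Rightarrow> complex ^ 'n :: finite \<Rightarrow> real \<Rightarrow> complex ^ 'n" where
  "pulse t \<xi> = before t (\<lambda>_. \<xi>)"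

lemma Lstep_pulse: "pulse t \<xi> \<in> Lstep"
  using Lstep_indicator[of 0] by (simp add: pulse_def before_def)

lemma cinner_l2:
  assumes "f \<in> Lstep" "g \<in> Lstep"
  shows "cinner (l2 f) (l2 g) = (LINT s:{0..}|lborel. cinner (f s) (g s))"
  using assms by (simp add: l2_def cinner_kvec kern_sqint_def Rep_Abs_sqint)

text \<open>\<open>l2\<close> passes through \<open>Abs_sqint\<close> and formal generators, so
  additivity is tested against all generators. Membership in \<open>Lstep\<close> ensures that
  \<open>Abs_sqint\<close> loses nothing.\<close>

lemma l2_add:
  fixes f g :: "real \<Rightarrow> complex ^ 'n :: finite"
  assumes "f \<in> Lstep" "g \<in> Lstep"
  shows "l2 (\<lambda>s. f s + g s) = l2 f + l2 g"
proof (rule total_cinner_eqI[OF total_kvec])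
  fix h :: "'n sqint"
  have "cinner (kvec h) (l2 f) = (LINT s:{0..}|lborel. cinner (Rep_sqint h s) (f s))"
    "set_integrable lborel {0..} (\<lambda>s. cinner (Rep_sqint h s) (f s))" if "f \<in> Lstep"
    for f :: "real \<Rightarrow> complex ^ 'n"
    using that sqint_integrable[of h "Abs_sqint f"]
    by (simp_all add: l2_def cinner_kvec kern_sqint_def Rep_Abs_sqint)
  with assms Lstep_add[OF assms]
  show "cinner (kvec h) (l2 (\<lambda>s. f s + g s)) = cinner (kvec h) (l2 f + l2 g)"
    by (simp add: cinner_add_right set_integral_add)
qed

lemma l2_zero: "l2 (\<lambda>_. 0) = 0"
  using l2_add[OF Lstep_zero Lstep_zero] by simp

lemma cinner_l2_before_after:
  assumes "f \<in> Lstep" "g \<in> Lstep" "0 \<le> t"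
  shows "cinner (l2 (before t f)) (l2 (after t g)) = 0"
proof -
  have "cinner (before t f s) (after t g s) = 0" for s
    by (auto simp: before_def after_def indicator_def)
  then show ?thesis by (simp add: cinner_l2 Lstep_before Lstep_after assms)
qed

lemma l2_before_after:
  assumes "f \<in> Lstep" "0 \<le> t"
  shows "l2 f = l2 (before t f) + l2 (after t f)"
  using l2_add[OF Lstep_before[OF assms(1), of t] Lstep_after[OF assms]] before_add_after[OF assms]
  by simp

lemma cinner_l2_split:
  assumes "f \<in> Lstep" "g \<in> Lstep" "0 \<le> t"
  shows "cinner (l2 f) (l2 g) =
    cinner (l2 (before t f)) (l2 (before t g)) + cinner (l2 (after t f)) (l2 (after t g))"
proof -
  have "cinner (l2 (after t f)) (l2 (before t g)) = 0"
    by (subst cinner_commute) (simp add: cinner_l2_before_after assms)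
  then show ?thesis
    using assms
    by (simp add: l2_before_after[of f t] l2_before_after[of g t] cinner_add_left cinner_add_right
        cinner_l2_before_after)
qed

lemma pulse_add: "l2 (pulse t (\<xi> + \<zeta>)) = l2 (pulse t \<xi>) + l2 (pulse t \<zeta>)"
  using l2_add[OF Lstep_pulse[of t \<xi>] Lstep_pulse[of t \<zeta>]]
  by (simp add: pulse_def before_def scaleR_add_right)

lemma pulse_zero: "l2 (pulse t 0) = 0" "l2 (pulse 0 \<xi>) = 0"
  using l2_zero by (simp_all add: pulse_def before_def)

lemma pulse_minus: "l2 (pulse t (- \<xi>)) = - l2 (pulse t \<xi>)"
  using pulse_add[of t \<xi> "- \<xi>"] by (simp add: pulse_zero add_eq_0_iff)

text \<open>The last two identities say that a pulse sees only the past of \<open>f\<close>; they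
  are the source of adaptedness.\<close>

lemma cinner_pulse_l2:
  assumes "f \<in> Lstep" "0 \<le> t"
  shows "cinner (l2 (pulse t \<xi>)) (l2 f) = (LINT s:{0..<t}|lborel. cinner \<xi> (f s))"
    and "cinner (l2 (pulse t \<xi>)) (l2 f) = cinner (l2 (pulse t \<xi>)) (l2 (before t f))"
    and "cinner (l2 f) (l2 (pulse t \<xi>)) = cinner (l2 (before t f)) (l2 (pulse t \<xi>))"
proof -
  have "indicat_real {0..} s *\<^sub>R cinner (pulse t \<xi> s) (f s) = indicat_real {0..<t} s *\<^sub>R cinner \<xi> (f s)" for s
    by (auto simp: pulse_def before_def indicator_def)
  then show "cinner (l2 (pulse t \<xi>)) (l2 f) = (LINT s:{0..<t}|lborel. cinner \<xi> (f s))"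
    by (simp add: cinner_l2 Lstep_pulse assms set_lebesgue_integral_def)
  have "before t (pulse t \<xi>) = pulse t \<xi>" "after t (pulse t \<xi>) = (\<lambda>_. 0)"
    by (auto simp: pulse_def before_def after_def indicator_def)
  then show "cinner (l2 (pulse t \<xi>)) (l2 f) = cinner (l2 (pulse t \<xi>)) (l2 (before t f))"
    "cinner (l2 f) (l2 (pulse t \<xi>)) = cinner (l2 (before t f)) (l2 (pulse t \<xi>))"
    using cinner_l2_split[OF Lstep_pulse assms, of t \<xi>] cinner_l2_split[OF assms(1) Lstep_pulse assms(2), of t \<xi>]
    by (simp_all add: l2_zero)
qed

lemma cinner_pulse_pulse:
  assumes "0 \<le> s" "0 \<le> t"
  shows "cinner (l2 (pulse s \<xi>)) (l2 (pulse t \<zeta>)) = of_real (min s t) * cinner \<xi> \<zeta>"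
proof -
  have "cinner (l2 (pulse s \<xi>)) (l2 (pulse t \<zeta>)) = (LINT r:{0..<s}|lborel. cinner \<xi> (pulse t \<zeta> r))"
    by (rule cinner_pulse_l2(1)[OF Lstep_pulse assms(1)])
  also have "\<dots> = (LINT r:{0..<min s t}|lborel. cinner \<xi> \<zeta>)"
    unfolding set_lebesgue_integral_def
    by (rule Bochner_Integration.integral_cong) (auto simp: pulse_def before_def indicator_def)
  also have "\<dots> = of_real (min s t) * cinner \<xi> \<zeta>"
    using assms by (simp add: set_integral_const scaleR_conv_of_real)
  finally show ?thesis .
qed

section \<open>Right-continuous, locally bounded functions\<close>

text \<open>Left limits are not demanded. Right-continuity gives explicit approximation by simple
  functions even for vector values, and local boundedness gives integrability of every power of the
  norm on bounded intervals.\<close>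

definition regulated :: "(real \<Rightarrow> 'a :: real_normed_vector) \<Rightarrow> bool" where
  "regulated F \<longleftrightarrow> (\<forall>t\<ge>0. (F \<longlongrightarrow> F t) (at_right t)) \<and> (\<forall>T. bounded (F ` {0..T}))"

lemma regulated_cong:
  assumes "regulated F" "\<And>t. 0 \<le> t \<Longrightarrow> F t = G t"
  shows "regulated G"
  unfolding regulated_def
proof (intro conjI allI impI)
  fix t :: real assume t: "0 \<le> t"
  have "(F \<longlongrightarrow> F t) (at_right t)" using assms(1) t by (simp add: regulated_def)
  then have "(G \<longlongrightarrow> F t) (at_right t)"
    by (rule Lim_transform_eventually)
      (use assms(2) t in \<open>auto intro!: eventually_mono[OF eventually_at_right_less[of t]]\<close>)
  then show "(G \<longlongrightarrow> G t) (at_right t)" using assms(2)[OF t] by simp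
next
  fix T
  have "G ` {0..T} = F ` {0..T}" using assms(2) by (intro image_cong) auto
  then show "bounded (G ` {0..T})" using assms(1) by (simp add: regulated_def)
qed

lemma regulated_continuous:
  assumes "continuous_on {0..} F"
  shows "regulated F"
  unfolding regulated_def
proof (intro conjI allI impI)
  fix t :: real assume "0 \<le> t"
  then have "(F \<longlongrightarrow> F t) (at t within {0..})" using assms by (auto simp: continuous_on)
  moreover have "{t<..} \<subseteq> {0..}" using \<open>0 \<le> t\<close> by auto
  ultimately show "(F \<longlongrightarrow> F t) (at_right t)" by (rule tendsto_within_subset)
next
  fix T :: real
  have "continuous_on {0..T} F" using assms by (rule continuous_on_subset) auto
  then show "bounded (F ` {0..T})"
    by (intro compact_imp_bounded compact_continuous_image) auto
qed

lemma regulated_const [simp]: "regulated (\<lambda>_. c)"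
  by (rule regulated_continuous) simp

lemma regulated_add: "regulated F \<Longrightarrow> regulated G \<Longrightarrow> regulated (\<lambda>t. F t + G t)"
  unfolding regulated_def by (auto intro: tendsto_add bounded_plus_comp)

lemma regulated_sum: "(\<And>i. i \<in> I \<Longrightarrow> regulated (F i)) \<Longrightarrow> regulated (\<lambda>t. \<Sum>i\<in>I. F i t)"
  by (induction I rule: infinite_finite_induct) (auto intro: regulated_add)

lemma regulated_bilinear:
  assumes "bounded_bilinear pr" "regulated F" "regulated G"
  shows "regulated (\<lambda>t. pr (F t) (G t))"
  unfolding regulated_def
proof (intro conjI allI impI)
  interpret bounded_bilinear pr by fact
  fix t :: real assume "0 \<le> t"
  then show "((\<lambda>t. pr (F t) (G t)) \<longlongrightarrow> pr (F t) (G t)) (at_right t)"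
    using assms(2,3) unfolding regulated_def by (intro tendsto) auto
next
  interpret bounded_bilinear pr by fact
  fix T :: real
  obtain A B where A: "0 < A" "\<And>t. t \<in> {0..T} \<Longrightarrow> norm (F t) \<le> A"
    and B: "0 < B" "\<And>t. t \<in> {0..T} \<Longrightarrow> norm (G t) \<le> B"
    using assms(2,3) unfolding regulated_def bounded_pos by (metis imageI)
  obtain K where K: "0 < K" "\<And>a b. norm (pr a b) \<le> norm a * norm b * K"
    using pos_bounded by blast
  show "bounded ((\<lambda>t. pr (F t) (G t)) ` {0..T})"
    unfolding bounded_iff
  proof (intro exI[of _ "A * B * K"] ballI, elim imageE, hypsubst)
    fix t assume "t \<in> {0..T}"
    then have "norm (F t) * norm (G t) * K \<le> A * B * K"
      using A B K(1) by (intro mult_mono) auto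
    with K(2) show "norm (pr (F t) (G t)) \<le> A * B * K" by (rule order_trans)
  qed
qed

lemma regulated_linear:
  assumes "bounded_linear T" "regulated F"
  shows "regulated (\<lambda>t. T (F t))"
  using assms bounded_linear.tendsto bounded_linear_image[OF _ assms(1)]
  unfolding regulated_def by (metis image_image)

lemma bounded_linear_axis: "bounded_linear (axis i :: 'a :: real_normed_vector \<Rightarrow> 'a ^ 'n :: finite)"
proof (rule bounded_linear_intro[where K = 1])
  fix x y :: 'a and r
  show "axis i (x + y) = axis i x + (axis i y :: 'a ^ 'n)"
    and "axis i (r *\<^sub>R x) = r *\<^sub>R (axis i x :: 'a ^ 'n)"
    by (simp_all add: vec_eq_iff axis_def)
  have "norm (axis i x :: 'a ^ 'n) \<le> (\<Sum>j\<in>UNIV. norm ((axis i x :: 'a ^ 'n) $ j))"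
    unfolding norm_vec_def by (rule L2_set_le_sum) auto
  also have "\<dots> = (\<Sum>j\<in>UNIV. if j = i then norm x else 0)"
    by (rule sum.cong) (auto simp: axis_def)
  finally show "norm (axis i x :: 'a ^ 'n) \<le> norm x * 1" by simp
qed

lemma regulated_vec:
  assumes "\<And>i. regulated (\<lambda>t. F t $ i)"
  shows "regulated (F :: real \<Rightarrow> 'a :: real_normed_vector ^ 'n :: finite)"
proof -
  have "F t = (\<Sum>i\<in>UNIV. axis i (F t $ i))" for t
    by (simp add: vec_eq_iff axis_def)
  moreover have "regulated (\<lambda>t. \<Sum>i\<in>UNIV. axis i (F t $ i) :: 'a ^ 'n)"
    by (intro regulated_sum regulated_linear[OF bounded_linear_axis] assms)
  ultimately show ?thesis by (metis (no_types, lifting) ext)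
qed

lemma regulated_Lstep: "f \<in> Lstep \<Longrightarrow> regulated f"
proof (induction f rule: Lstep_induct)
  case (add f a b z)
  have "regulated (indicat_real {a..<b})"
    unfolding regulated_def
  proof (intro conjI allI impI)
    fix t :: real
    have "eventually (\<lambda>s. indicat_real {a..<b} s = indicat_real {a..<b} t) (at_right t)"
    proof (cases "t < a")
      case True
      then show ?thesis
        unfolding eventually_at_right[OF True] by (intro exI[of _ a]) (auto simp: indicator_def)
    next
      case ta: False
      show ?thesis
      proof (cases "t < b")
        case True
        then show ?thesis
          unfolding eventually_at_right[OF True] using ta by (intro exI[of _ b]) (auto simp: indicator_def)
      next
        case False
        then show ?thesis
          by (intro eventually_mono[OF eventually_at_right_less[of t]]) (auto simp: indicator_def)
      qed
    qed
    then show "(indicat_real {a..<b} \<longlongrightarrow> indicat_real {a..<b} t) (at_right t)"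
      by (rule tendsto_eventually)
    show "bounded (indicat_real {a..<b} ` {0..T})" for T
      by (rule boundedI[of _ 1]) (auto simp: indicator_def)
  qed
  then show ?case
    by (intro regulated_add add.IH regulated_bilinear[OF bounded_bilinear_scaleR] regulated_const)
qed simp

lemma regulated_hat: "f \<in> Lstep \<Longrightarrow> regulated (\<lambda>t. hat (f t) $ \<alpha>)"
  by (cases \<alpha>) (auto simp: hat_def intro: regulated_linear[OF bounded_linear_vec_nth regulated_Lstep])

text \<open>Sampling \<open>F\<close> at the grid point to the right of \<open>t\<close> gives simple functions converging to \<open>F\<close>.\<close>

lemma regulated_simple_limit:
  assumes "regulated F"
  shows "\<exists>s. (\<forall>i :: nat. simple_function (lebesgue_on {0..}) (s i)) \<and> (\<forall>t\<ge>0. (\<lambda>i. s i t) \<longlonglongrightarrow> F t)"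
proof -
  \<comment> \<open>The sample point \<open>r i (k i t)\<close> lies strictly to the right of
    \<open>t\<close>, within one mesh width, so right-continuity applies. The value -1 beyond time
    \<open>i\<close> keeps the range finite and corresponds to the sample point 0.\<close>
  define k :: "nat \<Rightarrow> real \<Rightarrow> int" where "k i t = (if t < real i then \<lfloor>t * real (Suc i)\<rfloor> else - 1)" for i t
  define r where "r i m = (of_int m + 1) / real (Suc i)" for i :: nat and m :: int
  define s where "s i = (\<lambda>m. F (r i m)) \<circ> k i" for i
  have "simple_function (lebesgue_on {0..}) (k i)" for i
    unfolding simple_function_eq_measurable
  proof
    have "k i ` space (lebesgue_on {0..}) \<subseteq> {- 1..\<lceil>real i * real (Suc i)\<rceil>}"
    proof clarify
      fix t :: real assume "t \<in> space (lebesgue_on {0..})"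
      then have t: "0 \<le> t" by simp
      have "0 \<le> t * real (Suc i)" "0 \<le> real i * real (Suc i)" using t by simp_all
      then have "- 1 \<le> \<lfloor>t * real (Suc i)\<rfloor>" "- 1 \<le> \<lceil>real i * real (Suc i)\<rceil>" by linarith+
      moreover have "\<lfloor>t * real (Suc i)\<rfloor> \<le> \<lceil>real i * real (Suc i)\<rceil>" if "t < real i"
      proof -
        have "t * real (Suc i) \<le> real i * real (Suc i)" using that by (intro mult_right_mono) auto
        then show ?thesis by linarith
      qed
      ultimately show "k i t \<in> {- 1..\<lceil>real i * real (Suc i)\<rceil>}"
        by (simp only: k_def atLeastAtMost_iff) (simp only: if_split_mem1 split: if_split; blast)
    qed
    then show "finite (k i ` space (lebesgue_on {0..}))" by (rule finite_subset) simp
    have "k i \<in> measurable borel (count_space UNIV)" unfolding k_def by measurable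
    then have "k i \<in> measurable lebesgue (count_space UNIV)"
      by (simp add: measurable_completion)
    then show "k i \<in> measurable (lebesgue_on {0..}) (count_space UNIV)"
      by (rule measurable_restrict_space1)
  qed
  then have "simple_function (lebesgue_on {0..}) (s i)" for i
    unfolding s_def by (rule simple_function_compose)
  moreover have "(\<lambda>i. s i t) \<longlonglongrightarrow> F t" if t: "0 \<le> t" for t
  proof -
    have r: "t < r i (k i t)" "r i (k i t) \<le> t + inverse (real (Suc i))" if "t < real i" for i
    proof -
      have "t * real (Suc i) < of_int (k i t) + 1" "of_int (k i t) \<le> t * real (Suc i)"
        using that by (simp_all add: k_def)
      then have "t < (of_int (k i t) + 1) / real (Suc i)" "of_int (k i t) / real (Suc i) \<le> t"
        by (simp_all add: less_divide_eq divide_le_eq del: of_nat_Suc)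
      then show "t < r i (k i t)" "r i (k i t) \<le> t + inverse (real (Suc i))"
        by (simp_all add: r_def add_divide_distrib inverse_eq_divide del: of_nat_Suc)
    qed
    obtain N :: nat where N: "t < real N" using reals_Archimedean2 by blast
    have ev: "eventually (\<lambda>i. t < real i) sequentially"
      by (intro eventually_sequentiallyI[of N]) (use N in linarith)
    have "(\<lambda>i. r i (k i t)) \<longlonglongrightarrow> t"
    proof (rule tendsto_sandwich)
      show "eventually (\<lambda>i. t \<le> r i (k i t)) sequentially"
        using ev by (rule eventually_mono) (use r less_imp_le in blast)
      show "eventually (\<lambda>i. r i (k i t) \<le> t + inverse (real (Suc i))) sequentially"
        using ev by (rule eventually_mono) (use r in blast)
      show "(\<lambda>i. t + inverse (real (Suc i))) \<longlonglongrightarrow> t"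
        using tendsto_add[OF tendsto_const LIMSEQ_inverse_real_of_nat, of t] by simp
    qed simp
    moreover have "\<forall>\<^sub>F i in sequentially. r i (k i t) \<in> {t<..} \<and> r i (k i t) \<noteq> t"
      using ev
    proof (rule eventually_mono)
      fix i assume "t < real i"
      from r(1)[OF this] show "r i (k i t) \<in> {t<..} \<and> r i (k i t) \<noteq> t" by simp
    qed
    ultimately have "filterlim (\<lambda>i. r i (k i t)) (at_right t) sequentially"
      by (simp add: filterlim_at)
    moreover have "(F \<longlongrightarrow> F t) (at_right t)" using assms t by (auto simp: regulated_def)
    ultimately show ?thesis
      unfolding s_def o_def by (rule filterlim_compose[rotated])
  qed
  ultimately show ?thesis by (intro exI[of _ s]) auto
qed

lemma regulated_strongly_measurable:
  assumes "regulated F"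
  shows "strongly_measurable F"
proof -
  obtain s where s: "\<And>i :: nat. simple_function (lebesgue_on {0..}) (s i)"
    "\<And>t. 0 \<le> t \<Longrightarrow> (\<lambda>i. s i t) \<longlonglongrightarrow> F t"
    using regulated_simple_limit[OF assms] by blast
  then show ?thesis
    unfolding strongly_measurable_def by (intro exI[of _ s] conjI allI AE_I2) auto
qed

lemma regulated_borel_measurable:
  fixes F :: "real \<Rightarrow> 'a :: euclidean_space"
  assumes "regulated F"
  shows "F \<in> borel_measurable (lebesgue_on {0..})"
proof -
  obtain s where s: "\<And>i :: nat. simple_function (lebesgue_on {0..}) (s i)"
    "\<And>t. 0 \<le> t \<Longrightarrow> (\<lambda>i. s i t) \<longlonglongrightarrow> F t"
    using regulated_simple_limit[OF assms] by blast
  show ?thesis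
    by (rule borel_measurable_LIMSEQ_metric[OF borel_measurable_simple_function[OF s(1)] s(2)]) simp
qed

lemma regulated_set_integrable:
  fixes F :: "real \<Rightarrow> 'a :: euclidean_space"
  assumes "regulated F"
  shows "set_integrable lebesgue {0..T} F"
proof -
  obtain B where B: "\<And>t. t \<in> {0..T} \<Longrightarrow> norm (F t) \<le> B"
    using assms unfolding regulated_def bounded_iff by (metis imageI)
  have "F \<in> borel_measurable (lebesgue_on {0..T})"
    using measurable_restrict_mono[OF regulated_borel_measurable[OF assms], of "{0..T}"] by simp
  then show ?thesis
    by (rule measurable_bounded_by_integrable_imp_absolutely_integrable[where g = "\<lambda>_. B"])
      (use B in auto)
qed

lemma regulated_norm:
  assumes "regulated F"
  shows "regulated (\<lambda>t. norm (F t))"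
  using assms unfolding regulated_def bounded_iff by (auto intro: tendsto_norm)

lemma regulated_power: "regulated F \<Longrightarrow> regulated (\<lambda>t. F t ^ p :: real)"
  by (induction p) (auto intro: regulated_bilinear[OF bounded_bilinear_mult])

lemma regulated_locally_integrable:
  assumes "regulated F"
  shows "locally_integrable_power p F"
  unfolding locally_integrable_power_def
  by (intro conjI allI impI regulated_strongly_measurable regulated_set_integrable regulated_power
      regulated_norm assms)


section \<open>Matrix elements of Weyl operators\<close>

lemma cinner_nexpvec:
  "cinner (nexpvec f) (nexpvec g) =
    exp (cinner f g - of_real ((norm f)\<^sup>2) / 2 - of_real ((norm g)\<^sup>2) / 2)"
  unfolding nexpvec_def
  by (simp add: cinner.scaleR_left cinner.scaleR_right cinner_expvec scaleR_conv_of_real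
      exp_of_real[symmetric] flip: exp_add; simp add: algebra_simps)

text \<open>Relative to \<open>cinner_nexpvec\<close>, the exponent gains only the terms containing
  \<open>p\<close>. When \<open>p\<close> is a pulse and \<open>f\<close>, \<open>g\<close> come
  from step functions, these are piecewise linear in time.\<close>

lemma cinner_weyl:
  "cinner (nexpvec f) (weyl p (nexpvec g)) =
    exp (cinner f p - cinner p g - of_real ((norm p)\<^sup>2) / 2 + cinner f g
      - of_real ((norm f)\<^sup>2) / 2 - of_real ((norm g)\<^sup>2) / 2)"
  unfolding nexpvec_def
  by (simp add: cinner.scaleR_left cinner.scaleR_right cinner_expvec scaleR_conv_of_real weyl
      blinfun.scaleR_right cinner_scaleC_right cinner_add_right exp_of_real[symmetric] flip: exp_add;
      simp add: algebra_simps)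

lemma norm_l2_split:
  assumes "f \<in> Lstep" "0 \<le> t"
  shows "(of_real ((norm (l2 f))\<^sup>2) :: complex) =
    of_real ((norm (l2 (before t f)))\<^sup>2) + of_real ((norm (l2 (after t f)))\<^sup>2)"
  using cinner_l2_split[OF assms(1,1,2)] by (simp only: cinner_self)

text \<open>The exponent is a sum of contributions from [0,t) and [t,\<infinity>), and the pulse
  contributes only to the first; this is adaptedness of the Weyl process.\<close>

lemma cinner_weyl_pulse:
  assumes "f \<in> Lstep" "g \<in> Lstep" "0 \<le> t"
  shows "cinner (varpi f) (weyl (l2 (pulse t \<xi>)) (varpi g)) =
    cinner (varpi (after t f)) (varpi (after t g)) *
    cinner (varpi (before t f)) (weyl (l2 (pulse t \<xi>)) (varpi (before t g)))"
proof -
  note p = cinner_pulse_l2(2)[OF assms(2,3), of \<xi>] cinner_pulse_l2(3)[OF assms(1,3), of \<xi>]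
  show ?thesis
    unfolding cinner_weyl cinner_nexpvec p cinner_l2_split[OF assms] norm_l2_split[OF assms(1,3)]
      norm_l2_split[OF assms(2,3)] exp_add[symmetric]
    by (rule arg_cong[of _ _ exp]) (simp add: field_simps)
qed

lemma norm_pulse:
  "0 \<le> t \<Longrightarrow> (of_real ((norm (l2 (pulse t \<xi>)))\<^sup>2) :: complex) = of_real (t * (norm \<xi>)\<^sup>2)"
  using cinner_pulse_pulse[of t t \<xi> \<xi>] by (simp add: cinner_self)

text \<open>Two pulses differ by \<xi> on an interval of length |t - s|, so the curve is Hoelder
  continuous with exponent 1/2.\<close>

lemma continuous_on_pulse: "continuous_on {0..} (\<lambda>t. l2 (pulse t \<xi>))"
  unfolding continuous_on_def
proof
  fix s :: real assume s: "s \<in> {0..}"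
  have dist: "norm (l2 (pulse t \<xi>) - l2 (pulse s \<xi>)) = sqrt \<bar>t - s\<bar> * norm \<xi>" if t: "0 \<le> t" for t
  proof -
    have "of_real ((norm (l2 (pulse t \<xi>) - l2 (pulse s \<xi>)))\<^sup>2) =
        (of_real (t + s - 2 * min s t) :: complex) * cinner \<xi> \<xi>"
      using s t unfolding cinner_self[symmetric]
      by (simp add: cinner_diff_left cinner_diff_right cinner_pulse_pulse min.commute[of t s] algebra_simps)
    also have "\<dots> = of_real ((sqrt \<bar>t - s\<bar> * norm \<xi>)\<^sup>2)"
      by (simp add: cinner_self power_mult_distrib min_def)
    finally show ?thesis unfolding of_real_eq_iff by (rule power2_eq_imp_eq) auto
  qed
  have "((\<lambda>t. sqrt \<bar>t - s\<bar> * norm \<xi>) \<longlongrightarrow> sqrt \<bar>s - s\<bar> * norm \<xi>) (at s within {0..})"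
    by (intro tendsto_intros)
  then have lim: "((\<lambda>t. sqrt \<bar>t - s\<bar> * norm \<xi>) \<longlongrightarrow> 0) (at s within {0..})" by simp
  have "((\<lambda>t. l2 (pulse t \<xi>) - l2 (pulse s \<xi>)) \<longlongrightarrow> 0) (at s within {0..})"
    by (rule Lim_null_comparison[OF _ lim]) (simp add: eventually_at_filter dist)
  then show "((\<lambda>t. l2 (pulse t \<xi>)) \<longlongrightarrow> l2 (pulse s \<xi>)) (at s within {0..})"
    by (rule LIM_zero_cancel)
qed

lemma l2_indicator:
  assumes "0 \<le> a" "a \<le> b"
  shows "l2 (\<lambda>s. indicat_real {a..<b} s *\<^sub>R z) = l2 (pulse b z) - l2 (pulse a z)"
proof -
  have "(\<lambda>s. pulse a z s + indicat_real {a..<b} s *\<^sub>R z) = pulse b z"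
    using assms by (auto simp: pulse_def before_def indicator_def fun_eq_iff)
  with l2_add[OF Lstep_pulse[of a z] Lstep_indicator[OF assms(1), of b z]] show ?thesis by simp
qed

text \<open>The function is the integral of \<open>cinner \<xi> (g s)\<close> over [0,t), so
  exceptional points can occur only at interval endpoints of \<open>g\<close>. Proceeding interval
  by interval makes this elementary.\<close>

lemma pulse_has_derivative:
  fixes g :: "real \<Rightarrow> complex ^ 'n :: finite"
  assumes "g \<in> Lstep"
  shows "\<exists>S. finite S \<and> (\<forall>t>0. t \<notin> S \<longrightarrow>
    ((\<lambda>t. cinner (l2 (pulse t \<xi>)) (l2 g)) has_vector_derivative cinner \<xi> (g t)) (at t))"
  using assms
proof (induction g rule: Lstep_induct)
  case zero
  show ?case by (rule exI[of _ "{}"]) (simp add: l2_zero)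
next
  case (add g a b z)
  let ?h = "\<lambda>s. indicat_real {a..<b} s *\<^sub>R z"
  obtain S where S: "finite S" "\<And>t. 0 < t \<Longrightarrow> t \<notin> S \<Longrightarrow>
      ((\<lambda>t. cinner (l2 (pulse t \<xi>)) (l2 g)) has_vector_derivative cinner \<xi> (g t)) (at t)"
    using add.IH by blast
  have h: "((\<lambda>t. cinner (l2 (pulse t \<xi>)) (l2 ?h)) has_vector_derivative cinner \<xi> (?h t)) (at t)"
    if t: "0 < t" "t \<notin> {a, b}" for t
  proof (cases "a \<le> b")
    case False
    then show ?thesis by (simp add: l2_zero)
  next
    case True
    define e where "e = indicat_real {a..<b} t"
    \<comment> \<open>The length of the intersection of [0,t) with [a,b), for nonnegative
      \<open>t\<close>.\<close>
    define \<mu> where "\<mu> t = min t b - min t a" for t :: real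
    have "(\<mu> has_vector_derivative e) (at t)"
    proof -
      have m: "((\<lambda>t. min t c) has_vector_derivative of_bool (t < c)) (at t)" if c: "t \<noteq> c" for c :: real
      proof (cases "t < c")
        case True
        have "((\<lambda>t. t) has_vector_derivative 1) (at t)" by (rule has_vector_derivative_id)
        then have "((\<lambda>t. min t c) has_vector_derivative 1) (at t)"
          by (rule has_vector_derivative_transform_within_open[of _ _ _ "{..<c}"]) (use True in auto)
        with True show ?thesis by simp
      next
        case False
        have "((\<lambda>t. c) has_vector_derivative 0) (at t)" by simp
        then have "((\<lambda>t. min t c) has_vector_derivative 0) (at t)"
          by (rule has_vector_derivative_transform_within_open[of _ _ _ "{c<..}"]) (use False c in auto)
        with False show ?thesis by simp
      qed
      have "(\<mu> has_vector_derivative of_bool (t < b) - of_bool (t < a)) (at t)"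
        unfolding \<mu>_def using t by (intro has_vector_derivative_diff m) auto
      moreover have "of_bool (t < b) - of_bool (t < a) = e"
        using t True by (auto simp: e_def indicator_def)
      ultimately show ?thesis by simp
    qed
    then have "((\<lambda>t. \<mu> t *\<^sub>R cinner \<xi> z) has_vector_derivative e *\<^sub>R cinner \<xi> z) (at t)"
      by (rule bounded_linear.has_vector_derivative[OF bounded_linear_scaleR_left])
    then have "((\<lambda>t. cinner (l2 (pulse t \<xi>)) (l2 ?h)) has_vector_derivative e *\<^sub>R cinner \<xi> z) (at t)"
    proof (rule has_vector_derivative_transform_within_open)
      fix s :: real assume "s \<in> {0<..}"
      then show "\<mu> s *\<^sub>R cinner \<xi> z = cinner (l2 (pulse s \<xi>)) (l2 ?h)"
        using add.hyps(2) True
        unfolding l2_indicator[OF add.hyps(2) True]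
        by (simp add: cinner_diff_right cinner_pulse_pulse \<mu>_def scaleR_conv_of_real left_diff_distrib)
    qed (use t in auto)
    then show ?thesis by (simp add: e_def cinner.scaleR_right)
  qed
  show ?case
  proof (intro exI[of _ "S \<union> {a, b}"] conjI allI impI)
    fix t assume "0 < t" "t \<notin> S \<union> {a, b}"
    then have "((\<lambda>t. cinner (l2 (pulse t \<xi>)) (l2 g) + cinner (l2 (pulse t \<xi>)) (l2 ?h))
        has_vector_derivative cinner \<xi> (g t) + cinner \<xi> (?h t)) (at t)"
      by (intro has_vector_derivative_add S h) auto
    then show "((\<lambda>t. cinner (l2 (pulse t \<xi>)) (l2 (\<lambda>s. g s + ?h s))) has_vector_derivative
        cinner \<xi> (g t + ?h t)) (at t)"
      by (simp add: l2_add add.hyps Lstep_indicator cinner_add_right)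
  qed (use S in auto)
qed

text \<open>The exponent \<open>E\<close> is continuous and differentiable off finitely many times,
  so the fundamental theorem applies to exp(E). The integrand displays the logarithmic derivative
  that the generator has to reproduce.\<close>

lemma weyl_pulse_has_integral:
  fixes f g :: "real \<Rightarrow> complex ^ 'n :: finite" and \<xi> :: "complex ^ 'n"
  assumes f: "f \<in> Lstep" and g: "g \<in> Lstep" and t: "0 \<le> t"
  defines "m \<equiv> \<lambda>t. cinner (varpi f) (weyl (l2 (pulse t \<xi>)) (varpi g))"
  shows "((\<lambda>s. (cinner (f s) \<xi> - cinner \<xi> (g s) - of_real ((norm \<xi>)\<^sup>2) / 2) * m s)
    has_integral (m t - m 0)) {0..t}"
proof -
  define E where "E t = cinner (l2 f) (l2 (pulse t \<xi>)) - cinner (l2 (pulse t \<xi>)) (l2 g)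
    - of_real (t * (norm \<xi>)\<^sup>2) / 2 + cinner (l2 f) (l2 g)
      - of_real ((norm (l2 f))\<^sup>2) / 2 - of_real ((norm (l2 g))\<^sup>2) / 2" for t
  have m: "m t = exp (E t)" if "0 \<le> t" for t
    using norm_pulse[OF that, of \<xi>] by (simp only: m_def cinner_weyl E_def)
  obtain S where S: "finite S" "\<And>t. 0 < t \<Longrightarrow> t \<notin> S \<Longrightarrow>
      ((\<lambda>t. cinner (l2 (pulse t \<xi>)) (l2 f)) has_vector_derivative cinner \<xi> (f t)) (at t)"
    using pulse_has_derivative[OF f] by blast
  obtain S' where S': "finite S'" "\<And>t. 0 < t \<Longrightarrow> t \<notin> S' \<Longrightarrow>
      ((\<lambda>t. cinner (l2 (pulse t \<xi>)) (l2 g)) has_vector_derivative cinner \<xi> (g t)) (at t)"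
    using pulse_has_derivative[OF g] by blast
  let ?h = "\<lambda>s. cinner (f s) \<xi> - cinner \<xi> (g s) - of_real ((norm \<xi>)\<^sup>2) / 2"
  have "((\<lambda>s. ?h s * exp (E s)) has_integral (exp (E t) - exp (E 0))) {0..t}"
  proof (rule fundamental_theorem_of_calculus_interior_strong[of "S \<union> S'"])
    fix s assume s: "s \<in> {0<..<t} - (S \<union> S')"
    have "((\<lambda>t. cinner (l2 f) (l2 (pulse t \<xi>))) has_vector_derivative cinner (f s) \<xi>) (at s)"
      using bounded_linear.has_vector_derivative[OF bounded_linear_cnj S(2)[of s]] s
      by (simp flip: cinner_commute)
    moreover have "((\<lambda>t. of_real (t * (norm \<xi>)\<^sup>2) / 2 :: complex) has_vector_derivative
        of_real ((norm \<xi>)\<^sup>2) / 2) (at s)"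
      by (auto intro!: derivative_eq_intros)
    ultimately have "(E has_vector_derivative ?h s) (at s)"
      unfolding E_def using S'(2)[of s] s by (auto intro!: derivative_eq_intros)
    then show "((\<lambda>s. exp (E s)) has_vector_derivative ?h s * exp (E s)) (at s)"
      using field_vector_diff_chain_at[of E "?h s" s exp "exp (E s)"] DERIV_exp[of "E s"]
      by (simp add: o_def)
  next
    have "continuous_on {0..t} (\<lambda>t. l2 (pulse t \<xi>))"
      by (rule continuous_on_subset[OF continuous_on_pulse]) auto
    then show "continuous_on {0..t} (\<lambda>s. exp (E s))"
      unfolding E_def by (auto intro!: continuous_intros cinner.continuous_on)
  qed (use S S' t in auto)
  then have "((\<lambda>s. ?h s * m s) has_integral (exp (E t) - exp (E 0))) {0..t}"
    by (rule has_integral_eq[rotated]) (simp add: m)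
  then show ?thesis using t by (simp add: m)
qed

section \<open>The solution\<close>

lemma star_hom_bop: "star_hom A \<pi> \<Longrightarrow> x \<in> A \<Longrightarrow> \<pi> x \<in> bop"
  by (auto simp: star_hom_def)

lemma sum_option: "(\<Sum>\<alpha>\<in>UNIV. f \<alpha>) = f None + (\<Sum>j\<in>UNIV. f (Some j))" for f :: "'n :: finite option \<Rightarrow> 'a :: comm_monoid_add"
  by (simp add: UNIV_option_conv sum.reindex)

lemma clinear_htensor: "clinear_on UNIV (\<lambda>u. u \<otimes>\<^sub>H v)"
  by (simp add: clinear_on_def htensor.add_left htensor_scaleC_left)

lemma cinner_cadj_htensor:
  "cinner u (cadj (\<lambda>u. u \<otimes>\<^sub>H v) \<theta>) = cinner (u \<otimes>\<^sub>H v) \<theta>"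
  by (rule cinner_cadj[symmetric, OF htensor.bounded_linear_left clinear_htensor])

lemma ftensor_add_left: "(u + v) \<otimes>\<^sub>F \<xi> = u \<otimes>\<^sub>F \<xi> + v \<otimes>\<^sub>F \<xi>"
  by (simp add: ftensor_def vec_eq_iff scaleC_add_right)

lemma ftensor_scaleC_left: "(a *\<^sub>C u) \<otimes>\<^sub>F \<xi> = a *\<^sub>C (u \<otimes>\<^sub>F \<xi>)"
  by (simp add: ftensor_def vec_eq_iff scaleC_scaleC scaleC_vec_def mult.commute)

lemma clinear_ftensor: "clinear_on UNIV (\<lambda>u. u \<otimes>\<^sub>F \<xi>)"
  by (simp add: clinear_on_def ftensor_add_left ftensor_scaleC_left)

lemma cinner_cadj_ftensor:
  "cinner u (cadj (\<lambda>u. u \<otimes>\<^sub>F \<xi>) \<theta>) = cinner (u \<otimes>\<^sub>F \<xi>) \<theta>"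
  by (rule cinner_cadj[symmetric, OF bounded_linear_ftensor clinear_ftensor])

lemma cinner_cadj_htensor_ftensor:
  "cinner u (cadj (\<lambda>u. (u \<otimes>\<^sub>H v) \<otimes>\<^sub>F \<xi>) \<theta>) = cinner ((u \<otimes>\<^sub>H v) \<otimes>\<^sub>F \<xi>) \<theta>"
proof (rule cinner_cadj[symmetric])
  show "bounded_linear (\<lambda>u. (u \<otimes>\<^sub>H v) \<otimes>\<^sub>F \<xi>)"
    by (rule bounded_linear_compose[OF bounded_linear_ftensor htensor.bounded_linear_left])
  show "clinear_on UNIV (\<lambda>u. (u \<otimes>\<^sub>H v) \<otimes>\<^sub>F \<xi>)"
    by (simp add: clinear_on_def htensor.add_left htensor_scaleC_left ftensor_add_left
        ftensor_scaleC_left)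
qed

locale sphere_flow =
  fixes K :: sphere and Z :: "'n :: finite \<Rightarrow> 'h :: hilbert_space \<Rightarrow>\<^sub>L 'h" and c :: "'n \<Rightarrow> complex"
  assumes sphere: "sphere_in_B K Z"
begin

lemma Z_bop: "Z i \<in> bop"
  using sphere by (simp add: sphere_in_B_def)

lemmas A0_ind [consumes 1, case_names word add scaleC] = A0_induct[of Z, OF Z_bop]

lemma A0_in_bop: "x \<in> A0 Z \<Longrightarrow> x \<in> bop"
  using A0_subset_bop[of Z, OF Z_bop] by blast

abbreviation d :: "'n \<Rightarrow> ('h \<Rightarrow>\<^sub>L 'h) \<Rightarrow> 'h \<Rightarrow>\<^sub>L 'h" where "d \<equiv> charge_deriv Z"

lemma d_A0: "x \<in> A0 Z \<Longrightarrow> d j x \<in> A0 Z"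
  and d_add: "x \<in> A0 Z \<Longrightarrow> y \<in> A0 Z \<Longrightarrow> d j (x + y) = d j x + d j y"
  and d_scaleC: "x \<in> A0 Z \<Longrightarrow> d j (a *\<^sub>C x) = a *\<^sub>C d j x"
  and d_word: "d j (word_op Z w) = of_int (charge j w) *\<^sub>C word_op Z w"
  using charge_derivation_charge_deriv[OF sphere, of j]
  by (auto simp: charge_derivation_def clinear_on_def)

lemma A0_scaleC: "x \<in> A0 Z \<Longrightarrow> a *\<^sub>C x \<in> A0 Z"
  and A0_add: "x \<in> A0 Z \<Longrightarrow> y \<in> A0 Z \<Longrightarrow> x + y \<in> A0 Z"
  and A0_adj: "x \<in> A0 Z \<Longrightarrow> adj x \<in> A0 Z"
  using unital_star_subalgebra_A0[of Z] by (auto simp: unital_star_subalgebra_def csubspace_def)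

lemma charge_star_word: "charge j (star_word w) = - charge j w"
proof (induction w)
  case (Sword as)
  show ?case
  proof (induction as)
    case (Cons a as)
    then show ?case by (cases a) (simp_all add: charge_def star_word_def)
  qed (simp add: charge_def star_word_def)
qed

text \<open>The adjoint of a word has opposite charges. This produces the minus sign in the upper
  right entry of the generator.\<close>

lemma adj_d_adj:
  assumes "x \<in> A0 Z"
  shows "adj (d j (adj x)) = - d j x"
  using assms
proof (induction x rule: A0_ind)
  case (word w)
  have "adj (d j (adj (word_op Z w))) = adj (d j (word_op Z (star_word w)))"
    by (simp add: word_op_star_word[of Z, OF Z_bop])
  also have "\<dots> = - of_int (charge j w) *\<^sub>C word_op Z w"
    unfolding d_word charge_star_word
    by (simp add: adj_scaleC word_op_bop[of Z, OF Z_bop] word_op_star_word[of Z, OF Z_bop] adj_adj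
        adj_bop)
  finally show ?case by (simp add: d_word scaleC.minus_left)
next
  case (add x y)
  then show ?case
    by (simp add: adj_add A0_in_bop d_add A0_adj d_A0)
next
  case (scaleC a x)
  then show ?case
    by (simp add: adj_scaleC A0_in_bop d_scaleC A0_adj d_A0 scaleC.minus_right)
qed

section \<open>Matrix entries of the generator\<close>

fun coef :: "('h \<Rightarrow>\<^sub>L 'h) \<Rightarrow> 'n option \<Rightarrow> 'n option \<Rightarrow> 'h \<Rightarrow>\<^sub>L 'h" where
  "coef x None None = tau c d x"
| "coef x (Some j) None = c j *\<^sub>C d j x"
| "coef x None (Some j) = - cnj (c j) *\<^sub>C d j x"
| "coef x (Some i) (Some j) = 0"

lemma tau_eq: "tau c d x = (\<Sum>j\<in>UNIV. (- of_real ((cmod (c j))\<^sup>2) / 2) *\<^sub>C d j (d j x))"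
proof -
  have "(- of_real ((cmod (c j))\<^sup>2) / 2 :: complex) = of_real (- 1 / 2 * (cmod (c j))\<^sup>2)" for j
    by simp
  then show ?thesis by (simp only: tau_def scaleC_of_real scaleR_sum_right scaleR_scaleR)
qed

lemma coef_A0: "x \<in> A0 Z \<Longrightarrow> coef x \<alpha> \<beta> \<in> A0 Z"
  using csubspace_A0[of Z]
  by (cases "(x, \<alpha>, \<beta>)" rule: coef.cases)
    (auto simp: tau_eq csubspace_def intro!: csubspace_sum csubspace_A0 A0_scaleC d_A0)

lemma coef_add: "x \<in> A0 Z \<Longrightarrow> y \<in> A0 Z \<Longrightarrow> coef (x + y) \<alpha> \<beta> = coef x \<alpha> \<beta> + coef y \<alpha> \<beta>"
  by (cases "(x, \<alpha>, \<beta>)" rule: coef.cases)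
    (simp_all add: tau_eq d_add d_A0 scaleC_add_right sum.distrib)

lemma coef_scaleC: "x \<in> A0 Z \<Longrightarrow> coef (a *\<^sub>C x) \<alpha> \<beta> = a *\<^sub>C coef x \<alpha> \<beta>"
  by (cases "(x, \<alpha>, \<beta>)" rule: coef.cases)
    (simp_all add: tau_eq d_scaleC d_A0 scaleC_scaleC mult.commute scaleC.sum_right scaleC.zero_right)

text \<open>The matrix unit sending the basis vector of index \<beta> to that of index
  \<alpha>.\<close>

definition munit :: "'n option \<Rightarrow> 'n option \<Rightarrow> (complex ^ 'n option) \<Rightarrow>\<^sub>L (complex ^ 'n option)" where
  "munit \<alpha> \<beta> = Blinfun (\<lambda>\<xi>. axis \<alpha> (\<xi> $ \<beta>))"

lemma munit_apply: "munit \<alpha> \<beta> \<xi> = axis \<alpha> (\<xi> $ \<beta>)"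
  unfolding munit_def
  by (simp add: bounded_linear_Blinfun_apply bounded_linear_compose[OF bounded_linear_axis bounded_linear_vec_nth])

lemma munit_bop: "munit \<alpha> \<beta> \<in> bop"
  by (rule bopI) (simp add: munit_apply scaleC_vec_def vec_eq_iff axis_def scaleC.zero_right)

lemma op_ftensor_munit: "op_ftensor y (munit \<alpha> \<beta>) v $ \<gamma> = (if \<gamma> = \<alpha> then y (v $ \<beta>) else 0)"
proof -
  have "op_ftensor y (munit \<alpha> \<beta>) v $ \<gamma> = (\<Sum>\<delta>\<in>UNIV. if \<delta> = \<beta> then if \<gamma> = \<alpha> then y (v $ \<beta>) else 0 else 0)"
    unfolding op_ftensor_apply sum_component
    by (rule sum.cong) (auto simp: munit_apply ftensor_def axis_def)
  then show ?thesis by simp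
qed

lemma sum_op_ftensor_munit:
  "(\<Sum>\<alpha>\<in>UNIV. \<Sum>\<beta>\<in>UNIV. op_ftensor (y \<alpha> \<beta>) (munit \<alpha> \<beta>)) v $ \<gamma> = (\<Sum>\<beta>\<in>UNIV. y \<gamma> \<beta> (v $ \<beta>))"
  by (simp add: blinfun.sum_left op_ftensor_munit if_distrib sum.If_cases)

text \<open>This exhibits the generator as an element of the algebraic tensor product; equality with
  a bounded operator also certifies that \<open>Blinfun\<close> in \<open>phi\<close> is applied to
  a bounded linear map.\<close>

lemma phi_eq:
  assumes x: "x \<in> A0 Z"
  shows "phi c d x = (\<Sum>\<alpha>\<in>UNIV. \<Sum>\<beta>\<in>UNIV. op_ftensor (coef x \<alpha> \<beta>) (munit \<alpha> \<beta>))" (is "_ = ?M")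
proof -
  have delta: "delta c d y u $ j = c j *\<^sub>C d j y u" for y u j
  proof -
    have "delta c d y u $ j = (\<Sum>i\<in>UNIV. if i = j then c j *\<^sub>C d j y u else 0)"
      unfolding delta_def sum_component
      by (rule sum.cong) (auto simp: ftensor_def axis_def scaleC_vec_def scaleC.zero_right)
    then show ?thesis by simp
  qed
  \<comment> \<open>The adjoint of \<open>delta\<close> is guessed and confirmed by
    \<open>cadj_eqI\<close>; its entries are then rewritten with \<open>adj_d_adj\<close>.\<close>
  have cadj_delta: "cadj (delta c d (adj x)) v = (\<Sum>j\<in>UNIV. (- cnj (c j)) *\<^sub>C d j x (v $ j))" for v
  proof -
    have "cadj (delta c d (adj x)) = (\<lambda>v. \<Sum>j\<in>UNIV. cnj (c j) *\<^sub>C adj (d j (adj x)) (v $ j))"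
    proof (rule cadj_eqI)
      fix u v
      show "cinner (delta c d (adj x) u) v
          = cinner u (\<Sum>j\<in>UNIV. cnj (c j) *\<^sub>C adj (d j (adj x)) (v $ j))"
        using x by (simp add: delta cinner_vec_def cinner.sum_right cinner_scaleC_left cinner_scaleC_right
            cinner_adj A0_in_bop d_A0 A0_adj)
    qed
    then show ?thesis using x
      by (simp add: adj_d_adj blinfun.minus_left scaleC.minus_left scaleC.minus_right)
  qed
  have "block (tau c d x) (cadj (delta c d (adj x))) (delta c d x) (\<lambda>_. 0) = blinfun_apply ?M"
  proof (intro ext vec_eq_iff[THEN iffD2] allI)
    fix v \<gamma>
    show "block (tau c d x) (cadj (delta c d (adj x))) (delta c d x) (\<lambda>_. 0) v $ \<gamma> = ?M v $ \<gamma>"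
      unfolding sum_op_ftensor_munit
      by (cases \<gamma>) (simp_all add: sum_option block_def Let_def cadj_delta delta scaleC_blinfun.rep_eq)
  qed
  then show ?thesis by (simp add: phi_def blinfun_apply_inverse)
qed

lemma phi_apply:
  assumes "x \<in> A0 Z"
  shows "phi c d x v $ \<gamma> = (\<Sum>\<beta>\<in>UNIV. coef x \<gamma> \<beta> (v $ \<beta>))"
  by (simp add: phi_eq[OF assms] sum_op_ftensor_munit)

lemma phi_in_A0_tensor_B:
  assumes "x \<in> A0 Z"
  shows "phi c d x \<in> A0_tensor_B Z"
proof -
  have "op_ftensor (coef x \<alpha> \<beta>) (munit \<alpha> \<beta>) \<in> {op_ftensor y T | y T. y \<in> A0 Z \<and> T \<in> bop}" for \<alpha> \<beta>
    using coef_A0[OF assms, of \<alpha> \<beta>] munit_bop[of \<alpha> \<beta>] by blast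
  then show ?thesis
    unfolding phi_eq[OF assms] A0_tensor_B_def
    by (intro csubspace_sum csubspace_cspan subsetD[OF cspan_superset])
qed

lemma entry_phi:
  assumes "x \<in> A0 Z"
  shows "entry (phi c d x) \<alpha> \<beta> = coef x \<alpha> \<beta>"
proof (rule blinfun_eqI)
  fix u
  have "entry (phi c d x) \<alpha> \<beta> u = (\<Sum>\<gamma>\<in>UNIV. if \<gamma> = \<beta> then coef x \<alpha> \<beta> u else 0)"
    unfolding entry_apply phi_apply[OF assms]
    by (rule sum.cong) (auto simp: ftensor_def axis_def blinfun.zero_right)
  then show "entry (phi c d x) \<alpha> \<beta> u = coef x \<alpha> \<beta> u" by simp
qed

section \<open>The Weyl representation of the charges and the homomorphisms j_t\<close>

definition xi :: "('n \<Rightarrow> int) \<Rightarrow> complex ^ 'n" where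
  "xi n = (\<chi> j. of_int (n j) * c j)"

lemma xi_add: "xi (\<lambda>j. m j + n j) = xi m + xi n"
  by (simp add: xi_def vec_eq_iff distrib_right)

text \<open>Charges are integers and each c_j meets its own conjugate, so only |c_j|^2 remains and
  the value is real.\<close>

lemma cinner_xi: "cinner (xi m) (xi n) = of_real (\<Sum>j\<in>UNIV. of_int (m j) * of_int (n j) * (cmod (c j))\<^sup>2)"
proof -
  have "cinner (xi m) (xi n) = (\<Sum>j\<in>UNIV. of_int (m j) * of_int (n j) * (c j * cnj (c j)))"
    by (simp add: xi_def cinner_vec_def cinner_complex_def mult_ac)
  then show ?thesis by (simp flip: complex_norm_square)
qed

definition W :: "real \<Rightarrow> ('n \<Rightarrow> int) \<Rightarrow> 'n L2 fock \<Rightarrow>\<^sub>L 'n L2 fock" where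
  "W t n = weyl (l2 (pulse t (xi n)))"

lemma isometry_W: "isometry (W t n)"
  by (simp add: W_def weyl(1))

lemma W_zero: "W t (\<lambda>_. 0) = id_blinfun" "W 0 n = id_blinfun"
proof -
  have "xi (\<lambda>_. 0) = 0" by (simp add: xi_def vec_eq_iff)
  then show "W t (\<lambda>_. 0) = id_blinfun" "W 0 n = id_blinfun" by (simp_all add: W_def pulse_zero weyl_zero)
qed

text \<open>Together with \<open>W_zero\<close> and \<open>W_adj\<close>: for fixed
  \<open>0 \<le> t\<close> the operators \<open>W t n\<close> form a unitary representation of the
  additive group of charge vectors, which matches concatenation and adjoints of words.\<close>

lemma W_add:
  assumes "0 \<le> t"
  shows "W t m o\<^sub>L W t n = W t (\<lambda>j. m j + n j)"
  unfolding W_def xi_add pulse_add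
  by (rule weyl_compose) (simp add: cinner_pulse_pulse assms cinner_xi flip: of_real_mult)

lemma W_adj: "adj (W t n) = W t (\<lambda>j. - n j)"
proof -
  have "xi (\<lambda>j. - n j) = - xi n" by (simp add: xi_def vec_eq_iff)
  then show ?thesis by (simp add: W_def weyl_adj pulse_minus)
qed

definition V :: "real \<Rightarrow> 'n \<Rightarrow> ('h, 'n) hF \<Rightarrow>\<^sub>L ('h, 'n) hF" where
  "V t i = op_tensor (Z i) (W t (\<lambda>j. of_bool (i = j)))"

lemma V_bop: "V t i \<in> bop"
  by (simp add: V_def op_tensor_bop Z_bop isometry_W)

lemma letter_V: "letter_op (V t) a = op_tensor (letter_op Z a) (W t (letter_charge a))"
proof (cases a)
  case (Gen i)
  have "letter_charge (Gen i) = (\<lambda>j. of_bool (i = j))" by auto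
  then show ?thesis by (simp add: Gen V_def)
next
  case (Adj i)
  have "letter_charge (Adj i) = (\<lambda>j. - of_bool (i = j))" by auto
  then show ?thesis
    by (simp add: Adj V_def op_tensor_adj Z_bop isometry_W W_adj)
qed

lemma word_V:
  assumes "0 \<le> t"
  shows "word_op (V t) w = op_tensor (word_op Z w) (W t (\<lambda>j. charge j w))"
proof (induction w)
  case (Sword as)
  show ?case
  proof (induction as)
    case Nil
    show ?case by (simp add: charge_def W_zero op_tensor_id)
  next
    case (Cons a as)
    then show ?case
      by (simp add: charge_Cons word_op_Cons letter_V op_tensor_compose letter_op_bop word_op_bop Z_bop
          isometry_W W_add assms)
  qed
qed

text \<open>The choice is justified for \<open>0 \<le> t\<close>, by
  \<open>star_hom_extension\<close> with the twisting map
  \<open>\<lambda>x. op_tensor x (W t n)\<close> on charge n.\<close>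

definition flow :: "real \<Rightarrow> ('h \<Rightarrow>\<^sub>L 'h) \<Rightarrow> ('h, 'n) hF \<Rightarrow>\<^sub>L ('h, 'n) hF" where
  "flow t = (SOME \<pi>. star_hom (Aclosed Z) \<pi> \<and> (\<forall>p. \<pi> (poly_op Z p) = poly_op (V t) p))"

lemma flow:
  assumes "0 \<le> t"
  shows star_hom_flow: "star_hom (Aclosed Z) (flow t)"
    and flow_word: "flow t (word_op Z w) = op_tensor (word_op Z w) (W t (\<lambda>j. charge j w))"
proof -
  have "\<exists>\<pi>. star_hom (Aclosed Z) \<pi> \<and> (\<forall>p. \<pi> (poly_op Z p) = poly_op (V t) p)"
  proof (rule star_hom_extension[OF sphere V_bop])
    show "clinear_on (A0 Z) (\<lambda>x. op_tensor x (W t n))" for n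
      by (rule clinear_on_op_tensor[OF A0_subset_bop[of Z, OF Z_bop] csubspace_A0 isometry_W])
  qed (rule word_V[OF assms])
  from someI_ex[OF this] have *: "star_hom (Aclosed Z) (flow t)" "\<And>p. flow t (poly_op Z p) = poly_op (V t) p"
    unfolding flow_def by auto
  show "star_hom (Aclosed Z) (flow t)" by (rule *)
  show "flow t (word_op Z w) = op_tensor (word_op Z w) (W t (\<lambda>j. charge j w))"
    using *(2)[of "Poly_Mapping.single w 1"] word_V[OF assms] by simp
qed

lemma A0_Aclosed: "x \<in> A0 Z \<Longrightarrow> x \<in> Aclosed Z"
  unfolding Aclosed_def using closure_subset by blast

lemma flow_bop: "0 \<le> t \<Longrightarrow> x \<in> A0 Z \<Longrightarrow> flow t x \<in> bop"
  by (rule star_hom_bop[OF star_hom_flow A0_Aclosed])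

lemma flow_add: "0 \<le> t \<Longrightarrow> x \<in> A0 Z \<Longrightarrow> y \<in> A0 Z \<Longrightarrow> flow t (x + y) = flow t x + flow t y"
  and flow_scaleC: "0 \<le> t \<Longrightarrow> x \<in> A0 Z \<Longrightarrow> flow t (a *\<^sub>C x) = a *\<^sub>C flow t x"
  using star_hom_flow[of t] A0_Aclosed by (auto simp: star_hom_def clinear_on_def)

lemma flow_zero:
  assumes "x \<in> A0 Z"
  shows "flow 0 x (u \<otimes>\<^sub>H e) = x u \<otimes>\<^sub>H e"
  using assms
proof (induction x rule: A0_ind)
  case (word w)
  show ?case
    by (simp add: flow_word W_zero op_tensor_apply word_op_bop Z_bop isometry_def id_blinfun_bop)
next
  case (add x y)
  then show ?case by (simp add: flow_add blinfun.add_left htensor.add_left)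
next
  case (scaleC a x)
  then show ?case by (simp add: flow_scaleC scaleC_blinfun.rep_eq htensor_scaleC_left)
qed

section \<open>Adaptedness and strong continuity in time\<close>

lemma flow_adapted:
  assumes x: "x \<in> A0 Z" and f: "f \<in> Lstep" and g: "g \<in> Lstep" and t: "0 \<le> t"
  shows "cinner (u \<otimes>\<^sub>H varpi f) (flow t x (v \<otimes>\<^sub>H varpi g)) =
    cinner (varpi (after t f)) (varpi (after t g)) *
    cinner (u \<otimes>\<^sub>H varpi (before t f)) (flow t x (v \<otimes>\<^sub>H varpi (before t g)))"
  using x
proof (induction x rule: A0_ind)
  case (word w)
  show ?case
    using cinner_weyl_pulse[OF f g t, of "xi (\<lambda>j. charge j w)"]
    by (simp add: flow_word[OF t] op_tensor_apply word_op_bop Z_bop weyl(1) cinner_htensor W_def)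
next
  case (add x y)
  then show ?case by (simp add: flow_add[OF t] blinfun.add_left cinner_add_right distrib_left)
next
  case (scaleC a x)
  then show ?case by (simp add: flow_scaleC[OF t] scaleC_blinfun.rep_eq cinner_scaleC_right)
qed

lemma csubspace_hEdom: "csubspace hEdom" and csubspace_Edom: "csubspace Edom"
  by (simp_all add: hEdom_def Edom_def csubspace_cspan)

lemma htensor_varpi_hEdom:
  assumes "f \<in> Lstep"
  shows "u \<otimes>\<^sub>H varpi f \<in> hEdom"
proof -
  have "expvec (l2 f) \<in> Edom"
    unfolding Edom_def using assms by (intro subsetD[OF cspan_superset]) blast
  then have "varpi f \<in> Edom"
    unfolding nexpvec_def by (rule csubspace_scaleR[OF csubspace_Edom])
  then show ?thesis
    unfolding hEdom_def by (intro subsetD[OF cspan_superset]) blast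
qed

text \<open>On a word only the Weyl factor moves, and it sends an exponential vector to a continuous
  scalar times the exponential vector of a continuous curve. Linearity extends this to the algebraic
  domain and to \<open>A0 Z\<close>.\<close>

lemma flow_continuous:
  assumes "x \<in> A0 Z" "\<xi> \<in> hEdom"
  shows "continuous_on {0..} (\<lambda>t. flow t x \<xi>)"
  using assms(1)
proof (induction x rule: A0_ind)
  case (word w)
  define n where "n = (\<lambda>j. charge j w)"
  have app: "flow t (word_op Z w) (u \<otimes>\<^sub>H e) = word_op Z w u \<otimes>\<^sub>H W t n e" if "t \<in> {0..}" for t u e
    using that by (simp add: flow_word op_tensor_apply word_op_bop Z_bop isometry_W n_def)
  have bop: "flow t (word_op Z w) \<in> bop" if "t \<in> {0..}" for t
    using that by (simp add: flow_bop word_op_in_A0)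
  have W_bop: "W t n \<in> bop" for t using isometry_W[of t n] by (simp add: isometry_def)
  have W: "continuous_on {0..} (\<lambda>t. W t n e)" if "e \<in> Edom" for e
    using that unfolding Edom_def
  proof (induction e rule: cspan_induct)
    case (base e)
    then obtain g where "e = expvec (l2 g)" by blast
    then show ?case
      by (auto simp: W_def weyl intro!: continuous_intros continuous_on_pulse scaleC.continuous_on
          cinner.continuous_on continuous_on_compose2[OF continuous_on_expvec[of UNIV]])
  next
    case (scaleC a e)
    then show ?case
      by (simp add: bop_scaleC[OF W_bop] scaleC.continuous_on)
  qed (auto simp: blinfun.add_right intro: continuous_on_add)
  show ?case
    using assms(2) unfolding hEdom_def
  proof (induction \<xi> rule: cspan_induct)
    case (base \<xi>)
    then obtain u e where e: "\<xi> = u \<otimes>\<^sub>H e" "e \<in> Edom" by blast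
    have "continuous_on {0..} (\<lambda>t. word_op Z w u \<otimes>\<^sub>H W t n e)"
      by (intro htensor.continuous_on continuous_on_const W e)
    then show ?case by (rule continuous_on_eq) (simp only: app e)
  next
    case (scaleC a \<xi>)
    then have "continuous_on {0..} (\<lambda>t. a *\<^sub>C flow t (word_op Z w) \<xi>)"
      by (intro scaleC.continuous_on continuous_on_const)
    then show ?case by (rule continuous_on_eq) (simp only: bop_scaleC[OF bop])
  qed (auto simp: blinfun.add_right intro: continuous_on_add)
next
  case (add x y)
  then have "continuous_on {0..} (\<lambda>t. flow t x \<xi> + flow t y \<xi>)" by (intro continuous_on_add)
  then show ?case
    by (rule continuous_on_eq) (simp add: flow_add add.hyps blinfun.add_left)
next
  case (scaleC a x)
  then have "continuous_on {0..} (\<lambda>t. a *\<^sub>C flow t x \<xi>)"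
    by (intro scaleC.continuous_on continuous_on_const)
  then show ?case
    by (rule continuous_on_eq) (simp add: flow_scaleC scaleC.hyps scaleC_blinfun.rep_eq)
qed

section \<open>The process and its integrability\<close>

definition J :: "real \<Rightarrow> ('h \<Rightarrow>\<^sub>L 'h) \<Rightarrow> ('h, 'n) hF \<Rightarrow> ('h, 'n) hF" where
  "J t x = blinfun_apply (flow t x)"

lemma jtilde_phi:
  assumes "x \<in> A0 Z"
  shows "jtilde (J t) (phi c d x) v $ \<alpha> = (\<Sum>\<beta>\<in>UNIV. flow t (coef x \<alpha> \<beta>) (v $ \<beta>))"
  using assms by (simp add: jtilde_def J_def entry_phi)

lemma jtilde_phi_ftensor:
  assumes "x \<in> A0 Z" "0 \<le> t"
  shows "jtilde (J t) (phi c d x) (\<theta> \<otimes>\<^sub>F \<zeta>) $ \<alpha> = (\<Sum>\<beta>\<in>UNIV. \<zeta> $ \<beta> *\<^sub>C flow t (coef x \<alpha> \<beta>) \<theta>)"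
  using assms by (simp add: jtilde_phi ftensor_def bop_scaleC[OF flow_bop] coef_A0)

lemma cinner_ftensor_jtilde:
  assumes "x \<in> A0 Z" "0 \<le> t"
  shows "cinner (\<eta> \<otimes>\<^sub>F \<xi>) (jtilde (J t) (phi c d x) (\<theta> \<otimes>\<^sub>F \<zeta>)) =
    (\<Sum>\<alpha>\<in>UNIV. \<Sum>\<beta>\<in>UNIV. cnj (\<xi> $ \<alpha>) * \<zeta> $ \<beta> * cinner \<eta> (flow t (coef x \<alpha> \<beta>) \<theta>))"
  by (simp add: cinner_vec_def jtilde_phi_ftensor[OF assms] ftensor_def[of \<eta>] cinner_scaleC_left
      cinner.sum_right cinner_scaleC_right sum_distrib_left mult_ac)

lemma operator_process_J:
  assumes x: "x \<in> A0 Z"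
  shows "operator_process (\<lambda>t. J t x)"
  unfolding operator_process_def
proof (intro conjI allI impI ballI)
  fix t :: real assume t: "0 \<le> t"
  show "clinear_on hEdom (J t x)"
    unfolding J_def by (rule clinear_on_bop[OF flow_bop[OF t x]])
next
  fix \<xi> \<eta> :: "('h, 'n) hF" assume "\<xi> \<in> hEdom"
  then have "regulated (\<lambda>t. cinner \<eta> (J t x \<xi>))"
    unfolding J_def
    by (intro regulated_linear[OF cinner.bounded_linear_right] regulated_continuous flow_continuous x)
  then show "(\<lambda>t. cinner \<eta> (J t x \<xi>)) \<in> borel_measurable (lebesgue_on {0..})"
    by (rule regulated_borel_measurable)
next
  fix t :: real and f g :: "real \<Rightarrow> complex ^ 'n" and u
  assume t: "0 \<le> t" and fg: "f \<in> Lstep" "g \<in> Lstep"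
  show "cadj (\<lambda>u. u \<otimes>\<^sub>H varpi f) (J t x (u \<otimes>\<^sub>H varpi g)) =
      cinner (varpi (after t f)) (varpi (after t g)) *\<^sub>C
        cadj (\<lambda>u. u \<otimes>\<^sub>H varpi (before t f)) (J t x (u \<otimes>\<^sub>H varpi (before t g)))"
    by (rule hilbert_eqI)
      (simp add: cinner_scaleC_right cinner_cadj_htensor J_def flow_adapted[OF x fg t])
qed

lemma regulated_jtilde:
  assumes x: "x \<in> A0 Z" and \<theta>: "\<theta> \<in> hEdom" and f: "f \<in> Lstep"
  shows "regulated (\<lambda>t. jtilde (J t) (phi c d x) (\<theta> \<otimes>\<^sub>F hat (f t)))"
proof (rule regulated_vec)
  fix \<alpha>
  have "regulated (\<lambda>t. \<Sum>\<beta>\<in>UNIV. hat (f t) $ \<beta> *\<^sub>C flow t (coef x \<alpha> \<beta>) \<theta>)"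
    by (intro regulated_sum regulated_bilinear[OF bounded_bilinear_scaleC] regulated_hat f regulated_continuous
        flow_continuous coef_A0 x \<theta>)
  then show "regulated (\<lambda>t. jtilde (J t) (phi c d x) (\<theta> \<otimes>\<^sub>F hat (f t)) $ \<alpha>)"
    by (rule regulated_cong) (simp add: jtilde_phi_ftensor x)
qed

lemma integrable_process_J:
  assumes x: "x \<in> A0 Z"
  shows "integrable_process (\<lambda>t. jtilde (J t) (phi c d x))"
  unfolding integrable_process_def
proof (intro conjI allI ballI AE_I2)
  fix t :: real and f g :: "real \<Rightarrow> complex ^ 'n" and u :: 'h and \<xi> \<zeta>
  assume "t \<in> space (lebesgue_on {0..})" and fg: "f \<in> Lstep" "g \<in> Lstep"
  then have t: "0 \<le> t" by simp
  show "cadj (\<lambda>u. (u \<otimes>\<^sub>H varpi f) \<otimes>\<^sub>F \<xi>) (jtilde (J t) (phi c d x) ((u \<otimes>\<^sub>H varpi g) \<otimes>\<^sub>F \<zeta>)) =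
      cinner (varpi (after t f)) (varpi (after t g)) *\<^sub>C
        cadj (\<lambda>u. (u \<otimes>\<^sub>H varpi (before t f)) \<otimes>\<^sub>F \<xi>)
          (jtilde (J t) (phi c d x) ((u \<otimes>\<^sub>H varpi (before t g)) \<otimes>\<^sub>F \<zeta>))"
    by (rule hilbert_eqI)
      (simp add: cinner_scaleC_right cinner_cadj_htensor_ftensor cinner_ftensor_jtilde[OF x t]
        flow_adapted[OF coef_A0[OF x] fg t] sum_distrib_left mult_ac)
next
  fix \<theta> :: "('h, 'n) hF ^ 'n option" assume "\<theta> \<in> hEkdom"
  \<comment> \<open>The algebraic tensor product with a finite-dimensional space consists of vectors
    whose components lie in \<open>hEdom\<close>, so strong continuity applies component by
    component.\<close>
  moreover have "hEkdom \<subseteq> {\<theta> :: ('h, 'n) hF ^ 'n option. \<forall>\<beta>. \<theta> $ \<beta> \<in> hEdom}"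
    unfolding hEkdom_def
    using csubspace_hEdom by (intro cspan_minimal) (auto simp: csubspace_def ftensor_def scaleC_vec_def)
  ultimately have \<theta>: "\<theta> $ \<beta> \<in> hEdom" for \<beta> by blast
  have "regulated (\<lambda>t. jtilde (J t) (phi c d x) \<theta>)"
    by (rule regulated_vec, unfold jtilde_phi[OF x])
      (intro regulated_sum regulated_continuous flow_continuous coef_A0 x \<theta>)
  then show "strongly_measurable (\<lambda>t. jtilde (J t) (phi c d x) \<theta>)"
    by (rule regulated_strongly_measurable)
next
  fix u :: 'h and f :: "real \<Rightarrow> complex ^ 'n" assume f: "f \<in> Lstep"
  let ?L = "\<lambda>t. jtilde (J t) (phi c d x) ((u \<otimes>\<^sub>H varpi f) \<otimes>\<^sub>F hat (f t))"
  have L: "regulated ?L" by (rule regulated_jtilde[OF x htensor_varpi_hEdom[OF f] f])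
  have comp: "regulated (\<lambda>t. ?L t $ \<alpha>)" for \<alpha>
    by (rule regulated_linear[OF bounded_linear_vec_nth L])
  have "regulated (\<lambda>t. Delta (?L t))"
  proof (rule regulated_vec)
    show "regulated (\<lambda>t. Delta (?L t) $ \<alpha>)" for \<alpha>
      using comp by (cases \<alpha>) (simp_all add: Delta_def)
  qed
  then show "locally_integrable_power 2 (\<lambda>t. Delta (?L t))"
    by (rule regulated_locally_integrable)
  have "regulated (\<lambda>t. ?L t - Delta (?L t))"
  proof (rule regulated_vec)
    show "regulated (\<lambda>t. (?L t - Delta (?L t)) $ \<alpha>)" for \<alpha>
      using comp by (cases \<alpha>) (simp_all add: Delta_def)
  qed
  then show "locally_integrable_power 1 (\<lambda>t. ?L t - Delta (?L t))"
    by (rule regulated_locally_integrable)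
qed

section \<open>The stochastic differential equation\<close>

text \<open>Between \<open>hat a\<close> and \<open>hat b\<close> the generator acts on a word by a
  scalar, and this scalar is the logarithmic derivative found in
  \<open>weyl_pulse_has_integral\<close>. Here the form of the generator and the Weyl process
  meet.\<close>

lemma sum_coef_word:
  assumes t: "0 \<le> t"
  defines "\<xi> \<equiv> \<lambda>w. xi (\<lambda>j. charge j w)"
  shows "(\<Sum>\<alpha>\<in>UNIV. \<Sum>\<beta>\<in>UNIV. cnj (hat a $ \<alpha>) * hat b $ \<beta> * cinner \<eta> (flow t (coef (word_op Z w) \<alpha> \<beta>) \<theta>))
    = (cinner a (\<xi> w) - cinner (\<xi> w) b - of_real ((norm (\<xi> w))\<^sup>2) / 2)
      * cinner \<eta> (flow t (word_op Z w) \<theta>)"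
proof -
  \<comment> \<open>The scalars by which the entries of the generator act on the word: \<tau> gives
    half the squared norm with a minus sign, \<delta> and its adjoint give the coordinates of
    \<xi>.\<close>
  define k where "k \<alpha> \<beta> = (case (\<alpha>, \<beta>) of
      (None, None) \<Rightarrow> - of_real ((norm (\<xi> w))\<^sup>2) / 2
    | (Some j, None) \<Rightarrow> \<xi> w $ j
    | (None, Some j) \<Rightarrow> - cnj (\<xi> w $ j)
    | (Some i, Some j) \<Rightarrow> 0)" for \<alpha> \<beta> :: "'n option"
  have norm: "of_real ((norm (\<xi> w))\<^sup>2) = (\<Sum>j\<in>UNIV. of_int (charge j w) * of_int (charge j w) * of_real ((cmod (c j))\<^sup>2) :: complex)"
    using cinner_xi[of "\<lambda>j. charge j w" "\<lambda>j. charge j w"] by (simp add: \<xi>_def cinner_self)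
  have "coef (word_op Z w) \<alpha> \<beta> = k \<alpha> \<beta> *\<^sub>C word_op Z w" for \<alpha> \<beta>
  proof (cases "(word_op Z w, \<alpha>, \<beta>)" rule: coef.cases)
    case (1 x)
    then have none: "\<alpha> = None" "\<beta> = None" by auto
    then have "coef (word_op Z w) \<alpha> \<beta> = (\<Sum>j\<in>UNIV. (- (of_int (charge j w) * of_int (charge j w) *
        of_real ((cmod (c j))\<^sup>2)) / 2) *\<^sub>C word_op Z w)"
      by (simp add: tau_eq d_word d_scaleC word_op_in_A0 scaleC_scaleC mult_ac)
    also have "\<dots> = (- of_real ((norm (\<xi> w))\<^sup>2) / 2) *\<^sub>C word_op Z w"
      unfolding norm scaleC.sum_left[symmetric] by (simp add: sum_negf sum_divide_distrib)
    finally show ?thesis using none by (simp add: k_def)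
  qed (auto simp: k_def \<xi>_def xi_def d_word scaleC_scaleC mult.commute scaleC.minus_left)
  then have "(\<Sum>\<alpha>\<in>UNIV. \<Sum>\<beta>\<in>UNIV. cnj (hat a $ \<alpha>) * hat b $ \<beta> * cinner \<eta> (flow t (coef (word_op Z w) \<alpha> \<beta>) \<theta>))
    = (\<Sum>\<alpha>\<in>UNIV. \<Sum>\<beta>\<in>UNIV. cnj (hat a $ \<alpha>) * hat b $ \<beta> * k \<alpha> \<beta>) * cinner \<eta> (flow t (word_op Z w) \<theta>)"
    by (simp add: flow_scaleC[OF t] word_op_in_A0 scaleC_blinfun.rep_eq cinner_scaleC_right
        sum_distrib_right mult.assoc)
  also have "(\<Sum>\<alpha>\<in>UNIV. \<Sum>\<beta>\<in>UNIV. cnj (hat a $ \<alpha>) * hat b $ \<beta> * k \<alpha> \<beta>)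
    = cinner a (\<xi> w) - cinner (\<xi> w) b - of_real ((norm (\<xi> w))\<^sup>2) / 2"
    by (simp add: sum_option hat_def k_def cinner_vec_def cinner_complex_def sum_negf mult.commute)
  finally show ?thesis .
qed

text \<open>For a word the scalar equation is multiplied by the constant
  \<open>cinner u (word_op Z w v)\<close>. Both sides are linear in \<open>x\<close>, which gives
  all of \<open>A0 Z\<close>.\<close>

lemma flow_has_integral:
  fixes f g :: "real \<Rightarrow> complex ^ 'n" and u v :: 'h
  assumes x: "x \<in> A0 Z" and f: "f \<in> Lstep" and g: "g \<in> Lstep" and t: "0 \<le> t"
  defines "m \<equiv> \<lambda>x t. cinner (u \<otimes>\<^sub>H varpi f) (flow t x (v \<otimes>\<^sub>H varpi g))"
  shows "((\<lambda>s. \<Sum>\<alpha>\<in>UNIV. \<Sum>\<beta>\<in>UNIV. cnj (hat (f s) $ \<alpha>) * hat (g s) $ \<beta> * m (coef x \<alpha> \<beta>) s)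
    has_integral (m x t - m x 0)) {0..t}"
  using x
proof (induction x rule: A0_ind)
  case (word w)
  define \<xi> where "\<xi> = xi (\<lambda>j. charge j w)"
  have m: "m (word_op Z w) s = cinner u (word_op Z w v) *
      cinner (varpi f) (weyl (l2 (pulse s \<xi>)) (varpi g))" if "0 \<le> s" for s
    using that by (simp add: m_def flow_word op_tensor_apply word_op_bop Z_bop weyl(1)
        cinner_htensor W_def \<xi>_def)
  show ?case
  proof (rule has_integral_eq[rotated])
    show "((\<lambda>s. cinner u (word_op Z w v) * ((cinner (f s) \<xi> - cinner \<xi> (g s) - of_real ((norm \<xi>)\<^sup>2) / 2) *
        cinner (varpi f) (weyl (l2 (pulse s \<xi>)) (varpi g))))
      has_integral (m (word_op Z w) t - m (word_op Z w) 0)) {0..t}"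
      using has_integral_mult_right[OF weyl_pulse_has_integral[OF f g t, of \<xi>], of "cinner u (word_op Z w v)"] t
      by (simp add: m right_diff_distrib)
    fix s assume "s \<in> {0..t}"
    then have s: "0 \<le> s" by simp
    show "cinner u (word_op Z w v) * ((cinner (f s) \<xi> - cinner \<xi> (g s) - of_real ((norm \<xi>)\<^sup>2) / 2) *
        cinner (varpi f) (weyl (l2 (pulse s \<xi>)) (varpi g))) =
      (\<Sum>\<alpha>\<in>UNIV. \<Sum>\<beta>\<in>UNIV. cnj (hat (f s) $ \<alpha>) * hat (g s) $ \<beta> * m (coef (word_op Z w) \<alpha> \<beta>) s)"
      using sum_coef_word[OF s, of "f s" "g s" "u \<otimes>\<^sub>H varpi f" w "v \<otimes>\<^sub>H varpi g"] m[OF s]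
      by (simp add: m_def \<xi>_def mult_ac)
  qed
next
  case (add x y)
  have m_add: "m (x + y) s = m x s + m y s" if "x \<in> A0 Z" "y \<in> A0 Z" "0 \<le> s" for x y s
    using that by (simp add: m_def flow_add blinfun.add_left cinner_add_right)
  show ?case
  proof (rule has_integral_eq[rotated])
    show "((\<lambda>s. (\<Sum>\<alpha>\<in>UNIV. \<Sum>\<beta>\<in>UNIV. cnj (hat (f s) $ \<alpha>) * hat (g s) $ \<beta> * m (coef x \<alpha> \<beta>) s) +
        (\<Sum>\<alpha>\<in>UNIV. \<Sum>\<beta>\<in>UNIV. cnj (hat (f s) $ \<alpha>) * hat (g s) $ \<beta> * m (coef y \<alpha> \<beta>) s))
      has_integral (m (x + y) t - m (x + y) 0)) {0..t}"
      using has_integral_add[OF add.IH] t add.hyps by (simp add: m_add algebra_simps)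
  qed (use add.hyps in \<open>simp add: coef_add coef_A0 m_add distrib_left sum.distrib\<close>)
next
  case (scaleC a x)
  have m_scaleC: "m (a *\<^sub>C x) s = a * m x s" if "x \<in> A0 Z" "0 \<le> s" for x s
    using that by (simp add: m_def flow_scaleC scaleC_blinfun.rep_eq cinner_scaleC_right)
  show ?case
  proof (rule has_integral_eq[rotated])
    show "((\<lambda>s. a * (\<Sum>\<alpha>\<in>UNIV. \<Sum>\<beta>\<in>UNIV. cnj (hat (f s) $ \<alpha>) * hat (g s) $ \<beta> * m (coef x \<alpha> \<beta>) s))
      has_integral (m (a *\<^sub>C x) t - m (a *\<^sub>C x) 0)) {0..t}"
      using has_integral_mult_right[OF scaleC.IH, of a] t scaleC.hyps
      by (simp add: m_scaleC right_diff_distrib)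
  qed (use scaleC.hyps in \<open>simp add: coef_scaleC coef_A0 m_scaleC sum_distrib_left mult_ac\<close>)
qed

text \<open>The fundamental theorem yields a gauge integral; the integrand is regulated, hence
  absolutely integrable, so the Lebesgue integral has the same value.\<close>

lemma J_equation:
  assumes x: "x \<in> A0 Z" and f: "f \<in> Lstep" and g: "g \<in> Lstep" and t: "0 \<le> t"
  shows "cinner (u \<otimes>\<^sub>H varpi f) (J t x (v \<otimes>\<^sub>H varpi g) - J 0 x (v \<otimes>\<^sub>H varpi g)) =
    (LINT s:{0..t}|lebesgue. cinner (u \<otimes>\<^sub>H varpi f)
      (cadj (\<lambda>\<theta>. \<theta> \<otimes>\<^sub>F hat (f s))
        (jtilde (J s) (phi c d x) ((v \<otimes>\<^sub>H varpi g) \<otimes>\<^sub>F hat (g s)))))"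
proof -
  let ?I = "\<lambda>s. cinner (u \<otimes>\<^sub>H varpi f) (cadj (\<lambda>\<theta>. \<theta> \<otimes>\<^sub>F hat (f s))
        (jtilde (J s) (phi c d x) ((v \<otimes>\<^sub>H varpi g) \<otimes>\<^sub>F hat (g s))))"
  have I: "?I s = cinner ((u \<otimes>\<^sub>H varpi f) \<otimes>\<^sub>F hat (f s))
      (jtilde (J s) (phi c d x) ((v \<otimes>\<^sub>H varpi g) \<otimes>\<^sub>F hat (g s)))" for s
    by (rule cinner_cadj_ftensor)
  have "regulated (\<lambda>s. (u \<otimes>\<^sub>H varpi f) \<otimes>\<^sub>F hat (f s))"
  proof (rule regulated_vec)
    show "regulated (\<lambda>s. ((u \<otimes>\<^sub>H varpi f) \<otimes>\<^sub>F hat (f s)) $ \<alpha>)" for \<alpha>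
      by (simp add: ftensor_def regulated_linear[OF scaleC.bounded_linear_left] regulated_hat f)
  qed
  then have "regulated ?I"
    unfolding I
    by (intro regulated_bilinear[OF bounded_bilinear_cinner] regulated_jtilde x g htensor_varpi_hEdom)
  then have "(LINT s:{0..t}|lebesgue. ?I s) = integral {0..t} ?I"
    by (intro set_lebesgue_integral_eq_integral(2) regulated_set_integrable)
  also have "(?I has_integral cinner (u \<otimes>\<^sub>H varpi f) (flow t x (v \<otimes>\<^sub>H varpi g))
      - cinner (u \<otimes>\<^sub>H varpi f) (flow 0 x (v \<otimes>\<^sub>H varpi g))) {0..t}"
    by (rule has_integral_eq[OF _ flow_has_integral[OF x f g t]])
      (simp add: I cinner_ftensor_jtilde[OF x])
  then have "integral {0..t} ?I = cinner (u \<otimes>\<^sub>H varpi f) (J t x (v \<otimes>\<^sub>H varpi g) - J 0 x (v \<otimes>\<^sub>H varpi g))"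
    by (simp add: integral_unique J_def cinner_diff_right)
  finally show ?thesis by simp
qed

lemma strong_solution_J: "strong_solution Z (phi c d) J"
  unfolding strong_solution_def solution_def
  using operator_process_J integrable_process_J J_equation
  by (simp add: clinear_on_def J_def flow_add flow_scaleC blinfun.add_left scaleC_blinfun.rep_eq
      flow_zero)

text \<open>Each \<open>flow t x\<close> is a bounded operator with a true adjoint, so the weak form
  follows from the homomorphism property on the closure.\<close>

lemma weakly_multiplicative_J: "weakly_multiplicative Z J"
  unfolding weakly_multiplicative_def
proof (intro allI impI ballI)
  fix t x y and \<zeta> \<xi> :: "('h, 'n) hF"
  assume t: "0 \<le> (t :: real)" and xy: "x \<in> A0 Z" "y \<in> A0 Z"
  have "flow t (adj x o\<^sub>L y) = adj (flow t x) o\<^sub>L flow t y"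
    using star_hom_flow[OF t] xy A0_adj A0_Aclosed by (simp add: star_hom_def)
  then show "cinner (J t x \<zeta>) (J t y \<xi>) = cinner \<zeta> (J t (adj x o\<^sub>L y) \<xi>)"
    by (simp add: J_def cinner_adj[OF flow_bop[OF t xy(1)]])
qed

end

theorem proposition5p11:
  fixes K :: sphere
    and Z :: "'n :: finite \<Rightarrow> 'h :: hilbert_space \<Rightarrow>\<^sub>L 'h"
    and c :: "'n \<Rightarrow> complex"
  assumes "sphere_in_B K Z"
  shows "\<exists>d.
    (\<forall>i. charge_derivation Z i (d i)) \<and>
    (\<forall>i D. charge_derivation Z i D \<longrightarrow> (\<forall>x\<in>A0 Z. D x = d i x)) \<and>
    (\<forall>x\<in>A0 Z. phi c d x \<in> A0_tensor_B Z) \<and>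
    (\<exists>j. strong_solution Z (phi c d) j \<and> weakly_multiplicative Z j \<and>
      (\<forall>t\<ge>0. \<exists>\<pi> :: ('h \<Rightarrow>\<^sub>L 'h) \<Rightarrow> (('h, 'n) hF \<Rightarrow>\<^sub>L ('h, 'n) hF).
        star_hom (Aclosed Z) \<pi> \<and> (\<forall>x\<in>A0 Z. \<forall>\<xi>\<in>hEdom. \<pi> x \<xi> = j t x \<xi>)))"
proof -
  interpret sphere_flow K Z c by standard (rule assms)
  show ?thesis
  proof (intro exI[of _ d] conjI allI impI ballI exI[of _ J])
    show d: "charge_derivation Z i (d i)" for i
      by (rule charge_derivation_charge_deriv[OF sphere])
    show "D x = d i x" if "charge_derivation Z i D" "x \<in> A0 Z" for i D x
      using charge_derivation_unique[of Z, OF Z_bop that(1) d that(2)] .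
    \<comment> \<open>The extension is \<open>flow t\<close> itself: \<open>J t\<close> was defined
      as the action of these operators.\<close>
    show "\<exists>\<pi> :: ('h \<Rightarrow>\<^sub>L 'h) \<Rightarrow> (('h, 'n) hF \<Rightarrow>\<^sub>L ('h, 'n) hF).
        star_hom (Aclosed Z) \<pi> \<and> (\<forall>x\<in>A0 Z. \<forall>\<xi>\<in>hEdom. \<pi> x \<xi> = J t x \<xi>)" if "0 \<le> t" for t
      using star_hom_flow[OF that] by (auto simp: J_def)
  qed (fact phi_in_A0_tensor_B strong_solution_J weakly_multiplicative_J)+
qed

end
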